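(* Suppose $u\in C^1\big([0,T_{max});\dot H^2_{\mathcal M}\big)$ is a solution of the Fourier-restricted Euler equation. Then for all $0\le t<T_{max}$ the evolution of enstrophy can be expressed equivalently by $$\frac{d}{dt}\frac12\|\nabla u(\cdot,t)\|_{L^2}^2=-\langle(u\cdot\nabla)u,-\Delta u\rangle,$$ $$\frac{d}{dt}\frac12\|\omega(\cdot,t)\|_{L^2}^2=\langle S,\omega\otimes\omega\rangle,$$ $$\frac{d}{dt}\|S(\cdot,t)\|_{L^2}^2=-4\int_{\mathbb T^3}\det(S).$$ In particular, $$\frac{d}{dt}\|S(\cdot,t)\|_{L^2}^2\le2\int_{\mathbb T^3}\lambda_2^+|S|^2.$$
   Context: Function spaces: $\mathbb T^3=\mathbb R^3/\mathbb Z^3$, $\hat u(k)=\int_{\mathbb T^3}u(x)e^{-2\pi i k\cdot x}\,dx$ for $k\in\mathbb Z^3$. For $s\ge0$, $\dot H^s=\dot H^s(\mathbb T^3;\mathbb R^3)$ is the space of mean-zero $L^2$ vector fields with $\|u\|_{\dot H^s}^2=\sum_{k\ne0}(4\pi^2|k|^2)^s|\hat u(k)|^2<\infty$; $\langle\cdot,\cdot\rangle$ is the $L^2(\mathbb T^3)$ inner product. Frequencies: let $\sigma=(1,1,1)$. For integers $m\ge0$ let $k^m=2^{2m}\sigma+3^m(1,0,-1)$, $h^m=2^{2m+1}\sigma+3^m(1,1,-2)$, $j^m=2^{2m+1}\sigma+3^m(2,-1,-1)$. For $v\in\mathbb R^3$, $\mathcal P[v]$ is the set of all vectors obtained by permuting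 the entries of $v$. Let $\mathcal M^+_{2m}=\mathcal P[k^m]$, $\mathcal M^+_{2m+1}=\mathcal P[h^m]\cup\mathcal P[j^m]$, $\mathcal M^+=\bigcup_{n\ge0}\mathcal M_n^+$, $\mathcal M=\mathcal M^+\cup(-\mathcal M^+)$. For $k\in\mathcal M$ let $P_k^\perp(\sigma)=\sigma-\frac{k\cdot\sigma}{|k|^2}k$ and $v^k=P_k^\perp(\sigma)/|P_k^\perp(\sigma)|$. Constraint space: $\dot H^s_{\mathcal M}$ is the set of $u\in\dot H^s(\mathbb T^3;\mathbb R^3)$ with $\operatorname{supp}\hat u\subset\mathcal M$ and $\hat u(k)\in\operatorname{span}\{v^k\}$ (complex multiples of $v^k$) for all $k\in\mathcal M$; such fields are divergence free. The projection $\mathbb P_{\mathcal M}$ is given by $\widehat{\mathbb P_{\mathcal M}w}(k)=(v^k\cdot\hat w(k))v^k$ for $k\in\mathcal M$ and $0$ for $k\notin\mathcal M$. The Fourier-restricted Euler equation is $\partial_tu+\mathbb P_{\mathcal M}((u\cdot\nabla)u)=0$. $\omega=\nabla\times u$ is the vorticity, $S_{ij}=\frac12(\partial_iu_j+\partial_ju_i)$ the strain matrix with eigenvalues $\lambda_1\le\lambda_2\le\lambda_3$, $|S|$ its Frobenius norm, and $f^+=\max(f,0)$. *)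

theory Defs
  imports "HOL-Analysis.Analysis"
begin

text \<open>
  Functions on the torus \<open>\<real>\<^sup>3/\<int>\<^sup>3\<close> are represented by functions on \<open>real ^ 3\<close> that are
  1-periodic in every coordinate. Integrals over the torus are integrals over the unit cube.
  An element of a function space is any Borel representative of its almost-everywhere class.
\<close>

section \<open>Square-integrable functions on the torus and their Fourier coefficients\<close>

abbreviation torus :: "(real ^ 3) measure" where
  "torus \<equiv> restrict_space lborel (cbox 0 1)"

definition periodic :: "(real ^ 3 \<Rightarrow> 'a) \<Rightarrow> bool" where
  "periodic f \<longleftrightarrow> (\<forall>x i. f (x + axis i 1) = f x)"

definition L2 :: "(real ^ 3 \<Rightarrow> 'a :: real_normed_vector) set" where
  "L2 = {f. periodic f \<and> f \<in> borel_measurable borel \<and> integrable torus (\<lambda>x. (norm (f x))\<^sup>2)}"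

text \<open>On matrix fields, \<open>\<bullet>\<close> and \<open>norm\<close> of \<open>real ^ 3 ^ 3\<close> are the Frobenius product and norm.\<close>

definition L2_inner :: "(real ^ 3 \<Rightarrow> 'a) \<Rightarrow> (real ^ 3 \<Rightarrow> 'a :: real_inner) \<Rightarrow> real" where
  "L2_inner f g = (LINT x|torus. f x \<bullet> g x)"

definition L2_norm :: "(real ^ 3 \<Rightarrow> 'a :: real_normed_vector) \<Rightarrow> real" where
  "L2_norm f = sqrt (LINT x|torus. (norm (f x))\<^sup>2)"

definition rvec :: "int ^ 3 \<Rightarrow> real ^ 3" where
  "rvec k = (\<chi> i. real_of_int (k $ i))"

definition cvec :: "real ^ 3 \<Rightarrow> complex ^ 3" where
  "cvec v = (\<chi> i. complex_of_real (v $ i))"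

definition fourier :: "(real ^ 3 \<Rightarrow> real ^ 3) \<Rightarrow> int ^ 3 \<Rightarrow> complex ^ 3" where
  "fourier u k =
     (\<chi> i. LINT x|torus. complex_of_real (u x $ i) * cis (- (2 * pi * (rvec k \<bullet> x))))"

section \<open>Homogeneous Sobolev spaces\<close>

definition Hdot_weight :: "real \<Rightarrow> (real ^ 3 \<Rightarrow> real ^ 3) \<Rightarrow> int ^ 3 \<Rightarrow> real" where
  "Hdot_weight s u k = (4 * pi\<^sup>2 * (norm (rvec k))\<^sup>2) powr s * (norm (fourier u k))\<^sup>2"

definition Hdot :: "real \<Rightarrow> (real ^ 3 \<Rightarrow> real ^ 3) set" where
  "Hdot s = {u \<in> L2. (LINT x|torus. u x) = 0 \<and> Hdot_weight s u summable_on {k. k \<noteq> 0}}"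

definition Hdot_norm :: "real \<Rightarrow> (real ^ 3 \<Rightarrow> real ^ 3) \<Rightarrow> real" where
  "Hdot_norm s u = sqrt (\<Sum>\<^sub>\<infinity>k\<in>{k. k \<noteq> 0}. Hdot_weight s u k)"

section \<open>The frequency set and the constraint space\<close>

definition sigma :: "int ^ 3" where
  "sigma = vector [1, 1, 1]"

definition kfreq :: "nat \<Rightarrow> int ^ 3" where
  "kfreq m = 2 ^ (2 * m) *s sigma + 3 ^ m *s vector [1, 0, -1]"

definition hfreq :: "nat \<Rightarrow> int ^ 3" where
  "hfreq m = 2 ^ (2 * m + 1) *s sigma + 3 ^ m *s vector [1, 1, -2]"

definition jfreq :: "nat \<Rightarrow> int ^ 3" where
  "jfreq m = 2 ^ (2 * m + 1) *s sigma + 3 ^ m *s vector [2, -1, -1]"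

definition perms :: "int ^ 3 \<Rightarrow> (int ^ 3) set" where
  "perms v = {\<chi> i. v $ p i | p. bij p}"

definition Mplus_level :: "nat \<Rightarrow> (int ^ 3) set" where
  "Mplus_level n =
     (if even n then perms (kfreq (n div 2))
      else perms (hfreq (n div 2)) \<union> perms (jfreq (n div 2)))"

definition Mplus :: "(int ^ 3) set" where
  "Mplus = (\<Union>n. Mplus_level n)"

definition Mset :: "(int ^ 3) set" where
  "Mset = Mplus \<union> uminus ` Mplus"

definition Pperp :: "real ^ 3 \<Rightarrow> real ^ 3 \<Rightarrow> real ^ 3" where
  "Pperp k w = w - ((k \<bullet> w) / (norm k)\<^sup>2) *\<^sub>R k"

definition vdir :: "int ^ 3 \<Rightarrow> real ^ 3" where
  "vdir k = (1 / norm (Pperp (rvec k) (rvec sigma))) *\<^sub>R Pperp (rvec k) (rvec sigma)"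

definition HdotM :: "real \<Rightarrow> (real ^ 3 \<Rightarrow> real ^ 3) set" where
  "HdotM s = {u \<in> Hdot s. (\<forall>k. k \<notin> Mset \<longrightarrow> fourier u k = 0) \<and>
     (\<forall>k\<in>Mset. \<exists>c. fourier u k = c *s cvec (vdir k))}"

text \<open>\<open>is_projM w g\<close> says that \<open>g\<close> is (a representative of) the projection of \<open>w\<close>.\<close>

definition is_projM :: "(real ^ 3 \<Rightarrow> real ^ 3) \<Rightarrow> (real ^ 3 \<Rightarrow> real ^ 3) \<Rightarrow> bool" where
  "is_projM w g \<longleftrightarrow> g \<in> L2 \<and>
     (\<forall>k. fourier g k =
        (if k \<in> Mset
         then (\<Sum>i\<in>UNIV. complex_of_real (vdir k $ i) * fourier w k $ i) *s cvec (vdir k)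
         else 0))"

section \<open>Weak derivatives and the derived fields\<close>

definition test_function :: "(real ^ 3 \<Rightarrow> real) \<Rightarrow> bool" where
  "test_function \<phi> \<longleftrightarrow> periodic \<phi> \<and> (\<forall>x. \<phi> differentiable at x) \<and>
     (\<forall>v. continuous_on UNIV (\<lambda>x. frechet_derivative \<phi> (at x) v))"

definition is_weak_deriv :: "3 \<Rightarrow> (real ^ 3 \<Rightarrow> real) \<Rightarrow> (real ^ 3 \<Rightarrow> real) \<Rightarrow> bool" where
  "is_weak_deriv j f g \<longleftrightarrow> g \<in> L2 \<and>
     (\<forall>\<phi>. test_function \<phi> \<longrightarrow>
        (LINT x|torus. f x * frechet_derivative \<phi> (at x) (axis j 1))
          = - (LINT x|torus. g x * \<phi> x))"

text \<open>A representative of the weak derivative, which is unique up to null sets.\<close>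

definition weak_deriv :: "3 \<Rightarrow> (real ^ 3 \<Rightarrow> real) \<Rightarrow> real ^ 3 \<Rightarrow> real" where
  "weak_deriv j f = (SOME g. is_weak_deriv j f g)"

definition grad :: "(real ^ 3 \<Rightarrow> real ^ 3) \<Rightarrow> real ^ 3 \<Rightarrow> real ^ 3 ^ 3" where
  "grad u x = (\<chi> i j. weak_deriv j (\<lambda>y. u y $ i) x)"

definition laplacian :: "(real ^ 3 \<Rightarrow> real ^ 3) \<Rightarrow> real ^ 3 \<Rightarrow> real ^ 3" where
  "laplacian u x = (\<chi> i. \<Sum>j\<in>UNIV. weak_deriv j (weak_deriv j (\<lambda>y. u y $ i)) x)"

definition advection :: "(real ^ 3 \<Rightarrow> real ^ 3) \<Rightarrow> (real ^ 3 \<Rightarrow> real ^ 3) \<Rightarrow> real ^ 3 \<Rightarrow> real ^ 3" where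
  "advection u w x = (\<chi> i. \<Sum>j\<in>UNIV. u x $ j * weak_deriv j (\<lambda>y. w y $ i) x)"

definition vorticity :: "(real ^ 3 \<Rightarrow> real ^ 3) \<Rightarrow> real ^ 3 \<Rightarrow> real ^ 3" where
  "vorticity u x = vector
     [weak_deriv 2 (\<lambda>y. u y $ 3) x - weak_deriv 3 (\<lambda>y. u y $ 2) x,
      weak_deriv 3 (\<lambda>y. u y $ 1) x - weak_deriv 1 (\<lambda>y. u y $ 3) x,
      weak_deriv 1 (\<lambda>y. u y $ 2) x - weak_deriv 2 (\<lambda>y. u y $ 1) x]"

definition strain :: "(real ^ 3 \<Rightarrow> real ^ 3) \<Rightarrow> real ^ 3 \<Rightarrow> real ^ 3 ^ 3" where
  "strain u x = (1 / 2) *\<^sub>R (grad u x + transpose (grad u x))"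

definition outer :: "real ^ 3 \<Rightarrow> real ^ 3 \<Rightarrow> real ^ 3 ^ 3" where
  "outer a b = (\<chi> i j. a $ i * b $ j)"

text \<open>
  The middle eigenvalue of a symmetric matrix: the eigenvalues, with multiplicity, are the roots
  of the characteristic polynomial \<open>det (z I - A)\<close>.
\<close>

definition lambda2 :: "real ^ 3 ^ 3 \<Rightarrow> real" where
  "lambda2 A = (THE b. \<exists>a c. a \<le> b \<and> b \<le> c \<and>
     (\<forall>z. det (mat z - A) = (z - a) * (z - b) * (z - c)))"

section \<open>Solutions of the Fourier-restricted Euler equation\<close>

text \<open>The end point may be infinite.\<close>

definition time_interval :: "ereal \<Rightarrow> real set" where
  "time_interval T = {t. 0 \<le> t \<and> ereal t < T}"

text \<open>
  \<open>u\<close> is a continuously differentiable map from \<open>[0, T)\<close> into the constraint space, with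
  derivative \<open>u'\<close>; both limits are in the norm of that space, and one-sided at time 0.
\<close>

definition C1_HdotM ::
  "real \<Rightarrow> ereal \<Rightarrow> (real \<Rightarrow> real ^ 3 \<Rightarrow> real ^ 3) \<Rightarrow> (real \<Rightarrow> real ^ 3 \<Rightarrow> real ^ 3) \<Rightarrow> bool" where
  "C1_HdotM s T u u' \<longleftrightarrow> (\<forall>t\<in>time_interval T.
     u t \<in> HdotM s \<and> u' t \<in> HdotM s \<and>
     ((\<lambda>r. Hdot_norm s (\<lambda>x. (1 / (r - t)) *\<^sub>R (u r x - u t x) - u' t x)) \<longlongrightarrow> 0)
        (at t within time_interval T) \<and>
     ((\<lambda>r. Hdot_norm s (\<lambda>x. u' r x - u' t x)) \<longlongrightarrow> 0) (at t within time_interval T))"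

definition restricted_Euler_solution ::
  "real \<Rightarrow> ereal \<Rightarrow> (real \<Rightarrow> real ^ 3 \<Rightarrow> real ^ 3) \<Rightarrow> bool" where
  "restricted_Euler_solution s T u \<longleftrightarrow> (\<exists>u'. C1_HdotM s T u u' \<and>
     (\<forall>t\<in>time_interval T. \<exists>N. is_projM (advection (u t) (u t)) N \<and>
        (AE x in torus. u' t x + N x = 0)))"

end

theory Submission
  imports Defs
begin

text \<open>
  The frequency set is lacunary, so \<open>\<Sum>\<^sub>k 1/|k|\<^sup>2\<close> converges over it, and for a field with coefficients
  \<open>c\<^sub>k\<close> in the constraint space of order 2 the series \<open>\<Sum>\<^sub>k |k| |c\<^sub>k|\<close> converges: the field and its
  gradient are bounded, while its second derivatives are square integrable. Hence the cubic
  integrals are limits of those of trigonometric truncations, for which integration by parts is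
  elementary and gives \<open>\<langle>(u\<cdot>\<nabla>)u, -\<Delta>u\<rangle> = \<integral> tr(A A A\<^sup>T)\<close> and \<open>\<integral> tr(A\<^sup>3) = 0\<close> with \<open>A = \<nabla>u\<close>. For a
  trace-free \<open>A\<close> both \<open>S \<bullet> (\<omega>\<otimes>\<omega>)\<close> and \<open>4 det S\<close> are linear combinations of these two integrands. In
  time, half the squared norm of the gradient is a quadratic form of the Fourier coefficients; its
  derivative pairs \<open>-\<Delta>u\<close> with \<open>\<partial>\<^sub>t u\<close>, and the projection can be dropped because \<open>-\<Delta>u\<close> lies in the
  constraint space.
\<close>

section \<open>Square-integrable functions on the torus\<close>

text \<open>The derivatives in the statement are weak derivatives picked by choice, so nothing is
  known about them until an \<open>L2\<close> function with the right Fourier coefficients exists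
  and coefficients determine a function almost everywhere. Hence completeness of \<open>L2\<close>,
  uniqueness of Fourier coefficients and Parseval come before any fluid mechanics. Second
  derivatives are only square integrable, so at most one factor of a cubic integral may converge
  merely in \<open>L2\<close>; the others must also stay uniformly bounded. The three rates of
  change coincide because the integral of tr(A^2) vanishes for divergence-free fields: half the
  squared norm of A, half that of the vorticity and the squared norm of S agree at every time, and
  only one of them has to be differentiated. The last inequality needs integrability, hence
  measurability, of \<open>lambda2\<close>, which is given by a definite description; it is obtained
  by expressing \<open>lambda2 A \<le> q\<close> through polynomial inequalities in the entries of
  A.\<close>

lemma finite_measure_torus: "finite_measure torus"
  by (rule finite_measureI) (simp add: emeasure_restrict_space space_restrict_space emeasure_lborel_cbox_eq)

interpretation torus: finite_measure torus
  by (rule finite_measure_torus)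

lemma borel_measurable_torus:
  fixes f :: "real ^ 3 \<Rightarrow> 'a :: topological_space"
  shows "f \<in> borel_measurable borel \<Longrightarrow> f \<in> borel_measurable torus"
  by (rule measurable_restrict_space1) (simp cong: measurable_cong_sets)

lemma measure_torus [simp]: "measure torus (cbox 0 1) = 1"
proof -
  have "(\<Prod>b\<in>Basis. (1 :: real ^ 3) \<bullet> b) = 1"
    by (rule prod.neutral) (auto simp: Basis_vec_def inner_axis)
  moreover have "\<forall>b\<in>Basis. 0 \<le> (1 :: real ^ 3) \<bullet> b"
    by (auto simp: Basis_vec_def inner_axis)
  ultimately show ?thesis
    by (simp add: measure_def emeasure_restrict_space space_restrict_space emeasure_lborel_cbox_eq)
qed

lemma L2_periodic: "f \<in> L2 \<Longrightarrow> periodic f"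
  and L2_borel: "f \<in> L2 \<Longrightarrow> f \<in> borel_measurable borel"
  and L2_measurable: "f \<in> L2 \<Longrightarrow> f \<in> borel_measurable torus"
  by (auto simp: L2_def intro: borel_measurable_torus)

lemma L2_integrable_square:
  fixes f :: "real ^ 3 \<Rightarrow> real"
  shows "f \<in> L2 \<Longrightarrow> integrable torus (\<lambda>x. (f x)\<^sup>2)"
  by (simp add: L2_def)

lemma L2_integrable:
  fixes f :: "real ^ 3 \<Rightarrow> real"
  shows "f \<in> L2 \<Longrightarrow> integrable torus f"
  by (rule torus.square_integrable_imp_integrable[OF L2_measurable L2_integrable_square])

lemma two_mult_le_squares: "\<bar>a * b\<bar> \<le> a\<^sup>2 + b\<^sup>2" for a b :: real
proof -
  have "2 * \<bar>a\<bar> * \<bar>b\<bar> \<le> \<bar>a\<bar>\<^sup>2 + \<bar>b\<bar>\<^sup>2"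
    by (rule sum_squares_bound)
  moreover have "0 \<le> \<bar>a\<bar> * \<bar>b\<bar>" by simp
  ultimately have "\<bar>a\<bar> * \<bar>b\<bar> \<le> \<bar>a\<bar>\<^sup>2 + \<bar>b\<bar>\<^sup>2" by linarith
  then show ?thesis by (simp add: abs_mult)
qed

lemma L2_integrable_mult:
  fixes f g :: "real ^ 3 \<Rightarrow> real"
  assumes "f \<in> L2" "g \<in> L2"
  shows "integrable torus (\<lambda>x. f x * g x)"
proof (rule Bochner_Integration.integrable_bound)
  show "integrable torus (\<lambda>x. (f x)\<^sup>2 + (g x)\<^sup>2)"
    using assms by (intro Bochner_Integration.integrable_add L2_integrable_square)
  show "(\<lambda>x. f x * g x) \<in> borel_measurable torus"
    using assms[THEN L2_measurable] by measurable
  show "AE x in torus. norm (f x * g x) \<le> norm ((f x)\<^sup>2 + (g x)\<^sup>2)"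
    using two_mult_le_squares by auto
qed

lemma L2_bounded:
  fixes f :: "real ^ 3 \<Rightarrow> real"
  assumes "periodic f" "f \<in> borel_measurable borel" "AE x in torus. \<bar>f x\<bar> \<le> C"
  shows "f \<in> L2"
  unfolding L2_def
proof (intro CollectI conjI assms)
  have [measurable]: "f \<in> borel_measurable torus"
    using assms(2) by (rule borel_measurable_torus)
  show "integrable torus (\<lambda>x. (norm (f x))\<^sup>2)"
  proof (rule torus.integrable_const_bound[where B = "C\<^sup>2"])
    show "AE x in torus. norm ((norm (f x))\<^sup>2) \<le> C\<^sup>2"
      using assms(3) by eventually_elim (simp add: power2_le_iff_abs_le)
  qed measurable
qed

lemma L2_add:
  fixes f g :: "real ^ 3 \<Rightarrow> real"
  assumes "f \<in> L2" "g \<in> L2"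
  shows "(\<lambda>x. f x + g x) \<in> L2"
  unfolding L2_def
proof (intro CollectI conjI)
  show "periodic (\<lambda>x. f x + g x)"
    using assms[THEN L2_periodic] by (simp add: periodic_def)
  show "(\<lambda>x. f x + g x) \<in> borel_measurable borel"
    using assms[THEN L2_borel] by measurable
  have "integrable torus (\<lambda>x. (f x)\<^sup>2 + (g x)\<^sup>2 + 2 * (f x * g x))"
    using assms by (intro Bochner_Integration.integrable_add L2_integrable_square
        integrable_mult_right L2_integrable_mult)
  then show "integrable torus (\<lambda>x. (norm (f x + g x))\<^sup>2)"
    by (simp add: power2_sum algebra_simps)
qed

lemma L2_cmult:
  fixes f :: "real ^ 3 \<Rightarrow> real"
  assumes "f \<in> L2"
  shows "(\<lambda>x. c * f x) \<in> L2"
  using assms unfolding L2_def periodic_def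
  by (auto simp: power_mult_distrib abs_mult)

lemma L2_minus:
  fixes f :: "real ^ 3 \<Rightarrow> real"
  assumes "f \<in> L2"
  shows "(\<lambda>x. - f x) \<in> L2"
  using L2_cmult[OF assms, of "-1"] by simp

lemma L2_diff:
  fixes f g :: "real ^ 3 \<Rightarrow> real"
  assumes "f \<in> L2" "g \<in> L2"
  shows "(\<lambda>x. f x - g x) \<in> L2"
  using L2_add[OF assms(1) L2_minus[OF assms(2)]] by simp

lemma L2_const: "(\<lambda>x. c :: real) \<in> L2"
  by (rule L2_bounded[where C = "\<bar>c\<bar>"]) (auto simp: periodic_def)

lemma L2_sum:
  fixes f :: "'i \<Rightarrow> real ^ 3 \<Rightarrow> real"
  assumes "\<And>i. i \<in> I \<Longrightarrow> f i \<in> L2"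
  shows "(\<lambda>x. \<Sum>i\<in>I. f i x) \<in> L2"
  using assms
  by (induction I rule: infinite_finite_induct) (auto intro: L2_const L2_add)

lemma L2_mult_bounded:
  fixes f g :: "real ^ 3 \<Rightarrow> real"
  assumes f: "f \<in> L2" and g: "g \<in> L2" and bd: "AE x in torus. \<bar>g x\<bar> \<le> C"
  shows "(\<lambda>x. f x * g x) \<in> L2"
  unfolding L2_def
proof (intro CollectI conjI)
  show "periodic (\<lambda>x. f x * g x)"
    using f[THEN L2_periodic] g[THEN L2_periodic] by (simp add: periodic_def)
  show "(\<lambda>x. f x * g x) \<in> borel_measurable borel"
    using f[THEN L2_borel] g[THEN L2_borel] by measurable
  have [measurable]: "f \<in> borel_measurable torus" "g \<in> borel_measurable torus"
    using f g by (auto intro: L2_measurable)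
  show "integrable torus (\<lambda>x. (norm (f x * g x))\<^sup>2)"
  proof (rule Bochner_Integration.integrable_bound)
    show "integrable torus (\<lambda>x. C\<^sup>2 * (f x)\<^sup>2)"
      using f by (intro integrable_mult_right L2_integrable_square)
    show "AE x in torus. norm ((norm (f x * g x))\<^sup>2) \<le> norm (C\<^sup>2 * (f x)\<^sup>2)"
      using bd
    proof eventually_elim
      case (elim x)
      then have "(g x)\<^sup>2 \<le> C\<^sup>2" by (simp add: power2_le_iff_abs_le)
      then show ?case
        using mult_right_mono[of "(g x)\<^sup>2" "C\<^sup>2" "(f x)\<^sup>2"]
        by (simp add: power_mult_distrib abs_mult mult.commute)
    qed
  qed measurable
qed

lemma quadratic_nonneg_imp:
  fixes A B C :: real
  assumes nonneg: "\<And>t. 0 \<le> t\<^sup>2 * A + 2 * t * C + B" and "0 \<le> A"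
  shows "C\<^sup>2 \<le> A * B"
proof (cases "A = 0")
  case True
  have "C = 0"
  proof (rule ccontr)
    assume "C \<noteq> 0"
    \<comment> \<open>At this t the affine function 2 * t * C + B takes the value -1.\<close>
    then show False
      using nonneg[of "- (B + 1) / (2 * C)"] True by (simp add: field_simps)
  qed
  then show ?thesis using True by simp
next
  case False
  with \<open>0 \<le> A\<close> have "0 < A" by simp
  have "(- C / A)\<^sup>2 * A + 2 * (- C / A) * C + B = B - C\<^sup>2 / A"
    using \<open>0 < A\<close> by (simp add: field_simps power2_eq_square)
  with nonneg[of "- C / A"] have "C\<^sup>2 / A \<le> B" by simp
  then show ?thesis using \<open>0 < A\<close> by (simp add: pos_divide_le_eq mult.commute)
qed

lemma L2_Cauchy_Schwarz:
  fixes f g :: "real ^ 3 \<Rightarrow> real"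
  assumes "f \<in> L2" "g \<in> L2"
  shows "(LINT x|torus. f x * g x)\<^sup>2 \<le> (LINT x|torus. (f x)\<^sup>2) * (LINT x|torus. (g x)\<^sup>2)"
proof (rule quadratic_nonneg_imp)
  note ints = L2_integrable_square[OF assms(1)] L2_integrable_square[OF assms(2)]
    L2_integrable_mult[OF assms]
  show "0 \<le> t\<^sup>2 * (LINT x|torus. (f x)\<^sup>2) + 2 * t * (LINT x|torus. f x * g x) + (LINT x|torus. (g x)\<^sup>2)" for t
  proof -
    have "0 \<le> (LINT x|torus. (t * f x + g x)\<^sup>2)" by simp
    also have "\<dots> = (LINT x|torus. t\<^sup>2 * (f x)\<^sup>2 + 2 * t * (f x * g x) + (g x)\<^sup>2)"
      by (simp add: power2_eq_square algebra_simps)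
    also have "\<dots> = t\<^sup>2 * (LINT x|torus. (f x)\<^sup>2) + 2 * t * (LINT x|torus. f x * g x) + (LINT x|torus. (g x)\<^sup>2)"
      using ints by simp
    finally show ?thesis .
  qed
qed simp

section \<open>Translation invariance, and integrals of derivatives over the torus\<close>

lemma lborel_integral_shift:
  fixes F :: "'a :: euclidean_space \<Rightarrow> real"
  assumes "F \<in> borel_measurable borel"
  shows "(LINT x|lborel. F (x + c)) = (LINT x|lborel. F x)"
proof -
  have "(LINT x|lborel. F x) = integral\<^sup>L (distr lborel borel ((+) c)) F"
    by (simp add: lborel_distr_plus)
  also have "\<dots> = (LINT x|lborel. F (c + x))"
    using assms by (intro integral_distr) auto
  finally show ?thesis by (simp add: add.commute)
qed

text \<open>Translation by h cuts the cube into slabs orthogonal to axis j: the part pushed beyond 1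
  is moved back by periodicity and fills the gap between 0 and h.\<close>

lemma torus_integral_shift:
  fixes f :: "real ^ 3 \<Rightarrow> real"
  assumes cont: "continuous_on UNIV f" and per: "periodic f" and h: "0 \<le> h" "h \<le> 1"
  shows "(LINT x|torus. f (x + h *\<^sub>R axis j 1)) = (LINT x|torus. f x)"
proof -
  \<comment> \<open>Half-open in coordinate j, so that slabs over adjacent intervals are disjoint
    and their integrals add exactly.\<close>
  define S where "S a b = {x :: real ^ 3. a < x $ j \<and> x $ j \<le> b \<and> (\<forall>i. i \<noteq> j \<longrightarrow> 0 \<le> x $ i \<and> x $ i \<le> 1)}"
    for a b
  have S_meas [measurable]: "S a b \<in> sets borel" for a b
    unfolding S_def by measurable
  have f_meas [measurable]: "f \<in> borel_measurable borel"
    using cont by (rule borel_measurable_continuous_onI)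
  define I where "I a b = (LINT x|lborel. indicator (S a b) x * f x)" for a b
  have int: "integrable lborel (\<lambda>x. indicator (S a b) x * f x)" for a b
  proof -
    define K where "K = cbox (\<chi> i. if i = j then a else 0) (\<chi> i. if i = j then b else 1 :: real ^ 3)"
    have "integrable lborel (\<lambda>x. indicator K x *\<^sub>R f x)"
      unfolding K_def using cont
      by (intro borel_integrable_compact) (auto intro: continuous_on_subset)
    then show ?thesis
    proof (rule Bochner_Integration.integrable_bound)
      have "S a b \<subseteq> K" unfolding S_def K_def by (auto simp: mem_box_cart)
      then show "AE x in lborel. norm (indicator (S a b) x * f x) \<le> norm (indicator K x *\<^sub>R f x)"
        by (auto simp: indicator_def)
    qed measurable
  qed
  have split: "I a c = I a b + I b c" if "a \<le> b" "b \<le> c" for a b c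
  proof -
    have "indicator (S a c) x = (indicator (S a b) x + indicator (S b c) x :: real)" for x
      using that by (auto simp: S_def indicator_def)
    then have "I a c = (LINT x|lborel. indicator (S a b) x * f x + indicator (S b c) x * f x)"
      by (simp add: I_def algebra_simps)
    also have "\<dots> = I a b + I b c"
      unfolding I_def by (intro Bochner_Integration.integral_add int)
    finally show ?thesis .
  qed
  have shift: "(LINT x|lborel. indicator (S a b) x * f (x + d *\<^sub>R axis j 1))
      = (LINT x|lborel. indicator (S (a + d) (b + d)) x * f x)" for a b d
  proof -
    have "(LINT x|lborel. indicator (S (a + d) (b + d)) x * f x)
      = (LINT x|lborel. indicator (S (a + d) (b + d)) (x + d *\<^sub>R axis j 1) * f (x + d *\<^sub>R axis j 1))"
      by (rule lborel_integral_shift[symmetric]) measurable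
    moreover have "indicator (S (a + d) (b + d)) (x + d *\<^sub>R axis j 1) = (indicator (S a b) x :: real)" for x
      by (auto simp: S_def indicator_def axis_def)
    ultimately show ?thesis by simp
  qed
  \<comment> \<open>This degenerate box is the face x $ j = 0, the only set on which the closed cube
    and the half-open slab \<open>S 0 1\<close> differ.\<close>
  have hyper: "AE x in lborel. x \<notin> cbox 0 (1 - axis j 1 :: real ^ 3)"
  proof (rule AE_not_in)
    have "emeasure lborel (cbox 0 (1 - axis j 1 :: real ^ 3)) = 0"
    proof -
      have "\<forall>b\<in>Basis. 0 \<bullet> b \<le> (1 - axis j 1 :: real ^ 3) \<bullet> b"
        by (auto simp: Basis_vec_def inner_axis inner_diff_left) (simp add: axis_def)
      moreover have "(\<Prod>b\<in>Basis. (1 - axis j 1 - 0 :: real ^ 3) \<bullet> b) = 0"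
        by (rule prod_zero) (auto intro!: bexI[of _ "axis j 1"] simp: inner_axis axis_in_Basis_iff)
      ultimately show ?thesis by (simp only: emeasure_lborel_cbox_eq if_cancel ennreal_0)
    qed
    then show "cbox 0 (1 - axis j 1 :: real ^ 3) \<in> null_sets lborel" by auto
  qed
  have torus_eq: "(LINT x|torus. g x) = (LINT x|lborel. indicator (S 0 1) x * g x)"
    if [measurable]: "g \<in> borel_measurable borel" for g :: "real ^ 3 \<Rightarrow> real"
  proof -
    have "(LINT x|torus. g x) = (LINT x|lborel. indicator (cbox 0 1) x *\<^sub>R g x)"
      by (rule integral_restrict_space) simp
    also have "\<dots> = (LINT x|lborel. indicator (S 0 1) x * g x)"
    proof (rule integral_cong_AE)
      show "AE x in lborel. indicator (cbox 0 1) x *\<^sub>R g x = indicator (S 0 1) x * g x"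
        using hyper
      proof eventually_elim
        case (elim x)
        have "x \<in> cbox 0 1 \<longleftrightarrow> x \<in> S 0 1"
        proof
          assume x: "x \<in> cbox 0 1"
          then have "\<And>i. 0 \<le> x $ i \<and> x $ i \<le> 1" by (auto simp: mem_box_cart)
          moreover have "x $ j \<noteq> 0"
          proof
            assume "x $ j = 0"
            then have "x \<in> cbox 0 (1 - axis j 1)"
              using x by (auto simp: mem_box_cart axis_def)
            with elim show False by simp
          qed
          ultimately show "x \<in> S 0 1" by (auto simp: S_def less_le)
        next
          assume "x \<in> S 0 1"
          then show "x \<in> cbox 0 1" by (auto simp: S_def mem_box_cart) (metis less_le)+
        qed
        then show ?case by (simp add: indicator_def)
      qed
    qed measurable
    finally show ?thesis .
  qed
  have per': "f (x + 1 *\<^sub>R axis j 1) = f x" for x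
    using per by (simp add: periodic_def)
  have "(LINT x|torus. f (x + h *\<^sub>R axis j 1)) = I h (1 + h)"
    using shift[of 0 1 h] by (simp add: torus_eq I_def)
  also have "\<dots> = I h 1 + I 1 (1 + h)" using h by (intro split) auto
  also have "I 1 (1 + h) = I 0 h"
    using shift[of 0 h 1] unfolding per' by (simp add: I_def add.commute)
  also have "I h 1 + I 0 h = I 0 1" using split[of 0 h 1] h by simp
  also have "\<dots> = (LINT x|torus. f x)" by (simp add: torus_eq I_def)
  finally show ?thesis .
qed

text \<open>By translation invariance every difference quotient integrates to 0. The mean value
  theorem bounds the quotients uniformly, and dominated convergence passes to the derivative. This
  is the source of integration by parts for smooth functions.\<close>

lemma torus_integral_deriv:
  fixes F G :: "real ^ 3 \<Rightarrow> real"
  assumes F: "continuous_on UNIV F" "periodic F" and G: "continuous_on UNIV G"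
    and deriv: "\<And>x. ((\<lambda>s. F (x + s *\<^sub>R axis j 1)) has_real_derivative G x) (at 0)"
  shows "(LINT x|torus. G x) = 0"
proof -
  \<comment> \<open>Step sizes in (0, 1], the range that \<open>torus_integral_shift\<close>
    covers.\<close>
  define h where "h n = 1 / (real n + 1)" for n
  have h: "0 < h n" "h n \<le> 1" for n by (auto simp: h_def)
  have h_lim: "h \<longlonglongrightarrow> 0"
    unfolding h_def using LIMSEQ_inverse_real_of_nat by (simp add: inverse_eq_divide add.commute)
  define q where "q n x = (F (x + h n *\<^sub>R axis j 1) - F x) / h n" for n x
  have deriv': "((\<lambda>s. F (x + s *\<^sub>R axis j 1)) has_real_derivative G (x + s *\<^sub>R axis j 1)) (at s)" for x s
  proof -
    have "((\<lambda>r. F (x + s *\<^sub>R axis j 1 + r *\<^sub>R axis j 1)) has_real_derivative G (x + s *\<^sub>R axis j 1)) (at (s - s))"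
      using deriv[of "x + s *\<^sub>R axis j 1"] by simp
    then have "((\<lambda>r. F (x + s *\<^sub>R axis j 1 + (r - s) *\<^sub>R axis j 1)) has_real_derivative G (x + s *\<^sub>R axis j 1)) (at s)"
      using DERIV_shift[of "\<lambda>r. F (x + s *\<^sub>R axis j 1 + r *\<^sub>R axis j 1)" _ s "-s"] by simp
    moreover have "x + s *\<^sub>R axis j 1 + (r - s) *\<^sub>R axis j 1 = x + r *\<^sub>R axis j 1" for r
      by (simp add: algebra_simps)
    ultimately show ?thesis by simp
  qed
  \<comment> \<open>The intermediate point x + z * e with x in the unit cube and z < 1 can leave
    that cube but not the one of side 2; periodicity of G is not among the assumptions.\<close>
  obtain B where B: "\<And>x. x \<in> cbox 0 2 \<Longrightarrow> \<bar>G x\<bar> \<le> B"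
  proof -
    have "compact (G ` cbox 0 2)"
      using G by (intro compact_continuous_image) (auto intro: continuous_on_subset)
    then have "bounded (G ` cbox 0 2)" by (rule compact_imp_bounded)
    then show ?thesis using that by (auto simp: bounded_iff)
  qed
  have F_meas [measurable]: "F \<in> borel_measurable borel" and G_meas [measurable]: "G \<in> borel_measurable borel"
    using F G by (auto intro: borel_measurable_continuous_onI)
  have q_int: "(LINT x|torus. q n x) = 0" for n
  proof -
    have int: "integrable torus g" if "continuous_on UNIV g" for g :: "real ^ 3 \<Rightarrow> real"
    proof (subst integrable_restrict_space)
      show "integrable lborel (\<lambda>x. indicator (cbox 0 1) x *\<^sub>R g x)"
        using that by (intro borel_integrable_compact) (auto intro: continuous_on_subset)
    qed simp
    have "continuous_on UNIV (\<lambda>x. F (x + h n *\<^sub>R axis j 1))"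
      by (intro continuous_on_compose2[OF F(1)] continuous_intros) auto
    then show ?thesis
      unfolding q_def using int F torus_integral_shift[OF F, of "h n" j] h[of n] by simp
  qed
  have "(\<lambda>n. LINT x|torus. q n x) \<longlonglongrightarrow> (LINT x|torus. G x)"
  proof (rule integral_dominated_convergence[where w = "\<lambda>_. B"])
    show "G \<in> borel_measurable torus" by (rule borel_measurable_torus) measurable
    show "q n \<in> borel_measurable torus" for n
      unfolding q_def by (rule borel_measurable_torus) measurable
    show "integrable torus (\<lambda>_. B)" by simp
    show "AE x in torus. (\<lambda>n. q n x) \<longlonglongrightarrow> G x"
    proof (rule AE_I2)
      fix x
      have "((\<lambda>s. (F (x + s *\<^sub>R axis j 1) - F x) / s) \<longlongrightarrow> G x) (at 0)"
        using deriv[of x] by (simp add: DERIV_def)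
      moreover have "filterlim h (at 0) sequentially"
        unfolding filterlim_at using h_lim h(1) by (auto simp: less_imp_neq[symmetric])
      ultimately show "(\<lambda>n. q n x) \<longlonglongrightarrow> G x"
        unfolding q_def by (rule filterlim_compose)
    qed
    show "AE x in torus. norm (q n x) \<le> B" for n
    proof (rule AE_I2)
      fix x :: "real ^ 3" assume "x \<in> space torus"
      then have x: "x \<in> cbox 0 1" by (simp add: space_restrict_space)
      obtain z where z: "0 < z" "z < h n"
        "F (x + h n *\<^sub>R axis j 1) - F (x + 0 *\<^sub>R axis j 1) = (h n - 0) * G (x + z *\<^sub>R axis j 1)"
        using MVT2[of 0 "h n" "\<lambda>s. F (x + s *\<^sub>R axis j 1)" "\<lambda>s. G (x + s *\<^sub>R axis j 1)"] h(1)[of n] deriv'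
        by blast
      have "x + z *\<^sub>R axis j 1 \<in> cbox 0 2"
        using x z h(2)[of n] by (auto simp: mem_box_cart axis_def) (smt (verit))+
      moreover have "q n x = G (x + z *\<^sub>R axis j 1)"
        using z h(1)[of n] by (simp add: q_def)
      ultimately show "norm (q n x) \<le> B" using B by simp
    qed
  qed
  then show ?thesis by (simp add: q_int LIMSEQ_const_iff)
qed

section \<open>Trigonometric polynomials and Bessel's inequality\<close>

definition phase :: "int ^ 3 \<Rightarrow> real ^ 3 \<Rightarrow> real" where
  "phase k x = 2 * pi * (rvec k \<bullet> x)"

definition sfourier :: "(real ^ 3 \<Rightarrow> real) \<Rightarrow> int ^ 3 \<Rightarrow> complex" where
  "sfourier f k = (LINT x|torus. complex_of_real (f x) * cis (- phase k x))"

lemma fourier_nth: "fourier u k $ i = sfourier (\<lambda>x. u x $ i) k"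
  by (simp add: fourier_def sfourier_def phase_def)

lemma rvec_add: "rvec (k + l) = rvec k + rvec l"
  and rvec_minus: "rvec (- k) = - rvec k"
  and rvec_0 [simp]: "rvec 0 = 0"
  by (simp_all add: rvec_def vec_eq_iff)

lemma rvec_nth: "rvec k $ i = of_int (k $ i)"
  by (simp add: rvec_def)

lemma phase_add: "phase (k + l) x = phase k x + phase l x"
  and phase_minus: "phase (- k) x = - phase k x"
  and phase_0 [simp]: "phase 0 x = 0"
  by (simp_all add: phase_def rvec_add rvec_minus algebra_simps)

lemma continuous_phase [continuous_intros]: "continuous_on S (phase k)"
  unfolding phase_def by (intro continuous_intros)

lemma borel_measurable_phase [measurable]: "phase k \<in> borel_measurable borel"
  by (intro borel_measurable_continuous_onI continuous_intros)

lemma phase_shift: "phase k (x + s *\<^sub>R axis j 1) = phase k x + 2 * pi * of_int (k $ j) * s"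
  by (simp add: phase_def inner_add_right inner_axis rvec_nth algebra_simps)

lemma phase_periodic: "phase k (x + axis j 1) = phase k x + 2 * pi * of_int (k $ j)"
  using phase_shift[of k x 1 j] by simp

lemma sin_cos_periodic:
  "cos (phase k (x + axis j 1)) = cos (phase k x)" "sin (phase k (x + axis j 1)) = sin (phase k x)"
  unfolding phase_periodic
  by (simp_all add: cos_add sin_add cos_int_2pin sin_int_2pin)

lemma L2_cos: "(\<lambda>x. cos (phase k x)) \<in> L2"
  by (rule L2_bounded[where C = 1]) (auto simp: periodic_def sin_cos_periodic)

lemma L2_sin: "(\<lambda>x. sin (phase k x)) \<in> L2"
  by (rule L2_bounded[where C = 1]) (auto simp: periodic_def sin_cos_periodic)

lemma integral_cos_phase: "(LINT x|torus. cos (phase k x)) = (if k = 0 then 1 else 0)"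
proof (cases "k = 0")
  case True
  then show ?thesis using measure_torus by simp
next
  case False
  then obtain j where j: "k $ j \<noteq> 0" by (auto simp: vec_eq_iff)
  define c where "c = 2 * pi * of_int (k $ j)"
  have c: "c \<noteq> 0" using j by (simp add: c_def)
  have "(LINT x|torus. cos (phase k x)) = 0"
  proof (rule torus_integral_deriv[where F = "\<lambda>x. sin (phase k x) / c" and j = j])
    show "((\<lambda>s. sin (phase k (x + s *\<^sub>R axis j 1)) / c) has_real_derivative cos (phase k x)) (at 0)" for x
      unfolding phase_shift c_def[symmetric] using c
      by (auto intro!: derivative_eq_intros)
  qed (auto intro!: continuous_intros simp: periodic_def sin_cos_periodic c)
  then show ?thesis using False by simp
qed

lemma integral_sin_phase: "(LINT x|torus. sin (phase k x)) = 0"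
proof (cases "k = 0")
  case False
  then obtain j where j: "k $ j \<noteq> 0" by (auto simp: vec_eq_iff)
  define c where "c = 2 * pi * of_int (k $ j)"
  have c: "c \<noteq> 0" using j by (simp add: c_def)
  show "(LINT x|torus. sin (phase k x)) = 0"
  proof (rule torus_integral_deriv[where F = "\<lambda>x. - cos (phase k x) / c" and j = j])
    show "((\<lambda>s. - cos (phase k (x + s *\<^sub>R axis j 1)) / c) has_real_derivative sin (phase k x)) (at 0)" for x
      unfolding phase_shift c_def[symmetric] using c
      by (auto intro!: derivative_eq_intros)
  qed (auto intro!: continuous_intros simp: periodic_def sin_cos_periodic c)
qed simp

lemma integrable_mult_cis:
  assumes "f \<in> L2"
  shows "integrable torus (\<lambda>x. complex_of_real (f x) * cis (- phase k x))"
proof (rule Bochner_Integration.integrable_bound[OF L2_integrable[OF assms]])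
  have [measurable]: "f \<in> borel_measurable torus" "phase k \<in> borel_measurable torus"
    using L2_measurable[OF assms] borel_measurable_torus[of "phase k"] by auto
  have "(\<lambda>x. complex_of_real (f x) * Complex (cos (phase k x)) (- sin (phase k x))) \<in> borel_measurable torus"
    unfolding Complex_eq by measurable
  then show "(\<lambda>x. complex_of_real (f x) * cis (- phase k x)) \<in> borel_measurable torus"
    by (simp add: cis.ctr)
qed (simp add: norm_mult)

lemma Re_sfourier: "f \<in> L2 \<Longrightarrow> Re (sfourier f k) = (LINT x|torus. f x * cos (phase k x))"
  and Im_sfourier: "f \<in> L2 \<Longrightarrow> Im (sfourier f k) = - (LINT x|torus. f x * sin (phase k x))"
  unfolding sfourier_def
  by (simp_all add: integral_Re[OF integrable_mult_cis, symmetric] integral_Im[OF integrable_mult_cis, symmetric])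

lemma sfourier_add:
  assumes "f \<in> L2" "g \<in> L2"
  shows "sfourier (\<lambda>x. f x + g x) k = sfourier f k + sfourier g k"
  unfolding sfourier_def using integrable_mult_cis[OF assms(1)] integrable_mult_cis[OF assms(2)]
  by (simp add: distrib_right)

lemma sfourier_cmult: "sfourier (\<lambda>x. c * f x) k = of_real c * sfourier f k"
  unfolding sfourier_def by (simp add: mult.assoc)

lemma sfourier_diff:
  assumes "f \<in> L2" "g \<in> L2"
  shows "sfourier (\<lambda>x. f x - g x) k = sfourier f k - sfourier g k"
  using sfourier_add[OF assms(1) L2_minus[OF assms(2)]] sfourier_cmult[of "-1" g] by simp

lemma sfourier_sum:
  assumes "finite I" "\<And>i. i \<in> I \<Longrightarrow> f i \<in> L2"
  shows "sfourier (\<lambda>x. \<Sum>i\<in>I. f i x) k = (\<Sum>i\<in>I. sfourier (f i) k)"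
  using assms by (induction I) (auto simp: sfourier_add L2_sum, simp add: sfourier_def)

lemma sfourier_cong_AE:
  assumes "f \<in> L2" "g \<in> L2" "AE x in torus. f x = g x"
  shows "sfourier f k = sfourier g k"
  unfolding sfourier_def
proof (rule integral_cong_AE)
  show "AE x in torus. complex_of_real (f x) * cis (- phase k x) = complex_of_real (g x) * cis (- phase k x)"
    using assms(3) by eventually_elim simp
qed (use assms integrable_mult_cis borel_measurable_integrable in blast)+

lemma sfourier_minus: "sfourier f (- k) = cnj (sfourier f k)"
  unfolding sfourier_def phase_minus
  by (subst Bochner_Integration.integral_cnj[symmetric]) (simp add: cis_cnj)

text \<open>Taking real parts makes the truncation to any index set a real function, even when the
  set or the coefficients lack the symmetry under k \<mapsto> - k. For Hermitian coefficients and a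
  symmetric set it is the usual partial sum.\<close>

definition trig :: "(int ^ 3 \<Rightarrow> complex) \<Rightarrow> (int ^ 3) set \<Rightarrow> real ^ 3 \<Rightarrow> real" where
  "trig c A x = (\<Sum>k\<in>A. Re (c k * cis (phase k x)))"

lemma trig_eq: "trig c A x = (\<Sum>k\<in>A. Re (c k) * cos (phase k x) - Im (c k) * sin (phase k x))"
  by (simp add: trig_def)

lemma trig_empty [simp]: "trig c {} x = 0"
  by (simp add: trig_def)

lemma continuous_trig [continuous_intros]: "continuous_on S (trig c A)"
  unfolding trig_eq by (intro continuous_intros)

lemma periodic_trig: "periodic (trig c A)"
  by (simp add: periodic_def trig_eq sin_cos_periodic)

lemma trig_deriv:
  "((\<lambda>s. trig c A (x + s *\<^sub>R axis j 1)) has_real_derivative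
     trig (\<lambda>k. 2 * pi * \<i> * of_int (k $ j) * c k) A x) (at 0)"
  unfolding trig_eq phase_shift
  by (auto intro!: derivative_eq_intros DERIV_sum sum.cong simp: algebra_simps)

lemma abs_trig_le: "finite A \<Longrightarrow> \<bar>trig c A x\<bar> \<le> (\<Sum>k\<in>A. cmod (c k))"
  unfolding trig_def
  by (rule order_trans[OF sum_abs], rule sum_mono, rule order_trans[OF abs_Re_le_cmod])
    (simp only: norm_mult norm_cis mult_1_right order_refl)

lemma L2_trig: "trig c A \<in> L2"
proof (cases "finite A")
  case True
  show ?thesis
    by (rule L2_bounded[OF periodic_trig _ AE_I2, OF _ abs_trig_le[OF True]])
      (intro borel_measurable_continuous_onI continuous_intros)
next
  case False
  then have "trig c A = (\<lambda>_. 0)" by (simp add: trig_def fun_eq_iff)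
  then show ?thesis by (simp add: L2_const)
qed

text \<open>The minus sign in the imaginary part of a Fourier coefficient cancels the one in Re (c *
  cis), which leaves exactly the real inner product on the complex numbers.\<close>

lemma trig_pairing:
  assumes f: "f \<in> L2"
  shows "(LINT x|torus. trig c A x * f x) = (\<Sum>k\<in>A. c k \<bullet> sfourier f k)"
proof -
  note ints = L2_integrable_mult[OF f L2_cos] L2_integrable_mult[OF f L2_sin]
  have "(LINT x|torus. trig c A x * f x)
     = (LINT x|torus. (\<Sum>k\<in>A. Re (c k) * (f x * cos (phase k x)) - Im (c k) * (f x * sin (phase k x))))"
    unfolding trig_eq sum_distrib_right by (simp add: algebra_simps)
  also have "\<dots> = (\<Sum>k\<in>A. (LINT x|torus. Re (c k) * (f x * cos (phase k x)) - Im (c k) * (f x * sin (phase k x))))"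
    by (rule Bochner_Integration.integral_sum) (use ints in auto)
  also have "\<dots> = (\<Sum>k\<in>A. c k \<bullet> sfourier f k)"
    using ints by (simp add: inner_complex_def Re_sfourier[OF f] Im_sfourier[OF f])
  finally show ?thesis .
qed

text \<open>The real part of c * cis contributes c / 2 at its own frequency and cnj c / 2 at the
  opposite one; at k = 0 the two contributions meet and leave the real part of
  \<open>c 0\<close>.\<close>

lemma sfourier_trig:
  assumes "finite A"
  shows "sfourier (trig c A) k
     = ((if k \<in> A then c k else 0) + (if - k \<in> A then cnj (c (- k)) else 0)) / 2"
proof -
  have ortho: "(LINT x|torus. cos (phase m x) * cos (phase k x)) = ((if m = k then 1 else 0) + (if m = - k then 1 else 0)) / 2"
    "(LINT x|torus. sin (phase m x) * sin (phase k x)) = ((if m = k then 1 else 0) - (if m = - k then 1 else 0)) / 2"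
    "(LINT x|torus. sin (phase m x) * cos (phase k x)) = 0" for m k
  proof -
    note i = L2_integrable[OF L2_cos] L2_integrable[OF L2_sin]
    have e: "cos (phase m x) * cos (phase k x) = (cos (phase (m + - k) x) + cos (phase (m + k) x)) / 2"
      "sin (phase m x) * sin (phase k x) = (cos (phase (m + - k) x) - cos (phase (m + k) x)) / 2"
      "sin (phase m x) * cos (phase k x) = (sin (phase (m + k) x) + sin (phase (m + - k) x)) / 2" for x
      unfolding phase_add phase_minus by (simp_all add: cos_add cos_diff sin_add sin_diff)
    have z: "m + - k = 0 \<longleftrightarrow> m = k" "m + k = 0 \<longleftrightarrow> m = - k"
      by (auto simp: eq_neg_iff_add_eq_0)
    show "(LINT x|torus. cos (phase m x) * cos (phase k x)) = ((if m = k then 1 else 0) + (if m = - k then 1 else 0)) / 2"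
      unfolding e using i by (simp only: integral_divide_zero Bochner_Integration.integral_add integral_cos_phase z)
    show "(LINT x|torus. sin (phase m x) * sin (phase k x)) = ((if m = k then 1 else 0) - (if m = - k then 1 else 0)) / 2"
      unfolding e using i by (simp only: integral_divide_zero Bochner_Integration.integral_diff integral_cos_phase z)
    show "(LINT x|torus. sin (phase m x) * cos (phase k x)) = 0"
      unfolding e using i by (simp only: integral_divide_zero Bochner_Integration.integral_add integral_sin_phase) simp
  qed
  have half: "a * (((if P then 1 else 0) + (if Q then 1 else 0)) / 2) = (if P then a / 2 else 0) + (if Q then a / 2 else 0)"
    "a * - (((if P then 1 else 0) - (if Q then 1 else 0)) / 2) = (if P then - a / 2 else 0) + (if Q then a / 2 else 0)"
    for a :: real and P Q
    by simp_all
  have "Re (sfourier (trig c A) k) = (\<Sum>m\<in>A. c m \<bullet> sfourier (\<lambda>x. cos (phase k x)) m)"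
    unfolding Re_sfourier[OF L2_trig] by (rule trig_pairing[OF L2_cos])
  also have "\<dots> = (\<Sum>m\<in>A. (if m = k then Re (c m) / 2 else 0) + (if m = - k then Re (c m) / 2 else 0))"
  proof (rule sum.cong)
    fix m
    have neg: "k = - m \<longleftrightarrow> m = - k" and eq: "k = m \<longleftrightarrow> m = k" by auto
    have "(LINT x|torus. cos (phase k x) * sin (phase m x)) = 0"
      using ortho(3)[of m k] by (simp add: mult.commute)
    then show "c m \<bullet> sfourier (\<lambda>x. cos (phase k x)) m
       = (if m = k then Re (c m) / 2 else 0) + (if m = - k then Re (c m) / 2 else 0)"
      unfolding inner_complex_def Re_sfourier[OF L2_cos] Im_sfourier[OF L2_cos] ortho(1)[of k m, unfolded neg eq]
        half by simp
  qed simp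
  also have "\<dots> = ((if k \<in> A then Re (c k) else 0) + (if - k \<in> A then Re (c (- k)) else 0)) / 2"
    using assms by (simp add: sum.distrib sum.delta)
  finally have re: "Re (sfourier (trig c A) k) = \<dots>" .
  have "- Im (sfourier (trig c A) k) = (\<Sum>m\<in>A. c m \<bullet> sfourier (\<lambda>x. sin (phase k x)) m)"
    unfolding Im_sfourier[OF L2_trig] minus_minus by (rule trig_pairing[OF L2_sin])
  also have "\<dots> = (\<Sum>m\<in>A. (if m = k then - Im (c m) / 2 else 0) + (if m = - k then Im (c m) / 2 else 0))"
  proof (rule sum.cong)
    fix m
    have neg: "k = - m \<longleftrightarrow> m = - k" and eq: "k = m \<longleftrightarrow> m = k" by auto
    show "c m \<bullet> sfourier (\<lambda>x. sin (phase k x)) m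
       = (if m = k then - Im (c m) / 2 else 0) + (if m = - k then Im (c m) / 2 else 0)"
      unfolding inner_complex_def Re_sfourier[OF L2_sin] Im_sfourier[OF L2_sin] ortho ortho(2)[of k m, unfolded neg eq]
        half by simp
  qed simp
  also have "\<dots> = ((if k \<in> A then - Im (c k) else 0) + (if - k \<in> A then Im (c (- k)) else 0)) / 2"
    using assms by (simp add: sum.distrib sum.delta)
  finally have im: "- Im (sfourier (trig c A) k) = \<dots>" .
  show ?thesis
    by (rule complex_eqI) (use re im in \<open>auto simp: field_simps\<close>)
qed

text \<open>Averaging a coefficient with the conjugate of its partner at - k cannot increase the sum
  of squares. Only an inequality is available because neither the set nor the coefficients are
  assumed symmetric.\<close>

lemma trig_norm_le:
  assumes A: "finite A"
  shows "(LINT x|torus. (trig c A x)\<^sup>2) \<le> (\<Sum>k\<in>A. (cmod (c k))\<^sup>2)"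
proof -
  have sq: "(cmod z)\<^sup>2 = Re z * Re z + Im z * Im z" for z
    unfolding cmod_power2 by (simp add: power2_eq_square)
  have "(LINT x|torus. (trig c A x)\<^sup>2) = (\<Sum>k\<in>A. c k \<bullet> sfourier (trig c A) k)"
    unfolding power2_eq_square by (rule trig_pairing[OF L2_trig])
  \<comment> \<open>Half of the diagonal term, plus a quarter for each of k and - k from the
    arithmetic-geometric bound on the mixed term. Reindexing by negation below turns the quarters at
    - k into quarters at k, and the total is 3/4 + 1/4.\<close>
  also have "\<dots> \<le> (\<Sum>k\<in>A. (cmod (c k))\<^sup>2 * 3 / 4 + (if - k \<in> A then (cmod (c (- k)))\<^sup>2 / 4 else 0))"
  proof (rule sum_mono)
    fix k assume k: "k \<in> A"
    show "c k \<bullet> sfourier (trig c A) k \<le> (cmod (c k))\<^sup>2 * 3 / 4 + (if - k \<in> A then (cmod (c (- k)))\<^sup>2 / 4 else 0)"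
    proof (cases "- k \<in> A")
      case True
      have "c k \<bullet> cnj (c (- k)) \<le> cmod (c k) * cmod (c (- k))"
        using norm_cauchy_schwarz[of "c k" "cnj (c (- k))"] by simp
      moreover have "2 * cmod (c k) * cmod (c (- k)) \<le> (cmod (c k))\<^sup>2 + (cmod (c (- k)))\<^sup>2"
        by (rule sum_squares_bound)
      moreover have "c k \<bullet> sfourier (trig c A) k = ((cmod (c k))\<^sup>2 + c k \<bullet> cnj (c (- k))) / 2"
        using k True by (simp add: sfourier_trig[OF A] inner_complex_def sq field_simps)
      ultimately show ?thesis using True by simp
    next
      case False
      then have "c k \<bullet> sfourier (trig c A) k = (cmod (c k))\<^sup>2 / 2"
        using k by (simp add: sfourier_trig[OF A] inner_complex_def sq field_simps)
      moreover have "0 \<le> (cmod (c k))\<^sup>2" by simp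
      ultimately have "c k \<bullet> sfourier (trig c A) k \<le> (cmod (c k))\<^sup>2 * 3 / 4" by linarith
      then show ?thesis using False by simp
    qed
  qed
  also have "\<dots> = (\<Sum>k\<in>A. (cmod (c k))\<^sup>2) * 3 / 4 + (\<Sum>k\<in>{k\<in>A. - k \<in> A}. (cmod (c (- k)))\<^sup>2 / 4)"
    using A by (simp add: sum.distrib sum_distrib_right sum_divide_distrib sum.inter_filter)
  also have "(\<Sum>k\<in>{k\<in>A. - k \<in> A}. (cmod (c (- k)))\<^sup>2 / 4) = (\<Sum>k\<in>uminus ` {k\<in>A. - k \<in> A}. (cmod (c k))\<^sup>2 / 4)"
    by (subst sum.reindex) (auto simp: inj_on_def)
  also have "\<dots> \<le> (\<Sum>k\<in>A. (cmod (c k))\<^sup>2 / 4)"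
    using A by (intro sum_mono2) auto
  finally show ?thesis by (simp add: sum_divide_distrib[symmetric])
qed

text \<open>The squared distance from f to its truncation is nonnegative; the one-sided bound
  \<open>trig_norm_le\<close> takes the place of Pythagoras for sets that are not symmetric.\<close>

lemma Bessel:
  assumes f: "f \<in> L2" and A: "finite A"
  shows "(\<Sum>k\<in>A. (cmod (sfourier f k))\<^sup>2) \<le> (LINT x|torus. (f x)\<^sup>2)"
proof -
  let ?t = "trig (sfourier f) A"
  note ints = L2_integrable_square[OF f] L2_integrable_square[OF L2_trig] L2_integrable_mult[OF L2_trig f]
  have "0 \<le> (LINT x|torus. (f x - ?t x)\<^sup>2)" by simp
  also have "\<dots> = (LINT x|torus. (f x)\<^sup>2 - 2 * (?t x * f x) + (?t x)\<^sup>2)"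
    by (simp add: power2_eq_square algebra_simps)
  also have "\<dots> = (LINT x|torus. (f x)\<^sup>2) - 2 * (LINT x|torus. ?t x * f x) + (LINT x|torus. (?t x)\<^sup>2)"
    using ints by simp
  also have "(LINT x|torus. ?t x * f x) = (\<Sum>k\<in>A. (cmod (sfourier f k))\<^sup>2)"
    by (simp add: trig_pairing[OF f] power2_norm_eq_inner)
  finally show ?thesis using trig_norm_le[OF A, of "sfourier f"] by simp
qed

lemma Bessel_summable:
  assumes f: "f \<in> L2"
  shows "(\<lambda>k. (cmod (sfourier f k))\<^sup>2) summable_on UNIV"
proof (rule nonneg_bdd_above_summable_on)
  show "bdd_above (sum (\<lambda>k. (cmod (sfourier f k))\<^sup>2) ` {F. F \<subseteq> UNIV \<and> finite F})"
    using Bessel[OF f] by (intro bdd_aboveI) auto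
qed simp

section \<open>The Riesz--Fischer theorem\<close>

text \<open>A general filter is allowed because partial sums are indexed by finite sets of
  frequencies. Membership is demanded for every index: for \<open>trig\<close> this includes
  infinite sets, where the sum defaults to 0.\<close>

definition L2_tendsto :: "('i \<Rightarrow> real ^ 3 \<Rightarrow> real) \<Rightarrow> (real ^ 3 \<Rightarrow> real) \<Rightarrow> 'i filter \<Rightarrow> bool" where
  "L2_tendsto f F flt \<longleftrightarrow> (\<forall>i. f i \<in> L2) \<and> F \<in> L2 \<and>
     ((\<lambda>i. LINT x|torus. (f i x - F x)\<^sup>2) \<longlongrightarrow> 0) flt"

lemma L2_abs_integral_le:
  fixes f g :: "real ^ 3 \<Rightarrow> real"
  assumes "f \<in> L2" "g \<in> L2"
  shows "\<bar>LINT x|torus. f x * g x\<bar> \<le> sqrt (LINT x|torus. (f x)\<^sup>2) * sqrt (LINT x|torus. (g x)\<^sup>2)"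
  using real_sqrt_le_mono[OF L2_Cauchy_Schwarz[OF assms]] by (simp add: real_sqrt_mult)

lemma L2_tendsto_integral_mult:
  assumes f: "L2_tendsto f F flt" and g: "L2_tendsto g G flt"
  shows "((\<lambda>i. LINT x|torus. f i x * g i x) \<longlongrightarrow> (LINT x|torus. F x * G x)) flt"
proof -
  have L2: "f i \<in> L2" "g i \<in> L2" "F \<in> L2" "G \<in> L2" for i
    using f g by (auto simp: L2_tendsto_def)
  define a b where "a i = sqrt (LINT x|torus. (f i x - F x)\<^sup>2)"
    and "b i = sqrt (LINT x|torus. (g i x - G x)\<^sup>2)" for i
  define A B where "A = sqrt (LINT x|torus. (F x)\<^sup>2)" and "B = sqrt (LINT x|torus. (G x)\<^sup>2)"
  have a: "(a \<longlongrightarrow> 0) flt" and b: "(b \<longlongrightarrow> 0) flt"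
    using f g tendsto_real_sqrt[of _ 0] unfolding L2_tendsto_def a_def b_def by fastforce+
  have bound: "norm ((LINT x|torus. f i x * g i x) - (LINT x|torus. F x * G x))
     \<le> a i * b i + a i * B + A * b i" for i
  proof -
    have d: "(\<lambda>x. f i x - F x) \<in> L2" "(\<lambda>x. g i x - G x) \<in> L2"
      using L2 by (auto intro: L2_diff)
    note ints = L2_integrable_mult[OF d] L2_integrable_mult[OF d(1) L2(4)]
      L2_integrable_mult[OF L2(3) d(2)] L2_integrable_mult[OF L2(3,4)] L2_integrable_mult[OF L2(1,2)]
    have "(LINT x|torus. f i x * g i x) - (LINT x|torus. F x * G x)
      = (LINT x|torus. f i x * g i x - F x * G x)"
      using ints by simp
    also have "\<dots> = (LINT x|torus. (f i x - F x) * (g i x - G x) + (f i x - F x) * G x + F x * (g i x - G x))"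
      by (simp add: algebra_simps)
    also have "\<dots> = (LINT x|torus. (f i x - F x) * (g i x - G x)) + (LINT x|torus. (f i x - F x) * G x)
        + (LINT x|torus. F x * (g i x - G x))"
      using ints(1,2,3) by (simp only: Bochner_Integration.integral_add Bochner_Integration.integrable_add)
    finally show ?thesis
      using L2_abs_integral_le[OF d] L2_abs_integral_le[OF d(1) L2(4)] L2_abs_integral_le[OF L2(3) d(2)]
      unfolding a_def b_def A_def B_def real_norm_def by linarith
  qed
  have "((\<lambda>i. a i * b i + a i * B + A * b i) \<longlongrightarrow> 0 * 0 + 0 * B + A * 0) flt"
    by (intro tendsto_intros a b)
  then have "((\<lambda>i. a i * b i + a i * B + A * b i) \<longlongrightarrow> 0) flt" by simp
  then have "((\<lambda>i. (LINT x|torus. f i x * g i x) - (LINT x|torus. F x * G x)) \<longlongrightarrow> 0) flt"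
    by (rule Lim_null_comparison[rotated]) (intro always_eventually allI bound)
  then show ?thesis by (simp add: LIM_zero_cancel)
qed

lemma L2_tendsto_const: "F \<in> L2 \<Longrightarrow> L2_tendsto (\<lambda>_. F) F flt"
  by (simp add: L2_tendsto_def)

lemma sfourier_tendsto:
  assumes "L2_tendsto f F flt"
  shows "((\<lambda>i. sfourier (f i) k) \<longlongrightarrow> sfourier F k) flt"
proof -
  have L2: "f i \<in> L2" "F \<in> L2" for i
    using assms by (auto simp: L2_tendsto_def)
  show ?thesis
    using L2_tendsto_integral_mult[OF assms L2_tendsto_const[OF L2_cos, of k]]
      tendsto_minus[OF L2_tendsto_integral_mult[OF assms L2_tendsto_const[OF L2_sin, of k]]]
    by (intro tendsto_complex_iff[THEN iffD2]) (simp add: Re_sfourier Im_sfourier L2)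
qed

lemma summable_on_small_tail:
  fixes f :: "'a \<Rightarrow> real"
  assumes f: "f summable_on UNIV" and e: "0 < e"
  shows "\<exists>A. finite A \<and> (\<forall>B. finite B \<longrightarrow> A \<inter> B = {} \<longrightarrow> sum f B \<le> e)"
proof -
  obtain s where "(f has_sum s) UNIV" using f by (auto simp: summable_on_def)
  then have "(sum f \<longlongrightarrow> s) (finite_subsets_at_top UNIV)" by (simp add: has_sum_def)
  then have "\<forall>\<^sub>F A in finite_subsets_at_top UNIV. dist (sum f A) s < e / 2"
    using e by (auto dest: tendstoD[where e = "e / 2"])
  then obtain A where A: "finite A" and close: "\<And>B. finite B \<Longrightarrow> A \<subseteq> B \<Longrightarrow> dist (sum f B) s < e / 2"
    by (auto simp: eventually_finite_subsets_at_top)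
  have "sum f B \<le> e" if B: "finite B" "A \<inter> B = {}" for B
  proof -
    have "sum f (A \<union> B) = sum f A + sum f B" using A B by (intro sum.union_disjoint)
    moreover have "dist (sum f (A \<union> B)) s < e / 2" "dist (sum f A) s < e / 2"
      using A B close[of "A \<union> B"] close[of A] by auto
    ultimately show ?thesis unfolding dist_real_def by linarith
  qed
  with A show ?thesis by blast
qed

lemma trig_diff:
  assumes "finite A" "finite B"
  shows "trig c A x - trig c B x = trig c (A - B) x - trig c (B - A) x"
proof -
  have "trig c A x = trig c (A - B) x + trig c (A \<inter> B) x"
    "trig c B x = trig c (B - A) x + trig c (A \<inter> B) x"
    unfolding trig_def using sum.Int_Diff[OF assms(1), of _ B] sum.Int_Diff[OF assms(2), of _ A]
    by (simp_all add: Int_commute add.commute)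
  then show ?thesis by simp
qed

text \<open>Riesz--Fischer: along a fast subsequence the partial sums converge almost everywhere, and
  Fatou's lemma turns the pointwise limit into an \<open>L2\<close> limit.\<close>

lemma Riesz_Fischer:
  fixes c :: "int ^ 3 \<Rightarrow> complex"
  assumes c: "(\<lambda>k. (cmod (c k))\<^sup>2) summable_on UNIV"
  obtains F where "L2_tendsto (trig c) F (finite_subsets_at_top UNIV)"
proof -
  \<comment> \<open>The rate 1/4 for squared norms gives increments of \<open>L2\<close> norm at
    most (1/2)^n, hence of \<open>L1\<close> norm at most (1/2)^n on a space of measure 1, and these
    are summable.\<close>
  obtain A0 where A0: "\<And>n. finite (A0 n)"
    and tail0: "\<And>n B. finite B \<Longrightarrow> A0 n \<inter> B = {} \<Longrightarrow> (\<Sum>k\<in>B. (cmod (c k))\<^sup>2) \<le> (1 / 4) ^ n"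
    using summable_on_small_tail[OF c, of "(1 / 4) ^ n" for n] by (metis zero_less_power zero_less_divide_iff zero_less_numeral zero_less_one)
  define A where "A n = (\<Union>m\<le>n. A0 m)" for n
  have A: "finite (A n)" for n unfolding A_def using A0 by auto
  have A_mono: "A m \<subseteq> A n" if "m \<le> n" for m n using that unfolding A_def by force
  have tail: "(LINT x|torus. (trig c B x)\<^sup>2) \<le> (1 / 4) ^ n" if "finite B" "A n \<inter> B = {}" for n B
  proof -
    have "A0 n \<inter> B = {}" using that(2) unfolding A_def by auto
    then show ?thesis using trig_norm_le[OF that(1), of c] tail0[OF that(1), of n] by simp
  qed
  define P where "P n = trig c (A n)" for n
  define D where "D n x = P (Suc n) x - P n x" for n x
  have P_meas [measurable]: "P n \<in> borel_measurable borel" for n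
    unfolding P_def by (rule L2_borel[OF L2_trig])
  have D_L2: "D n \<in> L2" for n
    unfolding D_def P_def by (intro L2_diff L2_trig)
  have D_int: "(LINT x|torus. \<bar>D n x\<bar>) \<le> (1 / 2) ^ n" for n
  proof -
    have "D n x = trig c (A (Suc n) - A n) x" for x
    proof -
      have e: "A n - A (Suc n) = {}" using A_mono[of n "Suc n"] by auto
      show ?thesis
        unfolding D_def P_def using trig_diff[OF A A, of c "Suc n" x n] unfolding e by simp
    qed
    then have "(LINT x|torus. (D n x)\<^sup>2) \<le> (1 / 4) ^ n"
      using tail[of "A (Suc n) - A n" n] A by auto
    moreover have "(\<lambda>x. \<bar>D n x\<bar>) \<in> L2"
      using D_L2[of n] unfolding L2_def periodic_def by auto
    ultimately have "(LINT x|torus. \<bar>D n x\<bar> * 1)\<^sup>2 \<le> (1 / 4) ^ n * 1"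
      using L2_Cauchy_Schwarz[of "\<lambda>x. \<bar>D n x\<bar>" "\<lambda>_. 1"] L2_const[of 1] by simp
    also have "(1 / 4 :: real) ^ n * 1 = ((1 / 2) ^ n)\<^sup>2"
      by (simp add: power2_eq_square flip: power_mult_distrib)
    finally show ?thesis by (simp add: abs_le_square_iff[symmetric])
  qed
  have "AE x in torus. summable (\<lambda>n. \<bar>D n x\<bar>)"
  proof -
    have [measurable]: "D n \<in> borel_measurable torus" for n
      using D_L2 by (rule L2_measurable)
    have "(\<integral>\<^sup>+x. (\<Sum>n. ennreal \<bar>D n x\<bar>) \<partial>torus) = (\<Sum>n. \<integral>\<^sup>+x. ennreal \<bar>D n x\<bar> \<partial>torus)"
      by (rule nn_integral_suminf) measurable
    also have "\<dots> \<le> (\<Sum>n. ennreal ((1 / 2) ^ n))"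
    proof (rule suminf_le)
      show "(\<integral>\<^sup>+x. ennreal \<bar>D n x\<bar> \<partial>torus) \<le> ennreal ((1 / 2) ^ n)" for n
        using D_int[of n] L2_integrable[OF D_L2[of n]]
        by (subst nn_integral_eq_integral) (auto intro: ennreal_leI)
    qed auto
    also have "\<dots> = ennreal (\<Sum>n. (1 / 2) ^ n)"
      by (rule suminf_ennreal2) (auto simp: summable_geometric)
    finally have "(\<integral>\<^sup>+x. (\<Sum>n. ennreal \<bar>D n x\<bar>) \<partial>torus) \<noteq> \<infinity>"
      using ennreal_less_top le_less_trans by (metis infinity_ennreal_def less_irrefl)
    then have "AE x in torus. (\<Sum>n. ennreal \<bar>D n x\<bar>) \<noteq> \<infinity>"
      by (intro nn_integral_PInf_AE) measurable
    then show ?thesis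
      by eventually_elim (auto intro!: summable_suminf_not_top)
  qed
  then have conv: "AE x in torus. convergent (\<lambda>n. P n x)"
  proof eventually_elim
    case (elim x)
    then have "summable (\<lambda>n. D n x)" by (rule summable_rabs_cancel)
    then have "(\<lambda>n. \<Sum>i<n. D i x) \<longlonglongrightarrow> (\<Sum>n. D n x)" by (rule summable_LIMSEQ)
    moreover have "(\<Sum>i<n. D i x) = P n x - P 0 x" for n
      unfolding D_def by (rule sum_lessThan_telescope)
    ultimately have "(\<lambda>n. (P n x - P 0 x) + P 0 x) \<longlonglongrightarrow> (\<Sum>n. D n x) + P 0 x"
      by (intro tendsto_intros) simp
    then show ?case by (auto simp: convergent_def)
  qed
  \<comment> \<open>Defined at every point by the same expression, so that periodicity and Borel
    measurability hold everywhere and not only almost everywhere.\<close>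
  define F where "F x = lim (\<lambda>n. P n x)" for x
  have F_meas: "F \<in> borel_measurable borel"
    unfolding F_def by measurable
  have F_per: "periodic F"
  proof -
    have "P n (x + axis i 1) = P n x" for n x i
      using periodic_trig[of c "A n"] by (simp add: P_def periodic_def)
    then show ?thesis by (simp add: periodic_def F_def)
  qed
  have F_lim: "AE x in torus. (\<lambda>n. P n x) \<longlonglongrightarrow> F x"
    using conv by eventually_elim (simp add: F_def convergent_LIMSEQ_iff)
  \<comment> \<open>The factor 4 comes from (a - b)^2 \<le> 2 a^2 + 2 b^2, applied to the two parts
    of the symmetric difference of B and a later \<open>A n\<close>; both avoid
    \<open>A m\<close>.\<close>
  have F_close: "(\<integral>\<^sup>+x. ennreal ((trig c B x - F x)\<^sup>2) \<partial>torus) \<le> ennreal (4 * (1 / 4) ^ m)"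
    if B: "finite B" "A m \<subseteq> B" for B m
  proof -
    have [measurable]: "F \<in> borel_measurable torus" "P n \<in> borel_measurable torus"
      "trig c B \<in> borel_measurable torus" for n
      using F_meas P_meas L2_measurable[OF L2_trig] by (auto intro: borel_measurable_torus)
    have "(\<integral>\<^sup>+x. ennreal ((trig c B x - F x)\<^sup>2) \<partial>torus)
       = (\<integral>\<^sup>+x. liminf (\<lambda>n. ennreal ((trig c B x - P n x)\<^sup>2)) \<partial>torus)"
    proof (rule nn_integral_cong_AE)
      show "AE x in torus. ennreal ((trig c B x - F x)\<^sup>2) = liminf (\<lambda>n. ennreal ((trig c B x - P n x)\<^sup>2))"
        using F_lim
      proof eventually_elim
        case (elim x)
        have "(\<lambda>n. ennreal ((trig c B x - P n x)\<^sup>2)) \<longlonglongrightarrow> ennreal ((trig c B x - F x)\<^sup>2)"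
          by (intro tendsto_ennrealI tendsto_intros elim)
        then show ?case by (rule lim_imp_Liminf[OF sequentially_bot, symmetric])
      qed
    qed
    also have "\<dots> \<le> liminf (\<lambda>n. \<integral>\<^sup>+x. ennreal ((trig c B x - P n x)\<^sup>2) \<partial>torus)"
      by (rule nn_integral_liminf) measurable
    also have "\<dots> \<le> ennreal (4 * (1 / 4) ^ m)"
    proof (rule Liminf_le[OF sequentially_bot], rule eventually_sequentiallyI[of m])
      fix n assume n: "m \<le> n"
      have d: "A m \<inter> (B - A n) = {}" "A m \<inter> (A n - B) = {}"
        using A_mono[OF n] B(2) by auto
      have fin: "finite (B - A n)" "finite (A n - B)" using A B(1) by auto
      have e: "trig c B x - P n x = trig c (B - A n) x - trig c (A n - B) x" for x
        unfolding P_def by (rule trig_diff[OF B(1) A])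
      note sq = L2_integrable_square[OF L2_trig]
      have "(LINT x|torus. (trig c B x - P n x)\<^sup>2)
         \<le> (LINT x|torus. 2 * (trig c (B - A n) x)\<^sup>2 + 2 * (trig c (A n - B) x)\<^sup>2)"
      proof (rule integral_mono)
        show "integrable torus (\<lambda>x. (trig c B x - P n x)\<^sup>2)"
          unfolding P_def by (intro L2_integrable_square L2_diff L2_trig)
        show "(trig c B x - P n x)\<^sup>2 \<le> 2 * (trig c (B - A n) x)\<^sup>2 + 2 * (trig c (A n - B) x)\<^sup>2" for x
        proof -
          have "2 * a\<^sup>2 + 2 * b\<^sup>2 - (a - b)\<^sup>2 = (a + b)\<^sup>2" for a b :: real
            by (simp add: power2_eq_square algebra_simps)
          then show ?thesis unfolding e by (metis diff_ge_0_iff_ge zero_le_power2)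
        qed
      qed (use sq in auto)
      also have "\<dots> \<le> 4 * (1 / 4) ^ m"
        using sq tail[OF fin(1) d(1)] tail[OF fin(2) d(2)] by simp
      finally have "(LINT x|torus. (trig c B x - P n x)\<^sup>2) \<le> 4 * (1 / 4) ^ m" .
      moreover have "integrable torus (\<lambda>x. (trig c B x - P n x)\<^sup>2)"
        unfolding P_def by (intro L2_integrable_square L2_diff L2_trig)
      ultimately show "(\<integral>\<^sup>+x. ennreal ((trig c B x - P n x)\<^sup>2) \<partial>torus) \<le> ennreal (4 * (1 / 4) ^ m)"
        by (subst nn_integral_eq_integral) (auto intro: ennreal_leI)
    qed
    finally show ?thesis .
  qed
  have diff_L2: "(\<lambda>x. trig c B x - F x) \<in> L2" if B: "finite B" "A m \<subseteq> B" for B m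
    unfolding L2_def
  proof (intro CollectI conjI)
    show "periodic (\<lambda>x. trig c B x - F x)"
      using F_per periodic_trig[of c B] by (simp add: periodic_def)
    show meas: "(\<lambda>x. trig c B x - F x) \<in> borel_measurable borel"
      using F_meas L2_borel[OF L2_trig, of c B] by measurable
    have [measurable]: "(\<lambda>x. trig c B x - F x) \<in> borel_measurable torus"
      using meas by (rule borel_measurable_torus)
    show "integrable torus (\<lambda>x. (norm (trig c B x - F x))\<^sup>2)"
    proof (rule integrableI_nonneg)
      show "(\<integral>\<^sup>+x. ennreal ((norm (trig c B x - F x))\<^sup>2) \<partial>torus) < \<infinity>"
        using F_close[OF B] by (simp add: le_less_trans)
    qed auto
  qed
  have F_L2: "F \<in> L2"
  proof -
    have "(\<lambda>x. trig c (A 0) x - (trig c (A 0) x - F x)) \<in> L2"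
      by (intro L2_diff[OF L2_trig] diff_L2[of "A 0" 0] A) simp
    then show ?thesis by simp
  qed
  have close: "(LINT x|torus. (trig c B x - F x)\<^sup>2) \<le> 4 * (1 / 4) ^ m"
    if B: "finite B" "A m \<subseteq> B" for B m
  proof -
    have "ennreal (LINT x|torus. (trig c B x - F x)\<^sup>2) = (\<integral>\<^sup>+x. ennreal ((trig c B x - F x)\<^sup>2) \<partial>torus)"
      by (rule nn_integral_eq_integral[symmetric]) (auto intro: L2_integrable_square diff_L2[OF B])
    also have "\<dots> \<le> ennreal (4 * (1 / 4) ^ m)" by (rule F_close[OF B])
    finally show ?thesis by (simp add: ennreal_le_iff)
  qed
  have "((\<lambda>B. LINT x|torus. (trig c B x - F x)\<^sup>2) \<longlongrightarrow> 0) (finite_subsets_at_top UNIV)"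
  proof (rule tendstoI)
    fix e :: real assume "0 < e"
    then obtain m where m: "(1 / 4) ^ m < e / 4"
      using real_arch_pow_inv[of "e / 4" "1 / 4"] by auto
    show "\<forall>\<^sub>F B in finite_subsets_at_top UNIV. dist (LINT x|torus. (trig c B x - F x)\<^sup>2) 0 < e"
      unfolding eventually_finite_subsets_at_top
    proof (intro exI[of _ "A m"] conjI allI impI)
      fix B assume "finite B \<and> A m \<subseteq> B \<and> B \<subseteq> UNIV"
      then show "dist (LINT x|torus. (trig c B x - F x)\<^sup>2) 0 < e"
        using close[of B m] m by (simp add: dist_real_def)
    qed (use A in auto)
  qed
  with F_L2 L2_trig show ?thesis by (intro that) (simp add: L2_tendsto_def)
qed

text \<open>As soon as the finite set contains k and - k, the Hermitian symmetry makes the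
  coefficient of the truncation equal to \<open>c k\<close>, so the limit is eventually
  constant.\<close>

lemma sfourier_Riesz_Fischer:
  assumes lim: "L2_tendsto (trig c) F (finite_subsets_at_top UNIV)"
    and herm: "\<And>k. c (- k) = cnj (c k)"
  shows "sfourier F k = c k"
proof -
  have "\<forall>\<^sub>F A in finite_subsets_at_top UNIV. sfourier (trig c A) k = c k"
    unfolding eventually_finite_subsets_at_top
    by (rule exI[of _ "{k, - k}"]) (auto simp: sfourier_trig herm)
  then have "((\<lambda>A. sfourier (trig c A) k) \<longlongrightarrow> c k) (finite_subsets_at_top UNIV)"
    by (rule tendsto_eventually)
  then show ?thesis
    using sfourier_tendsto[OF lim] tendsto_unique[OF finite_subsets_at_top_neq_bot] by blast
qed

section \<open>Uniqueness of Fourier coefficients and Parseval's identity\<close>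

text \<open>The cube as a subset of the product of three circles, on which the Stone--Weierstrass
  theorem applies.\<close>

definition circles :: "real ^ 3 \<Rightarrow> complex ^ 3" where
  "circles x = (\<chi> i. cis (2 * pi * x $ i))"

lemma continuous_circles: "continuous_on S circles"
  unfolding circles_def by (intro continuous_intros)

text \<open>Opposite faces of the cube are identified, so one of the points must be interior; then
  each coordinate difference is an integer strictly between -1 and 1.\<close>

lemma circles_inj:
  assumes eq: "circles x = circles y" and x: "x \<in> box 0 1" and y: "y \<in> cbox 0 1"
  shows "x = y"
proof (rule vec_eq_iff[THEN iffD2], rule allI)
  fix i
  have "cis (2 * pi * x $ i) = cis (2 * pi * y $ i)"
    using eq by (simp add: circles_def vec_eq_iff)
  then have "sin (2 * pi * x $ i) = sin (2 * pi * y $ i) \<and> cos (2 * pi * x $ i) = cos (2 * pi * y $ i)"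
    by (simp add: complex_eq_iff)
  then obtain n :: int where "2 * pi * x $ i = 2 * pi * y $ i + 2 * pi * n"
    unfolding sin_cos_eq_iff by auto
  then have "2 * pi * (x $ i - y $ i - n) = 0" by (simp add: algebra_simps)
  then have n: "x $ i - y $ i = n" by simp
  moreover have "0 < x $ i" "x $ i < 1" "0 \<le> y $ i" "y $ i \<le> 1"
    using x y by (simp_all add: mem_box_cart)
  ultimately have "real_of_int n < 1" "- 1 < real_of_int n" by linarith+
  then have "n = 0" by linarith
  with n show "x $ i = y $ i" by simp
qed

text \<open>Complex coefficients make this class an algebra directly: exponentials multiply by
  adding frequencies, with no product formulas for sines and cosines.\<close>

inductive trig_poly :: "(real ^ 3 \<Rightarrow> complex) \<Rightarrow> bool" where
  trig_poly_cis: "trig_poly (\<lambda>x. c * cis (phase k x))"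
| trig_poly_add: "trig_poly f \<Longrightarrow> trig_poly g \<Longrightarrow> trig_poly (\<lambda>x. f x + g x)"

lemma trig_poly_cis_mult: "trig_poly g \<Longrightarrow> trig_poly (\<lambda>x. c * cis (phase k x) * g x)"
proof (induction rule: trig_poly.induct)
  case (trig_poly_cis d l)
  have "(\<lambda>x. c * cis (phase k x) * (d * cis (phase l x))) = (\<lambda>x. (c * d) * cis (phase (k + l) x))"
    by (auto simp: phase_add mult_ac simp flip: cis_mult)
  then show ?case using trig_poly.trig_poly_cis[of "c * d" "k + l"] by simp
next
  case (trig_poly_add f g)
  then show ?case using trig_poly.trig_poly_add by (fastforce simp: distrib_left)
qed

lemma trig_poly_mult: "trig_poly f \<Longrightarrow> trig_poly g \<Longrightarrow> trig_poly (\<lambda>x. f x * g x)"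
proof (induction rule: trig_poly.induct)
  case (trig_poly_cis c k)
  then show ?case by (rule trig_poly_cis_mult)
next
  case (trig_poly_add f g)
  then show ?case using trig_poly.trig_poly_add by (fastforce simp: distrib_right)
qed

lemma trig_poly_const: "trig_poly (\<lambda>_. c)"
  using trig_poly_cis[of c 0] by simp

lemma trig_poly_sum: "(\<And>i. i \<in> I \<Longrightarrow> trig_poly (f i)) \<Longrightarrow> trig_poly (\<lambda>x. \<Sum>i\<in>I. f i x)"
  by (induction I rule: infinite_finite_induct) (auto intro: trig_poly_const trig_poly_add)

lemma trig_poly_circles_nth:
  "trig_poly (\<lambda>x. complex_of_real (Re (circles x $ i)))"
  "trig_poly (\<lambda>x. complex_of_real (Im (circles x $ i)))"
proof -
  have p: "phase (axis i 1) x = 2 * pi * x $ i" for x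
  proof -
    have "rvec (axis i 1) = axis i 1" by (simp add: rvec_def axis_def vec_eq_iff)
    then show ?thesis by (simp add: phase_def inner_axis inner_commute)
  qed
  have "trig_poly (\<lambda>x. (1/2) * cis (phase (axis i 1) x) + (1/2) * cis (phase (- axis i 1) x))"
    by (intro trig_poly.intros)
  moreover have "(1/2) * cis (phase (axis i 1) x) + (1/2) * cis (phase (- axis i 1) x)
      = complex_of_real (Re (circles x $ i))" for x
    by (simp add: complex_eq_iff phase_minus p circles_def)
  ultimately show "trig_poly (\<lambda>x. complex_of_real (Re (circles x $ i)))" by simp
  have "trig_poly (\<lambda>x. (- \<i>/2) * cis (phase (axis i 1) x) + (\<i>/2) * cis (phase (- axis i 1) x))"
    by (intro trig_poly.intros)
  moreover have "(- \<i>/2) * cis (phase (axis i 1) x) + (\<i>/2) * cis (phase (- axis i 1) x)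
      = complex_of_real (Im (circles x $ i))" for x
    by (simp add: complex_eq_iff phase_minus p circles_def)
  ultimately show "trig_poly (\<lambda>x. complex_of_real (Im (circles x $ i)))" by simp
qed

text \<open>A real polynomial on complex 3-space is built from real and imaginary parts of the
  coordinates, and on the three circles these are cosines and sines.\<close>

lemma trig_poly_polynomial:
  "real_polynomial_function p \<Longrightarrow> trig_poly (\<lambda>x. complex_of_real (p (circles x)))"
proof (induction rule: real_polynomial_function.induct)
  case (linear h)
  have h: "linear h" using linear by (rule bounded_linear.linear)
  have "circles x = (\<Sum>i\<in>UNIV. Re (circles x $ i) *\<^sub>R axis i 1 + Im (circles x $ i) *\<^sub>R axis i \<i>)" for x
    by (auto simp: vec_eq_iff complex_eq_iff axis_def if_distrib cong: if_cong)
  then have "h (circles x) = h (\<Sum>i\<in>UNIV. Re (circles x $ i) *\<^sub>R axis i 1 + Im (circles x $ i) *\<^sub>R axis i \<i>)" for x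
    by metis
  then have "complex_of_real (h (circles x)) = (\<Sum>i\<in>UNIV. of_real (h (axis i 1)) * of_real (Re (circles x $ i))
      + of_real (h (axis i \<i>)) * of_real (Im (circles x $ i)))" for x
    using h by (simp add: linear_sum linear_add linear_cmul mult.commute)
  then show ?case
    by (auto intro!: trig_poly_sum trig_poly_add trig_poly_mult trig_poly_const trig_poly_circles_nth)
next
  case (const c)
  show ?case by (rule trig_poly_const)
next
  case (add f g)
  then show ?case by (simp add: trig_poly_add)
next
  case (mult f g)
  then show ?case by (simp add: trig_poly_mult)
qed

lemma trig_poly_integral_zero:
  assumes f: "f \<in> L2" and zero: "\<And>k. sfourier f k = 0" and g: "trig_poly g"
  shows "integrable torus (\<lambda>x. complex_of_real (f x) * g x) \<and> (LINT x|torus. complex_of_real (f x) * g x) = 0"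
  using g
proof (induction rule: trig_poly.induct)
  case (trig_poly_cis c k)
  have e: "(\<lambda>x. complex_of_real (f x) * (c * cis (phase k x))) = (\<lambda>x. c * (complex_of_real (f x) * cis (- phase (- k) x)))"
    by (simp add: phase_minus mult_ac)
  show ?case unfolding e
    using integrable_mult_cis[OF f, of "- k"] zero[of "- k"] by (simp add: sfourier_def)
next
  case (trig_poly_add g h)
  then show ?case by (simp add: distrib_left)
qed

lemma sfourier_zero_imp_orthogonal_polynomial:
  assumes f: "f \<in> L2" and zero: "\<And>k. sfourier f k = 0" and p: "real_polynomial_function p"
  shows "(LINT x|torus. f x * p (circles x)) = 0"
proof -
  have "complex_of_real (LINT x|torus. f x * p (circles x)) = (LINT x|torus. complex_of_real (f x) * complex_of_real (p (circles x)))"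
    by (simp flip: integral_complex_of_real)
  also have "\<dots> = 0"
    using trig_poly_integral_zero[OF f zero trig_poly_polynomial[OF p]] by simp
  finally show ?thesis by simp
qed

text \<open>Polynomials approximate \<phi> uniformly on the compact image of the cube, and
  integrability of f turns a uniform error into an error of the integral.\<close>

lemma sfourier_zero_imp_orthogonal_continuous:
  assumes f: "f \<in> L2" and zero: "\<And>k. sfourier f k = 0" and \<phi>: "continuous_on UNIV \<phi>"
  shows "(LINT x|torus. f x * \<phi> (circles x)) = 0"
proof (rule ccontr)
  define I where "I = \<bar>LINT x|torus. f x * \<phi> (circles x)\<bar>"
  define N where "N = (LINT x|torus. \<bar>f x\<bar>)"
  assume "\<not> ?thesis"
  then have "0 < I" by (simp add: I_def)
  have "0 \<le> N" by (simp add: N_def)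
  \<comment> \<open>Chosen so that e * (N + 1) = I / 2; the summand 1 covers the case N = 0.\<close>
  define e where "e = I / (2 * (N + 1))"
  have e: "0 < e" using \<open>0 < I\<close> \<open>0 \<le> N\<close> by (simp add: e_def)
  have cpt: "compact (circles ` cbox 0 1)"
    by (intro compact_continuous_image continuous_circles compact_cbox)
  obtain p where p: "real_polynomial_function p" "\<And>z. z \<in> circles ` cbox 0 1 \<Longrightarrow> \<bar>\<phi> z - p z\<bar> < e"
    using Stone_Weierstrass_real_polynomial_function[OF cpt continuous_on_subset[OF \<phi>] e] by blast
  have fi: "integrable torus f" by (rule L2_integrable[OF f])
  have int: "integrable torus (\<lambda>x. f x * \<psi> (circles x))" if "continuous_on UNIV \<psi>" for \<psi>
  proof -
    have cont: "continuous_on S (\<lambda>x. \<psi> (circles x))" for S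
      by (intro continuous_on_compose2[OF that] continuous_circles) simp
    have "bounded ((\<lambda>x. \<psi> (circles x)) ` cbox 0 1)"
      by (intro compact_imp_bounded compact_continuous_image cont compact_cbox)
    then obtain B where B: "\<And>x. x \<in> cbox 0 1 \<Longrightarrow> \<bar>\<psi> (circles x)\<bar> \<le> B"
      by (auto simp: bounded_iff)
    have [measurable]: "(\<lambda>x. \<psi> (circles x)) \<in> borel_measurable torus" "f \<in> borel_measurable torus"
      using L2_measurable[OF f] by (auto intro!: borel_measurable_torus borel_measurable_continuous_onI cont)
    show ?thesis
    proof (rule Bochner_Integration.integrable_bound[OF integrable_mult_right[OF fi, of B]])
      show "AE x in torus. norm (f x * \<psi> (circles x)) \<le> norm (B * f x)"
      proof (rule AE_I2)
        fix x :: "real ^ 3" assume "x \<in> space torus"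
        then have "\<bar>\<psi> (circles x)\<bar> \<le> \<bar>B\<bar>" using B[of x] by (simp add: space_restrict_space)
        then show "norm (f x * \<psi> (circles x)) \<le> norm (B * f x)"
          using mult_left_mono[of "\<bar>\<psi> (circles x)\<bar>" "\<bar>B\<bar>" "\<bar>f x\<bar>"] by (simp add: abs_mult mult.commute)
      qed
    qed measurable
  qed
  have pc: "continuous_on UNIV p"
    using p(1) by (simp add: continuous_on_polymonial_function real_polynomial_function_eq)
  have "(LINT x|torus. f x * \<phi> (circles x)) = (LINT x|torus. f x * \<phi> (circles x) - f x * p (circles x))"
    using int[OF \<phi>] int[OF pc] sfourier_zero_imp_orthogonal_polynomial[OF f zero p(1)] by simp
  also have "\<bar>\<dots>\<bar> \<le> (LINT x|torus. e * \<bar>f x\<bar>)"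
  proof (rule integral_abs_bound[THEN order_trans], rule integral_mono_AE)
    show "AE x in torus. \<bar>f x * \<phi> (circles x) - f x * p (circles x)\<bar> \<le> e * \<bar>f x\<bar>"
    proof (rule AE_I2)
      fix x :: "real ^ 3" assume "x \<in> space torus"
      then have "\<bar>\<phi> (circles x) - p (circles x)\<bar> \<le> e" using p(2)[of "circles x"] by (simp add: space_restrict_space)
      then have "\<bar>f x\<bar> * \<bar>\<phi> (circles x) - p (circles x)\<bar> \<le> \<bar>f x\<bar> * e" by (intro mult_left_mono) auto
      then show "\<bar>f x * \<phi> (circles x) - f x * p (circles x)\<bar> \<le> e * \<bar>f x\<bar>"
        by (simp add: mult.commute flip: abs_mult right_diff_distrib)
    qed
  qed (use int[OF \<phi>] int[OF pc] fi in auto)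
  also have "\<dots> = e * N" by (simp add: N_def)
  also have "\<dots> \<le> e * (N + 1)" using e by simp
  also have "\<dots> = I / 2"
  proof -
    have "N + 1 \<noteq> 0" using \<open>0 \<le> N\<close> by simp
    then show ?thesis unfolding e_def by (simp add: divide_simps)
  qed
  finally show False using \<open>0 < I\<close> by (simp add: I_def)
qed

lemma AE_torus_interior: "AE x in torus. x \<in> box 0 1"
proof -
  have "emeasure lborel (cbox 0 1 - box 0 1 :: (real ^ 3) set) = 0"
  proof (subst emeasure_Diff)
    have "\<forall>b\<in>Basis. 0 \<bullet> b \<le> (1 :: real ^ 3) \<bullet> b" by (auto simp: Basis_vec_def inner_axis)
    then show "emeasure lborel (cbox 0 1 :: (real ^ 3) set) - emeasure lborel (box 0 1 :: (real ^ 3) set) = 0"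
      by (simp add: emeasure_lborel_cbox_eq emeasure_lborel_box_eq)
  qed (auto simp: box_subset_cbox emeasure_lborel_box_eq)
  then have "AE x in lborel. x \<notin> (cbox 0 1 - box 0 1 :: (real ^ 3) set)"
    by (intro AE_not_in) auto
  then show ?thesis by (subst AE_restrict_space_iff) auto
qed

text \<open>The indicator of an open set is, on the open cube, the increasing limit of truncated
  multiples of the distance to the image of the complement. These are continuous functions of
  \<open>circles x\<close>, to which the preceding lemma applies.\<close>

lemma sfourier_zero_imp_set_integral_open:
  assumes f: "f \<in> L2" and zero: "\<And>k. sfourier f k = 0" and U: "open U"
  shows "(LINT x|torus. f x * indicator U x) = 0"
proof -
  \<comment> \<open>Cutting with the open cube puts the whole boundary into the complement, so the
    identification of opposite faces cannot mix points inside V with points outside.\<close>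
  define V where "V = U \<inter> box 0 1"
  have "open V" using U by (auto simp: V_def open_box)
  define K where "K = circles ` (cbox 0 1 - V)"
  have K: "closed K" "K \<noteq> {}"
  proof -
    have "compact (cbox 0 1 - V)"
      using \<open>open V\<close> by (intro compact_diff compact_cbox)
    then show "closed K"
      unfolding K_def by (intro compact_imp_closed compact_continuous_image continuous_circles)
    \<comment> \<open>The origin is a boundary point. A nonempty K is required since
      \<open>infdist\<close> to the empty set is 0.\<close>
    have "0 \<in> cbox 0 1 - V" by (auto simp: V_def mem_box_cart)
    then show "K \<noteq> {}" unfolding K_def by blast
  qed
  define \<phi> where "\<phi> n z = min 1 (real n * infdist z K)" for n z
  have \<phi>_cont: "continuous_on UNIV (\<phi> n)" for n
    unfolding \<phi>_def by (intro continuous_intros)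
  have [measurable]: "f \<in> borel_measurable torus" by (rule L2_measurable[OF f])
  have U_meas [measurable]: "U \<in> sets borel" using U by simp
  have \<phi>_meas [measurable]: "(\<lambda>x. \<phi> n (circles x)) \<in> borel_measurable torus" for n
    by (intro borel_measurable_torus borel_measurable_continuous_onI continuous_on_compose2[OF \<phi>_cont] continuous_circles) simp
  have ind_meas [measurable]: "(indicator U :: _ \<Rightarrow> real) \<in> borel_measurable torus"
    by (rule borel_measurable_torus) measurable
  have "(\<lambda>n. LINT x|torus. f x * \<phi> n (circles x)) \<longlonglongrightarrow> (LINT x|torus. f x * indicator U x)"
  proof (rule integral_dominated_convergence[where w = "\<lambda>x. \<bar>f x\<bar>"])
    show "AE x in torus. (\<lambda>n. f x * \<phi> n (circles x)) \<longlonglongrightarrow> f x * indicator U x"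
      using AE_torus_interior AE_space
    proof eventually_elim
      case (elim x)
      have x: "x \<in> cbox 0 1" using elim(2) by (simp add: space_restrict_space)
      have "(\<lambda>n. \<phi> n (circles x)) \<longlonglongrightarrow> indicator U x"
      proof (cases "x \<in> U")
        case True
        have "circles x \<notin> K"
        proof
          assume "circles x \<in> K"
          then obtain y where y: "y \<in> cbox 0 1" "y \<notin> V" "circles x = circles y" by (auto simp: K_def)
          then have "x = y" using circles_inj elim(1) by blast
          with y True elim(1) show False by (simp add: V_def)
        qed
        then have d: "0 < infdist (circles x) K"
          using infdist_pos_not_in_closed K by blast
        then obtain N where N: "1 < real N * infdist (circles x) K"
          using reals_Archimedean3 by blast
        have "\<phi> n (circles x) = 1" if "N \<le> n" for n
        proof -
          have "real N * infdist (circles x) K \<le> real n * infdist (circles x) K"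
            using that d by (intro mult_right_mono) auto
          then show ?thesis using N by (simp add: \<phi>_def)
        qed
        then have "(\<lambda>n. \<phi> n (circles x)) \<longlonglongrightarrow> 1"
          by (intro tendsto_eventually eventually_sequentiallyI[of N])
        then show ?thesis using True by simp
      next
        case False
        then have "circles x \<in> K" using x by (auto simp: K_def V_def)
        then have "\<phi> n (circles x) = 0" for n by (simp add: \<phi>_def)
        then show ?thesis using False by simp
      qed
      then show ?case by (intro tendsto_intros)
    qed
    show "AE x in torus. norm (f x * \<phi> n (circles x)) \<le> \<bar>f x\<bar>" for n
    proof (rule AE_I2)
      fix x
      have "\<bar>\<phi> n (circles x)\<bar> \<le> 1" by (simp add: \<phi>_def infdist_nonneg)
      then show "norm (f x * \<phi> n (circles x)) \<le> \<bar>f x\<bar>"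
        by (simp add: abs_mult mult_left_le)
    qed
    show "integrable torus (\<lambda>x. \<bar>f x\<bar>)" using L2_integrable[OF f] by simp
  qed measurable
  moreover have "(LINT x|torus. f x * \<phi> n (circles x)) = 0" for n
    by (rule sfourier_zero_imp_orthogonal_continuous[OF f zero \<phi>_cont])
  ultimately show ?thesis by (simp add: LIMSEQ_const_iff)
qed

text \<open>The Borel sets over which f integrates to 0 are closed under complements and countable
  disjoint unions and contain the open sets, an intersection-stable generator. Hence they are all
  Borel sets, and a density that vanishes on every measurable set is null.\<close>

theorem sfourier_zero_imp_AE_zero:
  assumes f: "f \<in> L2" and zero: "\<And>k. sfourier f k = 0"
  shows "AE x in torus. f x = 0"
proof (rule torus.density_zero)
  show fi: "integrable torus f" by (rule L2_integrable[OF f])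
  have int: "set_integrable torus A f" if "A \<in> sets torus" for A
    using fi that unfolding set_integrable_def by (rule integrable_mult_indicator[rotated])
  have borel_torus: "B \<inter> cbox 0 1 \<in> sets torus" if "B \<in> sets borel" for B :: "(real ^ 3) set"
    using that by (auto simp: sets_restrict_space)
  have borel: "(LINT x:B \<inter> cbox 0 1|torus. f x) = 0" if "B \<in> sets borel" for B
  proof -
    have eq: "(LINT x:B \<inter> cbox 0 1|torus. f x) = (LINT x|torus. f x * indicator B x)" for B
      unfolding set_lebesgue_integral_def
      by (intro Bochner_Integration.integral_cong) (auto simp: space_restrict_space indicator_def)
    have "Int_stable {S :: (real ^ 3) set. open S}"
      by (auto simp: Int_stable_def)
    moreover have "{S :: (real ^ 3) set. open S} \<subseteq> Pow UNIV" by simp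
    moreover have "B \<in> sigma_sets UNIV {S :: (real ^ 3) set. open S}"
      using that by (simp add: borel_def)
    ultimately show ?thesis
    proof (induction rule: sigma_sets_induct_disjoint)
      case (basic A)
      then show ?case unfolding eq using sfourier_zero_imp_set_integral_open[OF f zero] by simp
    next
      case empty
      show ?case by (simp add: set_lebesgue_integral_def)
    next
      case (compl A)
      then have A: "A \<in> sets borel" by (simp add: borel_def)
      have "UNIV - A = - A" by auto
      have "(LINT x|torus. f x) = (LINT x|torus. f x * indicator (UNIV - A) x + f x * indicator A x)"
        by (intro Bochner_Integration.integral_cong) (auto simp: indicator_def)
      also have "\<dots> = (LINT x|torus. f x * indicator (UNIV - A) x) + (LINT x|torus. f x * indicator A x)"
      proof (rule Bochner_Integration.integral_add)
        have "integrable torus (\<lambda>x. f x * indicator B x)" if "B \<in> sets borel" for B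
        proof -
          have "(\<lambda>x. f x * indicator B x) \<in> borel_measurable torus"
            using L2_borel[OF f] that
            by (intro borel_measurable_torus borel_measurable_times borel_measurable_indicator)
          then show ?thesis
            by (intro Bochner_Integration.integrable_bound[OF fi]) (auto simp: indicator_def)
        qed
        then show "integrable torus (\<lambda>x. f x * indicator (UNIV - A) x)" "integrable torus (\<lambda>x. f x * indicator A x)"
          using A by auto
      qed
      finally show ?case
        using compl sfourier_zero_imp_set_integral_open[OF f zero open_UNIV] unfolding eq by simp
    next
      case (union A)
      then have A: "A i \<in> sets borel" for i by (auto simp: borel_def)
      have "(LINT x:(\<Union>i. A i \<inter> cbox 0 1)|torus. f x) = (\<Sum>i. LINT x:A i \<inter> cbox 0 1|torus. f x)"
      proof (rule lebesgue_integral_countable_add)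
        show "(A i \<inter> cbox 0 1) \<inter> (A j \<inter> cbox 0 1) = {}" if "i \<noteq> j" for i j
          using union(1) that by (auto simp: disjoint_family_on_def)
      qed (use A borel_torus in \<open>auto intro!: int\<close>)
      then show ?case using union by simp
    qed
  qed
  show "(LINT x:A|torus. f x) = 0" if A: "A \<in> sets torus" for A
  proof -
    obtain B where B: "B \<in> sets borel" "A = B \<inter> cbox 0 1"
      using A by (auto simp: sets_restrict_space)
    then show ?thesis using borel by simp
  qed
qed

lemma sfourier_eq_imp_AE_eq:
  assumes "f \<in> L2" "g \<in> L2" "\<And>k. sfourier f k = sfourier g k"
  shows "AE x in torus. f x = g x"
proof -
  have "AE x in torus. f x - g x = 0"
    by (rule sfourier_zero_imp_AE_zero) (use assms in \<open>auto intro: L2_diff simp: sfourier_diff\<close>)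
  then show ?thesis by eventually_elim simp
qed

lemma L2_tendsto_cong_AE:
  assumes lim: "L2_tendsto f F flt" and G: "G \<in> L2" and ae: "AE x in torus. F x = G x"
  shows "L2_tendsto f G flt"
proof -
  have L2: "f i \<in> L2" "F \<in> L2" for i using lim by (auto simp: L2_tendsto_def)
  have "(LINT x|torus. (f i x - F x)\<^sup>2) = (LINT x|torus. (f i x - G x)\<^sup>2)" for i
  proof (rule integral_cong_AE)
    show "AE x in torus. (f i x - F x)\<^sup>2 = (f i x - G x)\<^sup>2"
      using ae by eventually_elim simp
  qed (use L2 G in \<open>auto intro!: L2_integrable_square L2_diff borel_measurable_integrable\<close>)
  then show ?thesis using lim G by (simp add: L2_tendsto_def)
qed

text \<open>Bessel makes the series converge to some \<open>L2\<close> function by Riesz--Fischer;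
  this limit has the coefficients of f, and uniqueness identifies it with f.\<close>

lemma trig_sfourier_tendsto:
  assumes f: "f \<in> L2"
  shows "L2_tendsto (trig (sfourier f)) f (finite_subsets_at_top UNIV)"
proof -
  obtain F where F: "L2_tendsto (trig (sfourier f)) F (finite_subsets_at_top UNIV)"
    using Riesz_Fischer[OF Bessel_summable[OF f]] .
  have "sfourier F k = sfourier f k" for k
    by (rule sfourier_Riesz_Fischer[OF F]) (rule sfourier_minus)
  then have "AE x in torus. F x = f x"
    using F f by (intro sfourier_eq_imp_AE_eq) (auto simp: L2_tendsto_def)
  then show ?thesis by (rule L2_tendsto_cong_AE[OF F f])
qed

lemma trig_tendsto:
  assumes "f \<in> L2" "\<And>k. sfourier f k = c k"
  shows "L2_tendsto (trig c) f (finite_subsets_at_top UNIV)"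
proof -
  have "c = sfourier f" using assms(2) by auto
  then show ?thesis using trig_sfourier_tendsto[OF assms(1)] by simp
qed

lemma Parseval:
  assumes f: "f \<in> L2" and g: "g \<in> L2"
  shows "((\<lambda>k. sfourier f k \<bullet> sfourier g k) has_sum (LINT x|torus. f x * g x)) UNIV"
  using L2_tendsto_integral_mult[OF trig_sfourier_tendsto[OF f] L2_tendsto_const[OF g]]
  by (simp add: has_sum_def trig_pairing[OF g])

section \<open>Weak derivatives and bounded convergence\<close>

text \<open>The Fourier multiplier of the partial derivative in direction j. It is purely imaginary,
  hence skew for the real inner product.\<close>

definition dsymbol :: "3 \<Rightarrow> int ^ 3 \<Rightarrow> complex" where
  "dsymbol j k = 2 * pi * \<i> * of_int (k $ j)"

lemma dsymbol_minus: "dsymbol j (- k) = cnj (dsymbol j k)"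
  by (simp add: dsymbol_def)

lemma inner_dsymbol: "a \<bullet> (dsymbol j k * b) = - ((dsymbol j k * a) \<bullet> b)"
  by (simp add: dsymbol_def inner_complex_def algebra_simps)

lemma L2_continuous:
  fixes f :: "real ^ 3 \<Rightarrow> real"
  assumes "continuous_on UNIV f" "periodic f"
  shows "f \<in> L2"
proof -
  have "bounded (f ` cbox 0 1)"
    using assms(1) by (intro compact_imp_bounded compact_continuous_image) (auto intro: continuous_on_subset)
  then obtain B where "\<And>x. x \<in> cbox 0 1 \<Longrightarrow> \<bar>f x\<bar> \<le> B"
    by (auto simp: bounded_iff)
  then have "AE x in torus. \<bar>f x\<bar> \<le> B"
    by (intro AE_I2) (simp add: space_restrict_space)
  then show ?thesis
    using assms by (intro L2_bounded borel_measurable_continuous_onI)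
qed

lemma sfourier_deriv:
  assumes f: "continuous_on UNIV f" "periodic f" and g: "continuous_on UNIV g" "periodic g"
    and deriv: "\<And>x. ((\<lambda>s. f (x + s *\<^sub>R axis j 1)) has_real_derivative g x) (at 0)"
  shows "sfourier g k = dsymbol j k * sfourier f k"
proof -
  define c where "c = 2 * pi * real_of_int (k $ j)"
  have L2: "f \<in> L2" "g \<in> L2" using f g by (auto intro: L2_continuous)
  note ints = L2_integrable_mult[OF L2(1) L2_cos] L2_integrable_mult[OF L2(1) L2_sin]
    L2_integrable_mult[OF L2(2) L2_cos] L2_integrable_mult[OF L2(2) L2_sin]
  have "(LINT x|torus. g x * cos (phase k x) - c * (f x * sin (phase k x))) = 0"
  proof (rule torus_integral_deriv[where F = "\<lambda>x. f x * cos (phase k x)" and j = j])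
    show "((\<lambda>s. f (x + s *\<^sub>R axis j 1) * cos (phase k (x + s *\<^sub>R axis j 1))) has_real_derivative
       g x * cos (phase k x) - c * (f x * sin (phase k x))) (at 0)" for x
      unfolding phase_shift c_def[symmetric]
      by (rule derivative_eq_intros deriv | simp add: algebra_simps)+
  qed (use f g in \<open>auto intro!: continuous_intros simp: periodic_def sin_cos_periodic\<close>)
  then have 1: "(LINT x|torus. g x * cos (phase k x)) = c * (LINT x|torus. f x * sin (phase k x))"
    using ints by simp
  have "(LINT x|torus. g x * sin (phase k x) + c * (f x * cos (phase k x))) = 0"
  proof (rule torus_integral_deriv[where F = "\<lambda>x. f x * sin (phase k x)" and j = j])
    show "((\<lambda>s. f (x + s *\<^sub>R axis j 1) * sin (phase k (x + s *\<^sub>R axis j 1))) has_real_derivative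
       g x * sin (phase k x) + c * (f x * cos (phase k x))) (at 0)" for x
      unfolding phase_shift c_def[symmetric]
      by (rule derivative_eq_intros deriv | simp add: algebra_simps)+
  qed (use f g in \<open>auto intro!: continuous_intros simp: periodic_def sin_cos_periodic\<close>)
  then have 2: "(LINT x|torus. g x * sin (phase k x)) = - c * (LINT x|torus. f x * cos (phase k x))"
    using ints by simp
  show ?thesis
    by (rule complex_eqI) (simp_all add: Re_sfourier Im_sfourier L2 dsymbol_def 1 2 c_def)
qed

lemma test_function_partial:
  assumes "test_function \<phi>"
  shows "continuous_on UNIV (\<lambda>x. frechet_derivative \<phi> (at x) (axis j 1))"
    and "periodic (\<lambda>x. frechet_derivative \<phi> (at x) (axis j 1))"
    and "((\<lambda>s. \<phi> (x + s *\<^sub>R axis j 1)) has_real_derivative frechet_derivative \<phi> (at x) (axis j 1)) (at 0)"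
proof -
  show "continuous_on UNIV (\<lambda>x. frechet_derivative \<phi> (at x) (axis j 1))"
    using assms by (simp add: test_function_def)
  have d: "(\<phi> has_derivative frechet_derivative \<phi> (at y)) (at y)" for y
    using assms by (simp add: test_function_def frechet_derivative_works)
  have "frechet_derivative \<phi> (at (y + axis i 1)) = frechet_derivative \<phi> (at y)" for y i
  proof -
    have "((\<lambda>z. \<phi> (z + axis i 1)) has_derivative frechet_derivative \<phi> (at (y + axis i 1))) (at y)"
      by (rule has_derivative_compose[of "\<lambda>z. z + axis i 1" "\<lambda>h. h" y UNIV \<phi>, OF _ d])
        (auto intro!: derivative_eq_intros)
    moreover have "(\<lambda>z. \<phi> (z + axis i 1)) = \<phi>"
      using assms by (simp add: test_function_def periodic_def)
    ultimately have "(\<phi> has_derivative frechet_derivative \<phi> (at (y + axis i 1))) (at y)" by simp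
    then show ?thesis by (rule has_derivative_unique[OF _ d])
  qed
  then show "periodic (\<lambda>x. frechet_derivative \<phi> (at x) (axis j 1))"
    by (simp add: periodic_def)
  have lin: "linear (frechet_derivative \<phi> (at x))"
    using d has_derivative_linear by blast
  have "((\<lambda>s. \<phi> (x + s *\<^sub>R axis j 1)) has_derivative (\<lambda>s. frechet_derivative \<phi> (at x) (s *\<^sub>R axis j 1))) (at 0)"
    by (rule has_derivative_compose[of "\<lambda>s. x + s *\<^sub>R axis j 1" "\<lambda>s. s *\<^sub>R axis j 1" 0 UNIV \<phi>])
      (use d[of x] in \<open>auto intro!: derivative_eq_intros\<close>)
  moreover have "(\<lambda>s. frechet_derivative \<phi> (at x) (s *\<^sub>R axis j 1)) = (*) (frechet_derivative \<phi> (at x) (axis j 1))"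
    using lin by (simp add: linear_cmul fun_eq_iff mult.commute)
  ultimately show "((\<lambda>s. \<phi> (x + s *\<^sub>R axis j 1)) has_real_derivative frechet_derivative \<phi> (at x) (axis j 1)) (at 0)"
    unfolding has_field_derivative_def by simp
qed

lemma test_function_L2:
  assumes "test_function \<phi>"
  shows "\<phi> \<in> L2"
proof (rule L2_continuous)
  show "continuous_on UNIV \<phi>" "periodic \<phi>"
    using assms by (auto simp: test_function_def intro!: differentiable_imp_continuous_on
        differentiable_at_imp_differentiable_on)
qed

text \<open>Parseval turns both sides of the defining identity into sums over frequencies, and
  skewness of the multiplier moves the derivative from the test function to f.\<close>

lemma is_weak_derivI:
  assumes f: "f \<in> L2" and g: "g \<in> L2" and eq: "\<And>k. sfourier g k = dsymbol j k * sfourier f k"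
  shows "is_weak_deriv j f g"
  unfolding is_weak_deriv_def
proof (intro conjI allI impI g)
  fix \<phi> assume \<phi>: "test_function \<phi>"
  let ?\<psi> = "\<lambda>x. frechet_derivative \<phi> (at x) (axis j 1)"
  have \<phi>L2: "\<phi> \<in> L2" by (rule test_function_L2[OF \<phi>])
  have \<psi>: "?\<psi> \<in> L2" using test_function_partial[OF \<phi>] by (intro L2_continuous)
  have \<phi>c: "continuous_on UNIV \<phi>" "periodic \<phi>"
    using \<phi> by (auto simp: test_function_def intro!: differentiable_imp_continuous_on
        differentiable_at_imp_differentiable_on)
  have \<psi>hat: "sfourier ?\<psi> k = dsymbol j k * sfourier \<phi> k" for k
    using test_function_partial[OF \<phi>] \<phi>c by (intro sfourier_deriv)
  have "((\<lambda>k. - (sfourier g k \<bullet> sfourier \<phi> k)) has_sum (LINT x|torus. f x * ?\<psi> x)) UNIV"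
    using Parseval[OF f \<psi>] by (simp add: \<psi>hat eq inner_dsymbol)
  moreover have "((\<lambda>k. - (sfourier g k \<bullet> sfourier \<phi> k)) has_sum - (LINT x|torus. g x * \<phi> x)) UNIV"
    using Parseval[OF g \<phi>L2] by (simp add: has_sum_uminus)
  ultimately show "(LINT x|torus. f x * ?\<psi> x) = - (LINT x|torus. g x * \<phi> x)"
    by (rule has_sum_unique)
qed

lemma test_function_sin_cos:
  "test_function (\<lambda>x. cos (phase k x))"
  "test_function (\<lambda>x. sin (phase k x))"
  "frechet_derivative (\<lambda>x. cos (phase k x)) (at x) (axis j 1) = - (2 * pi * of_int (k $ j)) * sin (phase k x)"
  "frechet_derivative (\<lambda>x. sin (phase k x)) (at x) (axis j 1) = (2 * pi * of_int (k $ j)) * cos (phase k x)"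
proof -
  have dp: "(phase k has_derivative (\<lambda>h. 2 * pi * (rvec k \<bullet> h))) (at y)" for y
    unfolding phase_def by (auto intro!: derivative_eq_intros)
  have dc: "((\<lambda>x. cos (phase k x)) has_derivative (\<lambda>h. (2 * pi * (rvec k \<bullet> h)) * - sin (phase k y))) (at y)" for y
    by (rule has_derivative_cos[OF dp])
  have ds: "((\<lambda>x. sin (phase k x)) has_derivative (\<lambda>h. (2 * pi * (rvec k \<bullet> h)) * cos (phase k y))) (at y)" for y
    by (rule has_derivative_sin[OF dp])
  note fd = frechet_derivative_at[OF dc, symmetric] frechet_derivative_at[OF ds, symmetric]
  show "test_function (\<lambda>x. cos (phase k x))" "test_function (\<lambda>x. sin (phase k x))"
    unfolding test_function_def fd using dc ds
    by (auto simp: periodic_def sin_cos_periodic differentiable_def intro!: continuous_intros)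
  show "frechet_derivative (\<lambda>x. cos (phase k x)) (at x) (axis j 1) = - (2 * pi * of_int (k $ j)) * sin (phase k x)"
    "frechet_derivative (\<lambda>x. sin (phase k x)) (at x) (axis j 1) = (2 * pi * of_int (k $ j)) * cos (phase k x)"
    unfolding fd by (simp_all add: inner_axis rvec_nth)
qed

text \<open>Testing with the cosine and the sine of frequency k recovers the real and imaginary
  parts of the coefficient, so every weak derivative has the same coefficients.\<close>

lemma is_weak_derivD:
  assumes f: "f \<in> L2" and g: "is_weak_deriv j f g"
  shows "g \<in> L2" "sfourier g k = dsymbol j k * sfourier f k"
proof -
  show gL2: "g \<in> L2" using g by (simp add: is_weak_deriv_def)
  have "(LINT x|torus. f x * frechet_derivative \<phi> (at x) (axis j 1)) = - (LINT x|torus. g x * \<phi> x)"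
    if "test_function \<phi>" for \<phi>
    using g that by (simp add: is_weak_deriv_def)
  from this[OF test_function_sin_cos(1)[of k]] this[OF test_function_sin_cos(2)[of k]]
  have "(LINT x|torus. - (2 * pi * of_int (k $ j)) * (f x * sin (phase k x))) = - (LINT x|torus. g x * cos (phase k x))"
    "(LINT x|torus. (2 * pi * of_int (k $ j)) * (f x * cos (phase k x))) = - (LINT x|torus. g x * sin (phase k x))"
    unfolding test_function_sin_cos by (simp_all add: mult_ac)
  then have "(LINT x|torus. g x * cos (phase k x)) = 2 * pi * of_int (k $ j) * (LINT x|torus. f x * sin (phase k x))"
    "(LINT x|torus. g x * sin (phase k x)) = - (2 * pi * of_int (k $ j) * (LINT x|torus. f x * cos (phase k x)))"
    by simp_all
  then show "sfourier g k = dsymbol j k * sfourier f k"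
    by (intro complex_eqI) (simp_all add: Re_sfourier Im_sfourier f gL2 dsymbol_def)
qed

text \<open>Riesz--Fischer supplies a witness, so the choice in \<open>weak_deriv\<close> is made
  from a nonempty set; \<open>is_weak_derivD\<close> then applies to whatever representative was
  chosen.\<close>

lemma weak_deriv_L2_sfourier:
  assumes f: "f \<in> L2" and sum: "(\<lambda>k. (cmod (dsymbol j k * sfourier f k))\<^sup>2) summable_on UNIV"
  shows "weak_deriv j f \<in> L2"
    and "sfourier (weak_deriv j f) k = dsymbol j k * sfourier f k"
proof -
  obtain F where F: "L2_tendsto (trig (\<lambda>k. dsymbol j k * sfourier f k)) F (finite_subsets_at_top UNIV)"
    using Riesz_Fischer[OF sum] .
  have "sfourier F k = dsymbol j k * sfourier f k" for k
    by (rule sfourier_Riesz_Fischer[OF F]) (simp add: dsymbol_minus sfourier_minus)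
  then have "is_weak_deriv j f F"
    using F by (intro is_weak_derivI f) (auto simp: L2_tendsto_def)
  then have "is_weak_deriv j f (weak_deriv j f)"
    unfolding weak_deriv_def by (rule someI[of "is_weak_deriv j f"])
  from is_weak_derivD[OF f this]
  show "weak_deriv j f \<in> L2" "sfourier (weak_deriv j f) k = dsymbol j k * sfourier f k" .
qed

section \<open>Bounded convergence and products of limits\<close>

lemma L2_tendsto_AE_bounded:
  assumes lim: "L2_tendsto f F flt" and flt: "flt \<noteq> bot" and bd: "\<And>i x. \<bar>f i x\<bar> \<le> C"
  shows "AE x in torus. \<bar>F x\<bar> \<le> C"
proof -
  have L2: "f i \<in> L2" "F \<in> L2" for i using lim by (auto simp: L2_tendsto_def)
  \<comment> \<open>The squared excess of the limit over the bound. It lies below (f i x - F x)^2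
    for every i, so its integral is 0, without passing to an almost everywhere convergent
    subsequence.\<close>
  define h where "h x = (max (\<bar>F x\<bar> - C) 0)\<^sup>2" for x
  have le: "h x \<le> (f i x - F x)\<^sup>2" for i x
  proof -
    have "max (\<bar>F x\<bar> - C) 0 \<le> \<bar>f i x - F x\<bar>" using bd[of i x] by linarith
    then have "(max (\<bar>F x\<bar> - C) 0)\<^sup>2 \<le> \<bar>f i x - F x\<bar>\<^sup>2" by (intro power_mono) auto
    then show ?thesis by (simp add: h_def)
  qed
  have sq: "integrable torus (\<lambda>x. (f i x - F x)\<^sup>2)" for i
    using L2 by (intro L2_integrable_square L2_diff)
  have hi: "integrable torus h"
  proof -
    have [measurable]: "F \<in> borel_measurable torus" using L2 by (rule_tac L2_measurable)
    have "h \<in> borel_measurable torus" unfolding h_def by measurable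
    then show ?thesis
      by (rule Bochner_Integration.integrable_bound[OF sq[of undefined]]) (use le in \<open>auto simp: h_def\<close>)
  qed
  have "(LINT x|torus. h x) \<le> (LINT x|torus. (f i x - F x)\<^sup>2)" for i
    using hi sq le by (intro integral_mono) auto
  moreover have "((\<lambda>i. LINT x|torus. (f i x - F x)\<^sup>2) \<longlongrightarrow> 0) flt"
    using lim by (simp add: L2_tendsto_def)
  ultimately have "(LINT x|torus. h x) \<le> 0"
    using flt by (intro tendsto_lowerbound[where f = "\<lambda>i. LINT x|torus. (f i x - F x)\<^sup>2"]) auto
  moreover have "0 \<le> (LINT x|torus. h x)" by (simp add: h_def)
  ultimately have "(LINT x|torus. h x) = 0" by simp
  then have "AE x in torus. h x = 0"
    using hi by (subst (asm) integral_nonneg_eq_0_iff_AE) (auto simp: h_def)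
  then show ?thesis by eventually_elim (auto simp: h_def max_def split: if_splits)
qed

lemma L2_tendsto_add:
  assumes f: "L2_tendsto f F flt" and g: "L2_tendsto g G flt"
  shows "L2_tendsto (\<lambda>i x. f i x + g i x) (\<lambda>x. F x + G x) flt"
proof -
  have L2: "f i \<in> L2" "g i \<in> L2" "F \<in> L2" "G \<in> L2" for i
    using f g by (auto simp: L2_tendsto_def)
  have "((\<lambda>i. 2 * (LINT x|torus. (f i x - F x)\<^sup>2) + 2 * (LINT x|torus. (g i x - G x)\<^sup>2)) \<longlongrightarrow> 2 * 0 + 2 * 0) flt"
    using f g unfolding L2_tendsto_def by (intro tendsto_intros) auto
  then have lim: "((\<lambda>i. 2 * (LINT x|torus. (f i x - F x)\<^sup>2) + 2 * (LINT x|torus. (g i x - G x)\<^sup>2)) \<longlongrightarrow> 0) flt"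
    by simp
  have "norm (LINT x|torus. (f i x + g i x - (F x + G x))\<^sup>2)
     \<le> 2 * (LINT x|torus. (f i x - F x)\<^sup>2) + 2 * (LINT x|torus. (g i x - G x)\<^sup>2)" for i
  proof -
    have sq: "integrable torus (\<lambda>x. (f i x - F x)\<^sup>2)" "integrable torus (\<lambda>x. (g i x - G x)\<^sup>2)"
      using L2 by (auto intro!: L2_integrable_square L2_diff)
    have "(LINT x|torus. (f i x + g i x - (F x + G x))\<^sup>2)
      \<le> (LINT x|torus. 2 * (f i x - F x)\<^sup>2 + 2 * (g i x - G x)\<^sup>2)"
    proof (rule integral_mono)
      show "integrable torus (\<lambda>x. (f i x + g i x - (F x + G x))\<^sup>2)"
        using L2 by (intro L2_integrable_square L2_diff L2_add)
      have "(a + b - (c + d))\<^sup>2 \<le> 2 * (a - c)\<^sup>2 + 2 * (b - d)\<^sup>2" for a b c d :: real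
        using sum_squares_bound[of "a - c" "b - d"] by (simp add: power2_eq_square algebra_simps)
      then show "(f i x + g i x - (F x + G x))\<^sup>2 \<le> 2 * (f i x - F x)\<^sup>2 + 2 * (g i x - G x)\<^sup>2" for x .
    qed (use sq in auto)
    then show ?thesis using sq by simp
  qed
  then have "((\<lambda>i. LINT x|torus. (f i x + g i x - (F x + G x))\<^sup>2) \<longlongrightarrow> 0) flt"
    by (intro Lim_null_comparison[OF _ lim] always_eventually allI)
  then show ?thesis using L2 by (auto simp: L2_tendsto_def intro: L2_add)
qed

lemma L2_tendsto_sum:
  assumes "\<And>j. j \<in> J \<Longrightarrow> L2_tendsto (f j) (F j) flt"
  shows "L2_tendsto (\<lambda>i x. \<Sum>j\<in>J. f j i x) (\<lambda>x. \<Sum>j\<in>J. F j x) flt"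
  using assms
  by (induction J rule: infinite_finite_induct) (auto intro: L2_tendsto_const L2_const L2_tendsto_add)

text \<open>The uniform bound makes this mode of convergence stable under products, so that
  truncated cubic integrands converge together with their integrals.\<close>

definition bounded_L2_tendsto :: "('i \<Rightarrow> real ^ 3 \<Rightarrow> real) \<Rightarrow> (real ^ 3 \<Rightarrow> real) \<Rightarrow> 'i filter \<Rightarrow> bool" where
  "bounded_L2_tendsto f F flt \<longleftrightarrow> L2_tendsto f F flt \<and> (\<exists>C. \<forall>i x. \<bar>f i x\<bar> \<le> C)"

lemma bounded_L2_tendsto_mult:
  assumes f: "bounded_L2_tendsto f F flt" and g: "bounded_L2_tendsto g G flt" and flt: "flt \<noteq> bot"
  shows "bounded_L2_tendsto (\<lambda>i x. f i x * g i x) (\<lambda>x. F x * G x) flt"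
proof -
  obtain C D where C: "\<And>i x. \<bar>f i x\<bar> \<le> C" and D: "\<And>i x. \<bar>g i x\<bar> \<le> D"
    using f g by (auto simp: bounded_L2_tendsto_def)
  have lims: "L2_tendsto f F flt" "L2_tendsto g G flt"
    using f g by (auto simp: bounded_L2_tendsto_def)
  then have L2: "f i \<in> L2" "g i \<in> L2" "F \<in> L2" "G \<in> L2" for i
    by (auto simp: L2_tendsto_def)
  have FC: "AE x in torus. \<bar>F x\<bar> \<le> C" and GD: "AE x in torus. \<bar>G x\<bar> \<le> D"
    using lims flt C D by (auto intro: L2_tendsto_AE_bounded)
  have nn: "0 \<le> C" "0 \<le> D" using C[of undefined 0] D[of undefined 0] by auto
  have L2p: "(\<lambda>x. f i x * g i x) \<in> L2" "(\<lambda>x. F x * G x) \<in> L2" for i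
    using L2_mult_bounded[OF L2(1,2) AE_I2[OF D]] L2_mult_bounded[OF L2(3,4) GD] by auto
  have "((\<lambda>i. 2 * D\<^sup>2 * (LINT x|torus. (f i x - F x)\<^sup>2) + 2 * C\<^sup>2 * (LINT x|torus. (g i x - G x)\<^sup>2))
      \<longlongrightarrow> 2 * D\<^sup>2 * 0 + 2 * C\<^sup>2 * 0) flt"
    using lims unfolding L2_tendsto_def by (intro tendsto_intros) auto
  then have lim: "((\<lambda>i. 2 * D\<^sup>2 * (LINT x|torus. (f i x - F x)\<^sup>2) + 2 * C\<^sup>2 * (LINT x|torus. (g i x - G x)\<^sup>2))
      \<longlongrightarrow> 0) flt"
    by simp
  have "norm (LINT x|torus. (f i x * g i x - F x * G x)\<^sup>2)
     \<le> 2 * D\<^sup>2 * (LINT x|torus. (f i x - F x)\<^sup>2) + 2 * C\<^sup>2 * (LINT x|torus. (g i x - G x)\<^sup>2)" for i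
  proof -
    have sq: "integrable torus (\<lambda>x. (f i x - F x)\<^sup>2)" "integrable torus (\<lambda>x. (g i x - G x)\<^sup>2)"
      using L2 by (auto intro!: L2_integrable_square L2_diff)
    have "(LINT x|torus. (f i x * g i x - F x * G x)\<^sup>2)
      \<le> (LINT x|torus. 2 * D\<^sup>2 * (f i x - F x)\<^sup>2 + 2 * C\<^sup>2 * (g i x - G x)\<^sup>2)"
    proof (rule integral_mono_AE)
      show "integrable torus (\<lambda>x. (f i x * g i x - F x * G x)\<^sup>2)"
        using L2p by (intro L2_integrable_square L2_diff)
      show "AE x in torus. (f i x * g i x - F x * G x)\<^sup>2
          \<le> 2 * D\<^sup>2 * (f i x - F x)\<^sup>2 + 2 * C\<^sup>2 * (g i x - G x)\<^sup>2"
        using FC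
      proof eventually_elim
        case (elim x)
        \<comment> \<open>The telescoping f g - F G = g (f - F) + F (g - G); the first summand uses
          the bound on the approximants, the second the bound inherited by the limit.\<close>
        define a b where "a = g i x * (f i x - F x)" and "b = F x * (g i x - G x)"
        have ab: "f i x * g i x - F x * G x = a + b" by (simp add: a_def b_def algebra_simps)
        have "(a + b)\<^sup>2 \<le> 2 * a\<^sup>2 + 2 * b\<^sup>2"
          using sum_squares_bound[of a b] by (simp add: power2_eq_square algebra_simps)
        moreover have "a\<^sup>2 \<le> D\<^sup>2 * (f i x - F x)\<^sup>2"
          unfolding a_def power_mult_distrib
          using D[of i x] nn by (intro mult_right_mono) (auto simp: power2_le_iff_abs_le)
        moreover have "b\<^sup>2 \<le> C\<^sup>2 * (g i x - G x)\<^sup>2"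
          unfolding b_def power_mult_distrib
          using elim nn by (intro mult_right_mono) (auto simp: power2_le_iff_abs_le)
        ultimately show ?case unfolding ab by linarith
      qed
    qed (use sq in auto)
    then show ?thesis using sq by simp
  qed
  then have "((\<lambda>i. LINT x|torus. (f i x * g i x - F x * G x)\<^sup>2) \<longlongrightarrow> 0) flt"
    by (intro Lim_null_comparison[OF _ lim] always_eventually allI)
  moreover have "\<bar>f i x * g i x\<bar> \<le> C * D" for i x
    unfolding abs_mult using C D nn by (intro mult_mono) auto
  ultimately show ?thesis
    using L2p by (auto simp: bounded_L2_tendsto_def L2_tendsto_def)
qed

lemma bounded_L2_tendsto_sum:
  assumes "\<And>j. j \<in> J \<Longrightarrow> bounded_L2_tendsto (f j) (F j) flt"
  shows "bounded_L2_tendsto (\<lambda>i x. \<Sum>j\<in>J. f j i x) (\<lambda>x. \<Sum>j\<in>J. F j x) flt"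
proof -
  obtain C where C: "\<And>j i x. j \<in> J \<Longrightarrow> \<bar>f j i x\<bar> \<le> C j"
    using assms unfolding bounded_L2_tendsto_def by metis
  have "\<bar>\<Sum>j\<in>J. f j i x\<bar> \<le> (\<Sum>j\<in>J. C j)" for i x
    by (rule order_trans[OF sum_abs sum_mono]) (rule C)
  moreover have "L2_tendsto (\<lambda>i x. \<Sum>j\<in>J. f j i x) (\<lambda>x. \<Sum>j\<in>J. F j x) flt"
    using assms by (intro L2_tendsto_sum) (simp add: bounded_L2_tendsto_def)
  ultimately show ?thesis unfolding bounded_L2_tendsto_def by blast
qed

text \<open>The absolute sum of the coefficients bounds all truncations at once, whatever the index
  set.\<close>

lemma trig_bounded_tendsto:
  assumes f: "f \<in> L2" and c: "\<And>k. sfourier f k = c k" and sum: "(\<lambda>k. cmod (c k)) summable_on UNIV"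
  shows "bounded_L2_tendsto (trig c) f (finite_subsets_at_top UNIV)"
proof -
  have "\<bar>trig c A x\<bar> \<le> infsum (\<lambda>k. cmod (c k)) UNIV" for A x
  proof (cases "finite A")
    case True
    then show ?thesis
      using abs_trig_le[OF True, of c x] finite_sum_le_infsum[OF sum True] by simp
  next
    case False
    then have "trig c A x = 0" by (simp add: trig_def)
    then show ?thesis by (simp add: infsum_nonneg)
  qed
  with trig_tendsto[OF f c] show ?thesis unfolding bounded_L2_tendsto_def by blast
qed

lemma bounded_L2_tendsto_AE_bounded:
  assumes "bounded_L2_tendsto f F flt" "flt \<noteq> bot"
  obtains C where "AE x in torus. \<bar>F x\<bar> \<le> C"
  using assms L2_tendsto_AE_bounded unfolding bounded_L2_tendsto_def by metis

section \<open>Integration by parts for smooth fields\<close>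

text \<open>Below \<open>DV j i\<close> stands for \<open>\<partial>\<^sub>j V\<^sub>i\<close> and \<open>DDV l j i\<close> for \<open>\<partial>\<^sub>l \<partial>\<^sub>j V\<^sub>i\<close>.\<close>

locale smooth_div_free =
  fixes V :: "3 \<Rightarrow> real ^ 3 \<Rightarrow> real" and DV :: "3 \<Rightarrow> 3 \<Rightarrow> real ^ 3 \<Rightarrow> real"
    and DDV :: "3 \<Rightarrow> 3 \<Rightarrow> 3 \<Rightarrow> real ^ 3 \<Rightarrow> real"
  assumes cont: "continuous_on UNIV (V i)" "continuous_on UNIV (DV j i)" "continuous_on UNIV (DDV l j i)"
    and per: "periodic (V i)" "periodic (DV j i)"
    and DV: "((\<lambda>s. V i (x + s *\<^sub>R axis j 1)) has_real_derivative DV j i x) (at 0)"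
    and DDV: "((\<lambda>s. DV j i (x + s *\<^sub>R axis l 1)) has_real_derivative DDV l j i x) (at 0)"
    and sym: "DDV l j i = DDV j l i"
    and div: "(\<Sum>i\<in>UNIV. DV i i x) = 0" and ddiv: "(\<Sum>i\<in>UNIV. DDV l i i x) = 0"
begin

lemma integrable_continuous:
  fixes f :: "real ^ 3 \<Rightarrow> real"
  assumes "continuous_on UNIV f"
  shows "integrable torus f"
proof (subst integrable_restrict_space)
  show "integrable lborel (\<lambda>x. indicator (cbox 0 1) x *\<^sub>R f x)"
    using assms by (intro borel_integrable_compact) (auto intro: continuous_on_subset)
qed simp

text \<open>One derivative of the Laplacian is moved onto the advection term. If it hits
  \<open>V j\<close> it gives the right-hand side; if it hits \<open>DV j i\<close> it gives V
  \<cdot> \<nabla> of half the squared gradient, a divergence because V is divergence free.\<close>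

lemma integral_adv_laplacian:
  "(LINT x|torus. (\<Sum>i\<in>UNIV. (\<Sum>j\<in>UNIV. V j x * DV j i x) * (- (\<Sum>l\<in>UNIV. DDV l l i x))))
   = (LINT x|torus. (\<Sum>i\<in>UNIV. \<Sum>j\<in>UNIV. \<Sum>l\<in>UNIV. DV l j x * DV j i x * DV l i x))"
proof -
  \<comment> \<open>The l-th derivative of the sum of \<open>V j * DV j i * DV l i\<close>.\<close>
  define G where "G l x = (\<Sum>i\<in>UNIV. \<Sum>j\<in>UNIV. DDV l l i x * (V j x * DV j i x)
      + (DV l j x * DV j i x + DDV l j i x * V j x) * DV l i x)" for l x
  \<comment> \<open>The j-th derivative of \<open>V j\<close> times half the squared gradient;
    summed over j, its first part vanishes with the divergence.\<close>
  define H where "H j x = DV j j x * (\<Sum>i\<in>UNIV. \<Sum>l\<in>UNIV. (DV l i x)\<^sup>2) / 2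
      + V j x * (\<Sum>i\<in>UNIV. \<Sum>l\<in>UNIV. DV l i x * DDV j l i x)" for j x
  have G: "(LINT x|torus. G l x) = 0" for l
  proof (rule torus_integral_deriv[where F = "\<lambda>x. \<Sum>i\<in>UNIV. \<Sum>j\<in>UNIV. V j x * DV j i x * DV l i x" and j = l])
    show "((\<lambda>s. \<Sum>i\<in>UNIV. \<Sum>j\<in>UNIV. V j (x + s *\<^sub>R axis l 1) * DV j i (x + s *\<^sub>R axis l 1) * DV l i (x + s *\<^sub>R axis l 1))
       has_real_derivative G l x) (at 0)" for x
      unfolding G_def by (auto intro!: DERIV_sum derivative_eq_intros DV DDV simp: algebra_simps)
  qed (use per in \<open>auto intro!: continuous_intros cont simp: G_def periodic_def\<close>)
  have H: "(LINT x|torus. H j x) = 0" for j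
  proof (rule torus_integral_deriv[where F = "\<lambda>x. V j x * (\<Sum>i\<in>UNIV. \<Sum>l\<in>UNIV. (DV l i x)\<^sup>2) / 2" and j = j])
    show "((\<lambda>s. V j (x + s *\<^sub>R axis j 1) * (\<Sum>i\<in>UNIV. \<Sum>l\<in>UNIV. (DV l i (x + s *\<^sub>R axis j 1))\<^sup>2) / 2)
       has_real_derivative H j x) (at 0)" for x
      unfolding H_def
      by (auto intro!: DERIV_sum derivative_eq_intros DV DDV simp: algebra_simps sum_distrib_left sum.distrib sum_divide_distrib add_divide_distrib)
  qed (use per in \<open>auto intro!: continuous_intros cont simp: H_def periodic_def\<close>)
  have int: "integrable torus (G l)" "integrable torus (H l)" for l
    unfolding G_def H_def by (auto intro!: integrable_continuous continuous_intros cont)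
  have "(\<Sum>i\<in>UNIV. (\<Sum>j\<in>UNIV. V j x * DV j i x) * (- (\<Sum>l\<in>UNIV. DDV l l i x)))
     = (\<Sum>i\<in>UNIV. \<Sum>j\<in>UNIV. \<Sum>l\<in>UNIV. DV l j x * DV j i x * DV l i x)
       - (\<Sum>l\<in>UNIV. G l x) + (\<Sum>j\<in>UNIV. H j x)" for x
  proof -
    have H_sum: "(\<Sum>j\<in>UNIV. H j x) = (\<Sum>j\<in>UNIV. V j x * (\<Sum>i\<in>UNIV. \<Sum>l\<in>UNIV. DV l i x * DDV l j i x))"
      unfolding H_def sum.distrib sum_divide_distrib[symmetric] sum_distrib_right[symmetric] div
      by (simp add: sym)
    show ?thesis unfolding H_sum G_def by (simp add: sum_3 algebra_simps)
  qed
  then have "(LINT x|torus. (\<Sum>i\<in>UNIV. (\<Sum>j\<in>UNIV. V j x * DV j i x) * (- (\<Sum>l\<in>UNIV. DDV l l i x))))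
    = (LINT x|torus. (\<Sum>i\<in>UNIV. \<Sum>j\<in>UNIV. \<Sum>l\<in>UNIV. DV l j x * DV j i x * DV l i x)
       - (\<Sum>l\<in>UNIV. G l x) + (\<Sum>j\<in>UNIV. H j x))" by simp
  also have "\<dots> = (LINT x|torus. (\<Sum>i\<in>UNIV. \<Sum>j\<in>UNIV. \<Sum>l\<in>UNIV. DV l j x * DV j i x * DV l i x))
       - (\<Sum>l\<in>UNIV. LINT x|torus. G l x) + (\<Sum>j\<in>UNIV. LINT x|torus. H j x)"
  proof -
    have "integrable torus (\<lambda>x. \<Sum>i\<in>UNIV. \<Sum>j\<in>UNIV. \<Sum>l\<in>UNIV. DV l j x * DV j i x * DV l i x)"
      by (auto intro!: integrable_continuous continuous_intros cont)
    then show ?thesis using int by simp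
  qed
  finally show ?thesis by (simp add: G H)
qed

text \<open>For divergence-free V, tr(A^3) is itself a divergence. In the j-th derivative of
  \<open>V i * DV k j * DV i k\<close>, summed over all indices, one term is tr(A^3), one contains a
  derivative of div V and vanishes, and one is V \<cdot> \<nabla> of tr(A^2) / 2, which is the
  divergence collected in \<open>H\<close> below.\<close>

lemma integral_trace_cube:
  "(LINT x|torus. (\<Sum>i\<in>UNIV. \<Sum>j\<in>UNIV. \<Sum>k\<in>UNIV. DV j i x * DV k j x * DV i k x)) = 0"
proof -
  define G where "G j x = (\<Sum>i\<in>UNIV. \<Sum>k\<in>UNIV. DDV j i k x * (V i x * DV k j x)
      + (DV j i x * DV k j x + DDV j k j x * V i x) * DV i k x)" for j x
  define H where "H i x = DV i i x * (\<Sum>j\<in>UNIV. \<Sum>k\<in>UNIV. DV k j x * DV j k x) / 2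
      + V i x * (\<Sum>j\<in>UNIV. \<Sum>k\<in>UNIV. DDV i k j x * DV j k x + DDV i j k x * DV k j x) / 2" for i x
  have G: "(LINT x|torus. G j x) = 0" for j
  proof (rule torus_integral_deriv[where F = "\<lambda>x. \<Sum>i\<in>UNIV. \<Sum>k\<in>UNIV. V i x * DV k j x * DV i k x" and j = j])
    show "((\<lambda>s. \<Sum>i\<in>UNIV. \<Sum>k\<in>UNIV. V i (x + s *\<^sub>R axis j 1) * DV k j (x + s *\<^sub>R axis j 1) * DV i k (x + s *\<^sub>R axis j 1))
       has_real_derivative G j x) (at 0)" for x
      unfolding G_def by (auto intro!: DERIV_sum derivative_eq_intros DV DDV simp: algebra_simps)
  qed (use per in \<open>auto intro!: continuous_intros cont simp: G_def periodic_def\<close>)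
  have H: "(LINT x|torus. H i x) = 0" for i
  proof (rule torus_integral_deriv[where F = "\<lambda>x. V i x * (\<Sum>j\<in>UNIV. \<Sum>k\<in>UNIV. DV k j x * DV j k x) / 2" and j = i])
    show "((\<lambda>s. V i (x + s *\<^sub>R axis i 1) * (\<Sum>j\<in>UNIV. \<Sum>k\<in>UNIV. DV k j (x + s *\<^sub>R axis i 1) * DV j k (x + s *\<^sub>R axis i 1)) / 2)
       has_real_derivative H i x) (at 0)" for x
      unfolding H_def
      by (auto intro!: DERIV_sum derivative_eq_intros DV DDV simp: algebra_simps sum_distrib_left sum.distrib sum_divide_distrib add_divide_distrib)
  qed (use per in \<open>auto intro!: continuous_intros cont simp: H_def periodic_def\<close>)
  have int: "integrable torus (G j)" "integrable torus (H j)" for j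
    unfolding G_def H_def by (auto intro!: integrable_continuous continuous_intros cont)
  have "(\<Sum>i\<in>UNIV. \<Sum>j\<in>UNIV. \<Sum>k\<in>UNIV. DV j i x * DV k j x * DV i k x)
     = (\<Sum>j\<in>UNIV. G j x) - (\<Sum>i\<in>UNIV. H i x)" for x
  proof -
    have H_sum: "(\<Sum>i\<in>UNIV. H i x)
      = (\<Sum>i\<in>UNIV. V i x * (\<Sum>j\<in>UNIV. \<Sum>k\<in>UNIV. DDV i k j x * DV j k x + DDV i j k x * DV k j x) / 2)"
      unfolding H_def sum.distrib sum_divide_distrib[symmetric] sum_distrib_right[symmetric] div by simp
    have "(\<Sum>j\<in>UNIV. G j x) = (\<Sum>j\<in>UNIV. \<Sum>i\<in>UNIV. \<Sum>k\<in>UNIV. DDV j i k x * (V i x * DV k j x)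
         + DV j i x * DV k j x * DV i k x)
       + (\<Sum>j\<in>UNIV. \<Sum>i\<in>UNIV. \<Sum>k\<in>UNIV. DDV j k j x * V i x * DV i k x)"
      unfolding G_def by (simp add: sum.distrib algebra_simps)
    also have "(\<Sum>j\<in>UNIV. \<Sum>i\<in>UNIV. \<Sum>k\<in>UNIV. DDV j k j x * V i x * DV i k x)
       = (\<Sum>i\<in>UNIV. \<Sum>k\<in>UNIV. (\<Sum>j\<in>UNIV. DDV j k j x) * (V i x * DV i k x))"
      by (simp add: sum_3 algebra_simps)
    also have "\<dots> = 0" by (simp add: sym[of _ _ _, symmetric] ddiv sym)
    finally have G_sum: "(\<Sum>j\<in>UNIV. G j x) = (\<Sum>j\<in>UNIV. \<Sum>i\<in>UNIV. \<Sum>k\<in>UNIV. DDV j i k x * (V i x * DV k j x)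
         + DV j i x * DV k j x * DV i k x)" by simp
    show ?thesis unfolding H_sum G_sum by (simp add: sum_3 field_simps sym[of 2 1] sym[of 3 1] sym[of 3 2])
  qed
  then have "(LINT x|torus. (\<Sum>i\<in>UNIV. \<Sum>j\<in>UNIV. \<Sum>k\<in>UNIV. DV j i x * DV k j x * DV i k x))
    = (LINT x|torus. (\<Sum>j\<in>UNIV. G j x) - (\<Sum>i\<in>UNIV. H i x))" by simp
  also have "\<dots> = 0" using int by (simp add: G H)
  finally show ?thesis .
qed

end

section \<open>Pointwise matrix identities and the middle eigenvalue\<close>

lemma strain_eq: "strain u x $ i $ j = (grad u x $ i $ j + grad u x $ j $ i) / 2"
  by (simp add: strain_def transpose_def)

lemma strain_sym: "strain u x $ i $ j = strain u x $ j $ i"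
  by (simp add: strain_eq)

lemma vorticity_eq:
  "vorticity u x $ 1 = grad u x $ 3 $ 2 - grad u x $ 2 $ 3"
  "vorticity u x $ 2 = grad u x $ 1 $ 3 - grad u x $ 3 $ 1"
  "vorticity u x $ 3 = grad u x $ 2 $ 1 - grad u x $ 1 $ 2"
  by (simp_all add: vorticity_def grad_def)

lemma norm_matrix: "(norm (A :: real ^ 3 ^ 3))\<^sup>2 = (\<Sum>i\<in>UNIV. \<Sum>j\<in>UNIV. (A $ i $ j)\<^sup>2)"
  unfolding power2_norm_eq_inner inner_vec_def by (simp add: power2_eq_square)

lemma norm_vector: "(norm (a :: real ^ 3))\<^sup>2 = (\<Sum>i\<in>UNIV. (a $ i)\<^sup>2)"
  unfolding power2_norm_eq_inner inner_vec_def by (simp add: power2_eq_square)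

text \<open>The double sum is tr(A^2) for the gradient matrix A. Here and for the vorticity it is
  the only difference from a multiple of the squared gradient, and its integral is shown to vanish
  in \<open>integral_trace_square\<close>.\<close>

lemma norm_strain:
  "(norm (strain u x))\<^sup>2 = (norm (grad u x))\<^sup>2 / 2
     + (\<Sum>i\<in>UNIV. \<Sum>j\<in>UNIV. grad u x $ i $ j * grad u x $ j $ i) / 2"
  unfolding norm_matrix strain_eq by (simp add: sum_3 power2_eq_square field_simps)

lemma norm_vorticity:
  "(norm (vorticity u x))\<^sup>2 = (norm (grad u x))\<^sup>2
     - (\<Sum>i\<in>UNIV. \<Sum>j\<in>UNIV. grad u x $ i $ j * grad u x $ j $ i)"
  unfolding norm_matrix norm_vector by (simp add: sum_3 vorticity_eq power2_eq_square algebra_simps)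

text \<open>Write A = S + W with W antisymmetric. Then tr(A^3) - tr(A A A^T) = 4 tr(S W^2), and 4
  W^2 is \<omega>\<otimes>\<omega> minus |\<omega>|^2 times the identity, whose product with S has
  trace 0. The proof eliminates one diagonal entry and checks a polynomial identity.\<close>

lemma strain_vorticity:
  assumes "(\<Sum>i\<in>UNIV. grad u x $ i $ i) = 0"
  shows "strain u x \<bullet> outer (vorticity u x) (vorticity u x)
     = (\<Sum>i\<in>UNIV. \<Sum>j\<in>UNIV. \<Sum>k\<in>UNIV. grad u x $ i $ j * grad u x $ j $ k * grad u x $ k $ i)
       - (\<Sum>i\<in>UNIV. \<Sum>j\<in>UNIV. \<Sum>l\<in>UNIV. grad u x $ j $ l * grad u x $ i $ j * grad u x $ i $ l)"
proof -
  define g where "g i j = grad u x $ i $ j" for i j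
  have g33: "g 3 3 = - g 1 1 - g 2 2" using assms by (simp add: g_def sum_3)
  show ?thesis
    unfolding inner_vec_def outer_def
    by (simp add: sum_3 vorticity_eq strain_eq g33 flip: g_def) (simp add: field_simps)
qed

text \<open>For a trace-free symmetric S, tr(S^3) = 3 det S. In tr(A A A^T) + tr(A^3) / 3 the
  contributions of the antisymmetric part cancel and 4/3 tr(S^3) is left.\<close>

lemma det_strain:
  assumes "(\<Sum>i\<in>UNIV. grad u x $ i $ i) = 0"
  shows "4 * det (strain u x)
     = (\<Sum>i\<in>UNIV. \<Sum>j\<in>UNIV. \<Sum>l\<in>UNIV. grad u x $ j $ l * grad u x $ i $ j * grad u x $ i $ l)
       + (\<Sum>i\<in>UNIV. \<Sum>j\<in>UNIV. \<Sum>k\<in>UNIV. grad u x $ i $ j * grad u x $ j $ k * grad u x $ k $ i) / 3"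
proof -
  define g where "g i j = grad u x $ i $ j" for i j
  have g33: "g 3 3 = - g 1 1 - g 2 2" using assms by (simp add: g_def sum_3)
  show ?thesis
    unfolding det_3
    by (simp add: sum_3 strain_eq g33 flip: g_def) (simp add: field_simps)
qed

section \<open>Eigenvalues of symmetric 3 by 3 matrices\<close>

lemma degenerate_quadratic_form_nonneg:
  fixes d e f X Y :: real
  assumes "0 \<le> X" "0 \<le> Y" "X * Y = d\<^sup>2"
  shows "0 \<le> e\<^sup>2 * Y + 2 * d * e * f + f\<^sup>2 * X"
proof -
  have "\<bar>2 * d * e * f\<bar> \<le> e\<^sup>2 * Y + f\<^sup>2 * X"
  proof (rule power2_le_imp_le)
    \<comment> \<open>The form has zero discriminant, so up to sign it is the square of e sqrt Y
      \<plusminus> f sqrt X; comparing squares avoids the roots and the sign of d.\<close>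
    have "(e\<^sup>2 * Y + f\<^sup>2 * X)\<^sup>2 - \<bar>2 * d * e * f\<bar>\<^sup>2 = (e\<^sup>2 * Y - f\<^sup>2 * X)\<^sup>2"
      unfolding power2_abs power_mult_distrib assms(3)[symmetric]
      by (simp add: power2_eq_square algebra_simps)
    then show "\<bar>2 * d * e * f\<bar>\<^sup>2 \<le> (e\<^sup>2 * Y + f\<^sup>2 * X)\<^sup>2"
      by (metis diff_ge_0_iff_ge zero_le_power2)
  qed (use assms in simp)
  then show ?thesis by linarith
qed

definition char_roots :: "real ^ 3 ^ 3 \<Rightarrow> real \<Rightarrow> real \<Rightarrow> real \<Rightarrow> bool" where
  "char_roots A a b c \<longleftrightarrow> a \<le> b \<and> b \<le> c \<and> (\<forall>z. det (mat z - A) = (z - a) * (z - b) * (z - c))"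

lemma sort3: "\<exists>a b c :: real. a \<le> b \<and> b \<le> c \<and> (\<forall>z. (z - r) * (z - s) * (z - t) = (z - a) * (z - b) * (z - c))"
proof -
  consider "r \<le> s" "s \<le> t" | "r \<le> t" "t \<le> s" | "s \<le> r" "r \<le> t" | "s \<le> t" "t \<le> r" | "t \<le> r" "r \<le> s" | "t \<le> s" "s \<le> r"
    by linarith
  then show ?thesis
  proof cases
    case 1 then show ?thesis by (intro exI[of _ r] exI[of _ s] exI[of _ t]) (simp add: algebra_simps)
  next
    case 2 then show ?thesis by (intro exI[of _ r] exI[of _ t] exI[of _ s]) (simp add: algebra_simps)
  next
    case 3 then show ?thesis by (intro exI[of _ s] exI[of _ r] exI[of _ t]) (simp add: algebra_simps)
  next
    case 4 then show ?thesis by (intro exI[of _ s] exI[of _ t] exI[of _ r]) (simp add: algebra_simps)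
  next
    case 5 then show ?thesis by (intro exI[of _ t] exI[of _ r] exI[of _ s]) (simp add: algebra_simps)
  next
    case 6 then show ?thesis by (intro exI[of _ t] exI[of _ s] exI[of _ r]) (simp add: algebra_simps)
  qed
qed

text \<open>The characteristic polynomial changes sign between the eigenvalues of the leading 2 by 2
  block; the quotient by the linear factor of a root found there has nonnegative discriminant.\<close>

lemma char_roots_exist:
  fixes A :: "real ^ 3 ^ 3"
  assumes sym: "\<And>i j. A $ i $ j = A $ j $ i"
  obtains a b c where "char_roots A a b c"
proof -
  define \<alpha> \<beta> \<gamma> d e f where "\<alpha> = A $ 1 $ 1" "\<beta> = A $ 2 $ 2" "\<gamma> = A $ 3 $ 3" "d = A $ 1 $ 2" "e = A $ 1 $ 3" "f = A $ 2 $ 3"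
  note defs = this
  \<comment> \<open>The characteristic determinant expanded along the third row and column: the
    characteristic polynomial of the leading block times z - \<gamma>, minus the border
    terms.\<close>
  define p where "p z = (z - \<gamma>) * ((z - \<alpha>) * (z - \<beta>) - d\<^sup>2)
    - (e\<^sup>2 * (z - \<beta>) + 2 * d * e * f + f\<^sup>2 * (z - \<alpha>))" for z
  have det: "det (mat z - A) = p z" for z
    unfolding det_3 p_def defs using sym[of 2 1] sym[of 3 1] sym[of 3 2]
    by (simp add: mat_def algebra_simps power2_eq_square)
  \<comment> \<open>The eigenvalues of the leading block are m - w and m + w. There the first
    summand of p vanishes, and the border terms form the degenerate quadratic form treated
    above.\<close>
  define w where "w = sqrt (((\<alpha> - \<beta>) / 2)\<^sup>2 + d\<^sup>2)"
  have w: "0 \<le> w" "w\<^sup>2 = ((\<alpha> - \<beta>) / 2)\<^sup>2 + d\<^sup>2" by (simp_all add: w_def)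
  have "\<bar>(\<alpha> - \<beta>) / 2\<bar> \<le> w"
  proof (rule power2_le_imp_le)
    show "\<bar>(\<alpha> - \<beta>) / 2\<bar>\<^sup>2 \<le> w\<^sup>2" unfolding w(2) power2_abs by simp
  qed (rule w(1))
  then have wab: "(\<alpha> - \<beta>) / 2 \<le> w" "(\<beta> - \<alpha>) / 2 \<le> w"
    unfolding abs_le_iff by (simp_all add: field_simps)
  define m where "m = (\<alpha> + \<beta>) / 2"
  have w': "w * w = ((\<alpha> - \<beta>) / 2)\<^sup>2 + d\<^sup>2" using w(2) by (simp add: power2_eq_square)
  have prod: "(m + w - \<alpha>) * (m + w - \<beta>) = d\<^sup>2" "(m - w - \<alpha>) * (m - w - \<beta>) = d\<^sup>2"
    using w' by (simp_all add: m_def power2_eq_square field_simps)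
  have p2: "p (m + w) \<le> 0"
  proof -
    have "0 \<le> e\<^sup>2 * (m + w - \<beta>) + 2 * d * e * f + f\<^sup>2 * (m + w - \<alpha>)"
      using wab prod(1) by (intro degenerate_quadratic_form_nonneg) (auto simp: m_def field_simps)
    then show ?thesis by (simp add: p_def prod)
  qed
  have p1: "0 \<le> p (m - w)"
  proof -
    have "0 \<le> e\<^sup>2 * (\<beta> - (m - w)) + 2 * (- d) * e * f + f\<^sup>2 * (\<alpha> - (m - w))"
      using wab prod(2) by (intro degenerate_quadratic_form_nonneg) (auto simp: m_def field_simps)
    then show ?thesis unfolding p_def prod by (simp add: algebra_simps)
  qed
  have "continuous_on {m - w..m + w} p"
    unfolding p_def by (intro continuous_intros)
  then obtain r where r: "m - w \<le> r" "r \<le> m + w" "p r = 0"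
    using IVT2'[of p "m + w" 0 "m - w"] p1 p2 w(1) by auto
  define s where "s = r - (\<alpha> + \<beta> + \<gamma>)"
  define t where "t = \<alpha> * \<beta> + \<alpha> * \<gamma> + \<beta> * \<gamma> - d\<^sup>2 - e\<^sup>2 - f\<^sup>2 + r * s"
  have fact: "p z = (z - r) * (z\<^sup>2 + s * z + t)" for z
  proof -
    have "p z = p z - p r" using r by simp
    also have "\<dots> = (z - r) * (z\<^sup>2 + s * z + t)"
      unfolding p_def s_def t_def by (simp add: power2_eq_square algebra_simps)
    finally show ?thesis .
  qed
  \<comment> \<open>Otherwise the quadratic factor is positive and p has the sign of z - r. The
    signs of p at m - w and m + w then force w = 0 and r = m, so the block is r times the identity
    and the quadratic factor at r equals -(e^2 + f^2), which is not positive.\<close>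
  have "0 \<le> s\<^sup>2 - 4 * t"
  proof (rule ccontr)
    assume neg: "\<not> 0 \<le> s\<^sup>2 - 4 * t"
    have pos: "0 < z\<^sup>2 + s * z + t" for z
    proof -
      have eq: "z\<^sup>2 + s * z + t = (z + s / 2)\<^sup>2 - (s\<^sup>2 - 4 * t) / 4"
        by (simp add: power2_eq_square field_simps)
      have "0 < K - D / 4" if "0 \<le> K" "D < 0" for K D :: real using that by simp
      from this[OF zero_le_power2] neg show ?thesis unfolding eq not_le .
    qed
    have "r \<le> m - w" using p1 pos[of "m - w"] unfolding fact by (simp add: zero_le_mult_iff)
    moreover have "m + w \<le> r" using p2 pos[of "m + w"] unfolding fact by (simp add: mult_le_0_iff)
    ultimately have "w = 0" "r = m" using w(1) by auto
    then have "((\<alpha> - \<beta>) / 2)\<^sup>2 + d\<^sup>2 = 0" using w(2) by simp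
    then have "\<alpha> = \<beta>" "d = 0" by (simp_all add: sum_power2_eq_zero_iff)
    with \<open>r = m\<close> have "\<alpha> = r" "\<beta> = r" by (simp_all add: m_def)
    then have "r\<^sup>2 + s * r + t = - e\<^sup>2 - f\<^sup>2"
      unfolding s_def t_def using \<open>d = 0\<close> by (simp add: power2_eq_square algebra_simps)
    moreover have "0 \<le> e\<^sup>2" "0 \<le> f\<^sup>2" by simp_all
    ultimately show False using pos[of r] by linarith
  qed
  then have v: "(sqrt (s\<^sup>2 - 4 * t))\<^sup>2 = s\<^sup>2 - 4 * t" by simp
  define v where "v = sqrt (s\<^sup>2 - 4 * t)"
  have "z\<^sup>2 + s * z + t = (z - (- s - v) / 2) * (z - (- s + v) / 2)" for z
  proof -
    have "v * v = s * s - 4 * t" using v by (simp add: v_def power2_eq_square)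
    then show ?thesis by (simp add: power2_eq_square field_simps)
  qed
  then have "det (mat z - A) = (z - r) * (z - (- s - v) / 2) * (z - (- s + v) / 2)" for z
    unfolding det fact by simp
  then show ?thesis
    using sort3[of r "(- s - v) / 2" "(- s + v) / 2"] that unfolding char_roots_def by metis
qed

lemma char_roots_coeffs:
  assumes sym: "\<And>i j. A $ i $ j = A $ j $ i" and r: "char_roots A a b c"
  shows "a + b + c = A $ 1 $ 1 + A $ 2 $ 2 + A $ 3 $ 3"
    and "a * b + b * c + a * c = A $ 1 $ 1 * A $ 2 $ 2 + A $ 1 $ 1 * A $ 3 $ 3 + A $ 2 $ 2 * A $ 3 $ 3
       - (A $ 1 $ 2)\<^sup>2 - (A $ 1 $ 3)\<^sup>2 - (A $ 2 $ 3)\<^sup>2"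
    and "a * b * c = det A"
    and "a\<^sup>2 + b\<^sup>2 + c\<^sup>2 = (norm A)\<^sup>2"
proof -
  have "det (mat z - A) = (z - a) * (z - b) * (z - c)" for z
    using r by (simp add: char_roots_def)
  \<comment> \<open>Three values determine the three free coefficients of a monic cubic.\<close>
  from this[of 0] this[of 1] this[of "-1"]
  have d: "a * b * c = det A"
    and p: "a + b + c = A $ 1 $ 1 + A $ 2 $ 2 + A $ 3 $ 3"
    and q: "a * b + b * c + a * c = A $ 1 $ 1 * A $ 2 $ 2 + A $ 1 $ 1 * A $ 3 $ 3 + A $ 2 $ 2 * A $ 3 $ 3
       - (A $ 1 $ 2)\<^sup>2 - (A $ 1 $ 3)\<^sup>2 - (A $ 2 $ 3)\<^sup>2"
    unfolding det_3 mat_def using sym[of 2 1] sym[of 3 1] sym[of 3 2]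
    by (simp_all add: algebra_simps power2_eq_square)
  show "a + b + c = A $ 1 $ 1 + A $ 2 $ 2 + A $ 3 $ 3"
    and "a * b + b * c + a * c = A $ 1 $ 1 * A $ 2 $ 2 + A $ 1 $ 1 * A $ 3 $ 3 + A $ 2 $ 2 * A $ 3 $ 3
       - (A $ 1 $ 2)\<^sup>2 - (A $ 1 $ 3)\<^sup>2 - (A $ 2 $ 3)\<^sup>2"
    and "a * b * c = det A"
    by fact+
  have "a\<^sup>2 + b\<^sup>2 + c\<^sup>2 = (a + b + c)\<^sup>2 - 2 * (a * b + b * c + a * c)"
    by (simp add: power2_eq_square algebra_simps)
  also have "\<dots> = (norm A)\<^sup>2"
    unfolding p q norm_matrix using sym[of 2 1] sym[of 3 1] sym[of 3 2]
    by (simp add: sum_3 power2_eq_square algebra_simps)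
  finally show "a\<^sup>2 + b\<^sup>2 + c\<^sup>2 = (norm A)\<^sup>2" .
qed

text \<open>The middle root lies between the two critical points of the cubic, where the cubic decreases.\<close>

lemma middle_root_le_iff:
  fixes a b c q :: real
  assumes ab: "a \<le> b" and bc: "b \<le> c"
  shows "b \<le> q \<longleftrightarrow>
    (a + b + c \<le> 3 * q \<and> 0 \<le> 3 * q\<^sup>2 - 2 * (a + b + c) * q + (a * b + b * c + a * c)) \<or>
    (3 * q\<^sup>2 - 2 * (a + b + c) * q + (a * b + b * c + a * c) \<le> 0 \<and>
      q ^ 3 - (a + b + c) * q\<^sup>2 + (a * b + b * c + a * c) * q - a * b * c \<le> 0)"
proof -
  \<comment> \<open>For the monic cubic p with roots a, b, c, the elementary symmetric functions of
    these shifts are p''(q) / 2, p'(q) and p(q). The claim becomes a sign statement about ordered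
    numbers w \<le> y \<le> x.\<close>
  define x y w where "x = q - a" and "y = q - b" and "w = q - c"
  have D: "3 * q\<^sup>2 - 2 * (a + b + c) * q + (a * b + b * c + a * c) = x * y + y * w + x * w"
    and P: "q ^ 3 - (a + b + c) * q\<^sup>2 + (a * b + b * c + a * c) * q - a * b * c = x * y * w"
    and S: "a + b + c \<le> 3 * q \<longleftrightarrow> 0 \<le> x + y + w"
    and o: "y \<le> x" "w \<le> y"
    using ab bc by (auto simp: x_def y_def w_def power2_eq_square power3_eq_cube algebra_simps)
  have "0 \<le> y \<longleftrightarrow> (0 \<le> x + y + w \<and> 0 \<le> x * y + y * w + x * w) \<or> (x * y + y * w + x * w \<le> 0 \<and> x * y * w \<le> 0)"
  proof
    assume y: "0 \<le> y"
    then have x: "0 \<le> x" using o by simp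
    show "(0 \<le> x + y + w \<and> 0 \<le> x * y + y * w + x * w) \<or> (x * y + y * w + x * w \<le> 0 \<and> x * y * w \<le> 0)"
    proof (cases "0 \<le> w")
      case True
      then show ?thesis using x y by simp
    next
      case False
      then have "x * y * w \<le> 0" using x y by (simp add: mult_nonneg_nonpos)
      moreover have "0 \<le> x + y + w" if D: "0 < x * y + y * w + x * w"
      proof (rule ccontr)
        assume "\<not> 0 \<le> x + y + w"
        then have "(x + y) * w \<le> (x + y) * (- (x + y))" using x y by (intro mult_left_mono) auto
        moreover have "0 \<le> x * x" "0 \<le> y * y" "0 \<le> x * y" using x y by auto
        moreover have "(x + y) * w - (x + y) * (- (x + y)) = (x * y + y * w + x * w) + x * x + y * y + x * y"
          by (simp add: algebra_simps)
        ultimately show False using D by linarith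
      qed
      ultimately show ?thesis by linarith
    qed
  next
    assume R: "(0 \<le> x + y + w \<and> 0 \<le> x * y + y * w + x * w) \<or> (x * y + y * w + x * w \<le> 0 \<and> x * y * w \<le> 0)"
    show "0 \<le> y"
    proof (rule ccontr)
      assume "\<not> 0 \<le> y"
      then have y: "y < 0" "w < 0" using o by auto
      then have yw: "0 < y * w" by (simp add: mult_neg_neg)
      from R show False
      proof
        assume "0 \<le> x + y + w \<and> 0 \<le> x * y + y * w + x * w"
        then have "(- (y + w)) * (- (y + w)) \<le> x * (- (y + w))" "0 \<le> x * y + y * w + x * w"
          using y by (auto intro!: mult_right_mono)
        then have "y * y + w * w + y * w \<le> 0" by (simp add: algebra_simps)
        moreover have "0 \<le> y * y" "0 \<le> w * w" by auto
        ultimately show False using yw by linarith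
      next
        assume h: "x * y + y * w + x * w \<le> 0 \<and> x * y * w \<le> 0"
        then have "x * (y * w) \<le> 0" by (simp add: mult.assoc)
        then have "x \<le> 0" using yw by (metis mult_pos_pos not_le)
        then have "0 \<le> x * y" "0 \<le> x * w" using y by (auto simp: mult_nonpos_nonpos)
        then show False using h yw by linarith
      qed
    qed
  qed
  then show ?thesis unfolding D P S using y_def by auto
qed

text \<open>Expresses that the middle eigenvalue is at most q without mentioning roots, only through
  coefficients of the characteristic polynomial. This gives both the uniqueness of the middle root
  and the measurability of \<open>lambda2\<close>.\<close>

definition middle_le :: "real ^ 3 ^ 3 \<Rightarrow> real \<Rightarrow> bool" where
  "middle_le A q \<longleftrightarrow>
    (let s = A $ 1 $ 1 + A $ 2 $ 2 + A $ 3 $ 3;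
         t = A $ 1 $ 1 * A $ 2 $ 2 + A $ 1 $ 1 * A $ 3 $ 3 + A $ 2 $ 2 * A $ 3 $ 3
       - (A $ 1 $ 2)\<^sup>2 - (A $ 1 $ 3)\<^sup>2 - (A $ 2 $ 3)\<^sup>2
     in (s \<le> 3 * q \<and> 0 \<le> 3 * q\<^sup>2 - 2 * s * q + t) \<or>
        (3 * q\<^sup>2 - 2 * s * q + t \<le> 0 \<and> q ^ 3 - s * q\<^sup>2 + t * q - det A \<le> 0))"

lemma char_roots_middle:
  assumes sym: "\<And>i j. A $ i $ j = A $ j $ i" and r: "char_roots A a b c"
  shows "b \<le> q \<longleftrightarrow> middle_le A q"
  unfolding middle_le_def Let_def char_roots_coeffs[OF sym r, symmetric]
  using r by (intro middle_root_le_iff) (auto simp: char_roots_def)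

lemma lambda2_eq:
  assumes sym: "\<And>i j. A $ i $ j = A $ j $ i" and r: "char_roots A a b c"
  shows "lambda2 A = b"
  unfolding lambda2_def
proof (rule the_equality)
  show "\<exists>a c. a \<le> b \<and> b \<le> c \<and> (\<forall>z. det (mat z - A) = (z - a) * (z - b) * (z - c))"
    using r unfolding char_roots_def by blast
next
  fix b' assume "\<exists>a c. a \<le> b' \<and> b' \<le> c \<and> (\<forall>z. det (mat z - A) = (z - a) * (z - b') * (z - c))"
  then obtain a' c' where "char_roots A a' b' c'" unfolding char_roots_def by blast
  \<comment> \<open>A real number is determined by its upper bounds, and for a middle root these
    depend only on the matrix.\<close>
  then have "b' \<le> q \<longleftrightarrow> b \<le> q" for q
    using char_roots_middle[OF sym] r by blast
  then show "b' = b" by (meson order.antisym order.refl)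
qed

lemma lambda2_le_iff:
  assumes sym: "\<And>i j. A $ i $ j = A $ j $ i"
  shows "lambda2 A \<le> q \<longleftrightarrow> middle_le A q"
proof -
  obtain a b c where r: "char_roots A a b c" using char_roots_exist[OF sym] .
  then show ?thesis using char_roots_middle[OF sym r] lambda2_eq[OF sym r] by simp
qed

lemma abs_lambda2_le_norm:
  assumes sym: "\<And>i j. A $ i $ j = A $ j $ i"
  shows "\<bar>lambda2 A\<bar> \<le> norm A"
proof -
  obtain a b c where r: "char_roots A a b c" using char_roots_exist[OF sym] .
  have "b\<^sup>2 \<le> a\<^sup>2 + b\<^sup>2 + c\<^sup>2" by simp
  then have "b\<^sup>2 \<le> (norm A)\<^sup>2" using char_roots_coeffs(4)[OF sym r] by simp
  then show ?thesis using lambda2_eq[OF sym r] by (simp add: abs_le_square_iff[symmetric])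
qed

text \<open>With a = - b - c, the right side minus the left is 4 b^3 when b is nonnegative. When b
  is negative, a and b are negative and c is positive, so the determinant is nonnegative and the
  right side is 0.\<close>

lemma det_le_lambda2:
  assumes sym: "\<And>i j. A $ i $ j = A $ j $ i" and tr: "A $ 1 $ 1 + A $ 2 $ 2 + A $ 3 $ 3 = 0"
  shows "- 4 * det A \<le> 2 * (max (lambda2 A) 0 * (norm A)\<^sup>2)"
proof -
  obtain a b c where r: "char_roots A a b c" using char_roots_exist[OF sym] .
  note co = char_roots_coeffs[OF sym r]
  have o: "a \<le> b" "b \<le> c" using r by (auto simp: char_roots_def)
  have a: "a = - b - c" using co(1) tr by simp
  show ?thesis
    unfolding co(3)[symmetric] co(4)[symmetric] lambda2_eq[OF sym r]
  proof (cases "0 \<le> b")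
    case True
    have "2 * (b * (a\<^sup>2 + b\<^sup>2 + c\<^sup>2)) - (- 4 * (a * b * c)) = 4 * b * b\<^sup>2"
      unfolding a by (simp add: power2_eq_square algebra_simps)
    moreover have "0 \<le> 4 * b * b\<^sup>2" using True by simp
    ultimately show "- 4 * (a * b * c) \<le> 2 * (max b 0 * (a\<^sup>2 + b\<^sup>2 + c\<^sup>2))"
      unfolding max_absorb1[OF True] by linarith
  next
    case False
    then have "0 \<le> a * b" "0 \<le> c" using o co(1) tr by (auto simp: mult_nonpos_nonpos)
    then have "0 \<le> a * b * c" by simp
    then show "- 4 * (a * b * c) \<le> 2 * (max b 0 * (a\<^sup>2 + b\<^sup>2 + c\<^sup>2))"
      using False by (simp add: max_def)
  qed
qed

lemma borel_measurable_lambda2: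
  fixes f :: "'a \<Rightarrow> real ^ 3 ^ 3"
  assumes f [measurable]: "\<And>i j. (\<lambda>x. f x $ i $ j) \<in> borel_measurable M"
    and sym: "\<And>x i j. f x $ i $ j = f x $ j $ i"
  shows "(\<lambda>x. lambda2 (f x)) \<in> borel_measurable M"
proof (subst borel_measurable_iff_le, rule allI)
  fix q
  have "{x \<in> space M. lambda2 (f x) \<le> q} = {x \<in> space M. middle_le (f x) q}"
    using lambda2_le_iff[OF sym] by simp
  also have "\<dots> \<in> sets M"
    unfolding middle_le_def Let_def det_3 by measurable
  finally show "{x \<in> space M. lambda2 (f x) \<le> q} \<in> sets M" .
qed

section \<open>Fields with absolutely convergent gradient series\<close>

lemma summable_on_square:
  fixes f :: "'a \<Rightarrow> real"
  assumes f: "f summable_on UNIV" and nn: "\<And>k. 0 \<le> f k"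
  shows "(\<lambda>k. (f k)\<^sup>2) summable_on UNIV"
proof (rule summable_on_comparison_test)
  show "(\<lambda>k. infsum f UNIV * f k) summable_on UNIV"
    using f by (rule summable_on_cmult_right)
  show "(f k)\<^sup>2 \<le> infsum f UNIV * f k" for k
    using finite_sum_le_infsum[OF f, of "{k}"] nn
    by (simp add: power2_eq_square mult_right_mono)
qed simp

lemma integrable_bounded_L2_tendsto: "bounded_L2_tendsto f F flt \<Longrightarrow> integrable torus F"
  by (simp add: bounded_L2_tendsto_def L2_tendsto_def L2_integrable)

lemma bounded_L2_tendsto_integral:
  assumes "bounded_L2_tendsto f F flt"
  shows "((\<lambda>i. LINT x|torus. f i x) \<longlongrightarrow> (LINT x|torus. F x)) flt"
  using L2_tendsto_integral_mult[OF _ L2_tendsto_const[OF L2_const[of 1]], of f F flt] assms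
  by (simp add: bounded_L2_tendsto_def)

lemma has_sum_finite_sum:
  fixes f :: "'i \<Rightarrow> 'a \<Rightarrow> 'b :: {topological_comm_monoid_add, t2_space}"
  assumes "\<And>i. i \<in> I \<Longrightarrow> (f i has_sum s i) A"
  shows "((\<lambda>x. \<Sum>i\<in>I. f i x) has_sum (\<Sum>i\<in>I. s i)) A"
  using assms by (induction I rule: infinite_finite_induct) (auto intro: has_sum_add)

lemma trig_zero: "trig (\<lambda>_. 0) A x = 0"
  by (simp add: trig_def)

lemma trig_sum: "(\<Sum>i\<in>I. trig (c i) A x) = trig (\<lambda>k. \<Sum>i\<in>I. c i k) A x"
  unfolding trig_def by (subst sum.swap) (simp only: sum_distrib_right Re_sum)

lemma L2_tendsto_minus:
  assumes "L2_tendsto f F flt"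
  shows "L2_tendsto (\<lambda>i x. - f i x) (\<lambda>x. - F x) flt"
proof -
  have "(- a - - b)\<^sup>2 = (a - b)\<^sup>2" for a b :: real by (simp add: power2_eq_square algebra_simps)
  then show ?thesis using assms by (simp add: L2_tendsto_def L2_minus)
qed

lemma inner_sum_nth: "(a :: real ^ 3) \<bullet> b = (\<Sum>i\<in>UNIV. a $ i * b $ i)"
  by (simp add: inner_vec_def)

lemma grad_nth: "grad u x $ i $ j = weak_deriv j (\<lambda>y. u y $ i) x"
  by (simp add: grad_def)

lemma sum_dsymbol_sq:
  "(\<Sum>j\<in>UNIV. (cmod (dsymbol j k * a))\<^sup>2) = 4 * pi\<^sup>2 * (norm (rvec k))\<^sup>2 * (cmod a)\<^sup>2"
proof -
  have "(\<Sum>j\<in>UNIV. (cmod (dsymbol j k * a))\<^sup>2) = (\<Sum>j\<in>UNIV. (4 * pi\<^sup>2 * (cmod a)\<^sup>2) * (rvec k $ j)\<^sup>2)"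
    by (simp add: dsymbol_def norm_mult power_mult_distrib rvec_nth algebra_simps)
  then show ?thesis
    by (simp add: norm_vector sum_distrib_left[symmetric])
qed

text \<open>The regularity that the cubic integrals use, stated on coefficients: absolutely summable
  series for the field and its gradient give bounded functions, while second derivatives are only
  square summable.\<close>

locale regular_field =
  fixes u :: "real ^ 3 \<Rightarrow> real ^ 3"
  assumes u_L2: "(\<lambda>x. u x $ i) \<in> L2"
    and summable_0: "(\<lambda>k. cmod (fourier u k $ i)) summable_on UNIV"
    and summable_1: "(\<lambda>k. cmod (dsymbol j k * fourier u k $ i)) summable_on UNIV"
    and summable_2: "(\<lambda>k. (cmod (dsymbol l k * (dsymbol j k * fourier u k $ i)))\<^sup>2) summable_on UNIV"
    and div_free: "(\<Sum>i\<in>UNIV. dsymbol i k * fourier u k $ i) = 0"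
begin

abbreviation "du j i \<equiv> weak_deriv j (\<lambda>x. u x $ i)"
abbreviation "ddu l j i \<equiv> weak_deriv l (weak_deriv j (\<lambda>x. u x $ i))"

lemma du_summable: "(\<lambda>k. (cmod (dsymbol j k * sfourier (\<lambda>x. u x $ i) k))\<^sup>2) summable_on UNIV"
  using summable_on_square[OF summable_1] by (simp add: fourier_nth)

lemma du_L2: "du j i \<in> L2"
  and du_sfourier: "sfourier (du j i) k = dsymbol j k * fourier u k $ i"
  using weak_deriv_L2_sfourier[OF u_L2 du_summable] by (simp_all add: fourier_nth)

lemma ddu_summable: "(\<lambda>k. (cmod (dsymbol l k * sfourier (du j i) k))\<^sup>2) summable_on UNIV"
  using summable_2 by (simp add: du_sfourier)

lemma ddu_L2: "ddu l j i \<in> L2"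
  and ddu_sfourier: "sfourier (ddu l j i) k = dsymbol l k * (dsymbol j k * fourier u k $ i)"
  using weak_deriv_L2_sfourier[OF du_L2 ddu_summable] by (simp_all add: du_sfourier)

abbreviation "V A i \<equiv> trig (\<lambda>k. fourier u k $ i) A"
abbreviation "DV A j i \<equiv> trig (\<lambda>k. dsymbol j k * fourier u k $ i) A"
abbreviation "DDV A l j i \<equiv> trig (\<lambda>k. dsymbol l k * (dsymbol j k * fourier u k $ i)) A"

lemma V_lim: "bounded_L2_tendsto (\<lambda>A. V A i) (\<lambda>x. u x $ i) (finite_subsets_at_top UNIV)"
  by (rule trig_bounded_tendsto[OF u_L2 _ summable_0]) (simp add: fourier_nth)

lemma DV_lim: "bounded_L2_tendsto (\<lambda>A. DV A j i) (du j i) (finite_subsets_at_top UNIV)"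
  by (rule trig_bounded_tendsto[OF du_L2 du_sfourier summable_1])

lemma DDV_lim: "L2_tendsto (\<lambda>A. DDV A l j i) (ddu l j i) (finite_subsets_at_top UNIV)"
  by (rule trig_tendsto[OF ddu_L2 ddu_sfourier])

text \<open>The divergence vanishes frequency by frequency, so truncation preserves it for every
  index set; infinite sets give the zero field.\<close>

lemma smooth_truncation: "smooth_div_free (V A) (DV A) (DDV A)"
proof
  show "((\<lambda>s. V A i (x + s *\<^sub>R axis j 1)) has_real_derivative DV A j i x) (at 0)" for i j x
    using trig_deriv[of "\<lambda>k. fourier u k $ i" A x j] by (simp add: dsymbol_def mult.assoc)
  show "((\<lambda>s. DV A j i (x + s *\<^sub>R axis l 1)) has_real_derivative DDV A l j i x) (at 0)" for i j l x
    using trig_deriv[of "\<lambda>k. dsymbol j k * fourier u k $ i" A x l] by (simp add: dsymbol_def mult.assoc)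
  show "DDV A l j i = DDV A j l i" for i j l
    by (simp add: mult.left_commute)
  show "(\<Sum>i\<in>UNIV. DV A i i x) = 0" for x
    by (simp add: trig_sum div_free trig_zero)
  show "(\<Sum>i\<in>UNIV. DDV A l i i x) = 0" for l x
    by (simp add: trig_sum div_free trig_zero flip: sum_distrib_left)
qed (auto intro: continuous_trig periodic_trig)

lemma adv_eq: "advection u u x $ i = (\<Sum>j\<in>UNIV. u x $ j * du j i x)"
  by (simp add: advection_def)

lemma lap_eq: "laplacian u x $ i = (\<Sum>l\<in>UNIV. ddu l l i x)"
  by (simp add: laplacian_def)

lemma adv_lim:
  "bounded_L2_tendsto (\<lambda>A x. \<Sum>j\<in>UNIV. V A j x * DV A j i x) (\<lambda>x. advection u u x $ i) (finite_subsets_at_top UNIV)"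
  unfolding adv_eq by (intro bounded_L2_tendsto_sum bounded_L2_tendsto_mult V_lim DV_lim finite_subsets_at_top_neq_bot)

lemma adv_L2: "(\<lambda>x. advection u u x $ i) \<in> L2"
  using adv_lim by (simp add: bounded_L2_tendsto_def L2_tendsto_def)

lemma lap_lim:
  "L2_tendsto (\<lambda>A x. - (\<Sum>l\<in>UNIV. DDV A l l i x)) (\<lambda>x. - laplacian u x $ i) (finite_subsets_at_top UNIV)"
  unfolding lap_eq by (intro L2_tendsto_minus L2_tendsto_sum DDV_lim)

lemma lap_L2: "(\<lambda>x. - laplacian u x $ i) \<in> L2"
  using lap_lim by (simp add: L2_tendsto_def)

text \<open>With A = \<open>grad u x\<close>, this is tr(A A A^T), and \<open>cube\<close> is
  tr(A^3).\<close>

abbreviation "stretch x \<equiv> (\<Sum>i\<in>UNIV. \<Sum>j\<in>UNIV. \<Sum>l\<in>UNIV. grad u x $ j $ l * grad u x $ i $ j * grad u x $ i $ l)"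
abbreviation "cube x \<equiv> (\<Sum>i\<in>UNIV. \<Sum>j\<in>UNIV. \<Sum>k\<in>UNIV. grad u x $ i $ j * grad u x $ j $ k * grad u x $ k $ i)"

lemma stretch_lim:
  "bounded_L2_tendsto (\<lambda>A x. \<Sum>i\<in>UNIV. \<Sum>j\<in>UNIV. \<Sum>l\<in>UNIV. DV A l j x * DV A j i x * DV A l i x) stretch
     (finite_subsets_at_top UNIV)"
  unfolding grad_nth by (intro bounded_L2_tendsto_sum bounded_L2_tendsto_mult DV_lim finite_subsets_at_top_neq_bot)

lemma cube_lim:
  "bounded_L2_tendsto (\<lambda>A x. \<Sum>i\<in>UNIV. \<Sum>j\<in>UNIV. \<Sum>k\<in>UNIV. DV A j i x * DV A k j x * DV A i k x) cube
     (finite_subsets_at_top UNIV)"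
  unfolding grad_nth by (intro bounded_L2_tendsto_sum bounded_L2_tendsto_mult DV_lim finite_subsets_at_top_neq_bot)

lemma integrable_adv_lap: "integrable torus (\<lambda>x. advection u u x \<bullet> (- laplacian u x))"
  unfolding inner_sum_nth using L2_integrable_mult[OF adv_L2 lap_L2]
  by (intro Bochner_Integration.integrable_sum) simp

text \<open>The truncated advection converges boundedly, the truncated Laplacian only in
  \<open>L2\<close>; this suffices for their product to converge in the mean. The identity for
  truncations then passes to the limit on both sides.\<close>

lemma integral_adv_lap: "(LINT x|torus. advection u u x \<bullet> (- laplacian u x)) = (LINT x|torus. stretch x)"
proof -
  let ?a = "\<lambda>A i x. \<Sum>j\<in>UNIV. V A j x * DV A j i x" and ?l = "\<lambda>A i x. - (\<Sum>l\<in>UNIV. DDV A l l i x)"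
  have "((\<lambda>A. \<Sum>i\<in>UNIV. LINT x|torus. ?a A i x * ?l A i x)
      \<longlongrightarrow> (\<Sum>i\<in>UNIV. LINT x|torus. advection u u x $ i * - laplacian u x $ i)) (finite_subsets_at_top UNIV)"
    using adv_lim lap_lim
    by (intro tendsto_sum L2_tendsto_integral_mult) (simp_all add: bounded_L2_tendsto_def)
  moreover have "(\<Sum>i\<in>UNIV. LINT x|torus. advection u u x $ i * - laplacian u x $ i)
      = (LINT x|torus. advection u u x \<bullet> (- laplacian u x))"
    unfolding inner_sum_nth using L2_integrable_mult[OF adv_L2 lap_L2] by simp
  moreover have "(\<Sum>i\<in>UNIV. LINT x|torus. ?a A i x * ?l A i x)
      = (LINT x|torus. (\<Sum>i\<in>UNIV. \<Sum>j\<in>UNIV. \<Sum>l\<in>UNIV. DV A l j x * DV A j i x * DV A l i x))" for A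
  proof -
    have "?a A i \<in> L2" "?l A i \<in> L2" for i
      using adv_lim[of i] lap_lim[of i] by (simp_all add: bounded_L2_tendsto_def L2_tendsto_def)
    then have "(\<Sum>i\<in>UNIV. LINT x|torus. ?a A i x * ?l A i x) = (LINT x|torus. (\<Sum>i\<in>UNIV. ?a A i x * ?l A i x))"
      by (intro Bochner_Integration.integral_sum[symmetric] L2_integrable_mult)
    then show ?thesis
      using smooth_div_free.integral_adv_laplacian[OF smooth_truncation] by simp
  qed
  ultimately have "((\<lambda>A. LINT x|torus. (\<Sum>i\<in>UNIV. \<Sum>j\<in>UNIV. \<Sum>l\<in>UNIV. DV A l j x * DV A j i x * DV A l i x))
    \<longlongrightarrow> (LINT x|torus. advection u u x \<bullet> (- laplacian u x))) (finite_subsets_at_top UNIV)"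
    by simp
  then show ?thesis
    using bounded_L2_tendsto_integral[OF stretch_lim] tendsto_unique[OF finite_subsets_at_top_neq_bot] by blast
qed

lemma integral_cube: "(LINT x|torus. cube x) = 0"
proof -
  have "((\<lambda>A. 0) \<longlongrightarrow> (LINT x|torus. cube x)) (finite_subsets_at_top (UNIV :: (int ^ 3) set))"
    using bounded_L2_tendsto_integral[OF cube_lim] smooth_div_free.integral_trace_cube[OF smooth_truncation] by simp
  then show ?thesis by (simp add: tendsto_const_iff)
qed

text \<open>The chosen representatives of the weak derivatives are controlled only up to null sets,
  so the matrix identities for trace-free gradients enter the integrals almost everywhere.\<close>

lemma AE_div_free: "AE x in torus. (\<Sum>i\<in>UNIV. grad u x $ i $ i) = 0"
  unfolding grad_nth
proof (rule sfourier_zero_imp_AE_zero)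
  show "(\<lambda>x. \<Sum>i\<in>UNIV. du i i x) \<in> L2" by (intro L2_sum du_L2)
  show "sfourier (\<lambda>x. \<Sum>i\<in>UNIV. du i i x) k = 0" for k
    by (simp add: sfourier_sum du_L2 du_sfourier div_free)
qed

lemma grad_L2: "(\<lambda>x. grad u x $ i $ j) \<in> L2"
  unfolding grad_nth by (rule du_L2)

lemma grad_measurable [measurable]: "(\<lambda>x. grad u x $ i $ j) \<in> borel_measurable torus"
  by (rule L2_measurable[OF grad_L2])

lemma strain_measurable [measurable]: "(\<lambda>x. strain u x $ i $ j) \<in> borel_measurable torus"
  unfolding strain_eq by measurable

lemma integrable_det_strain: "integrable torus (\<lambda>x. det (strain u x))"
  and integral_det_strain: "4 * (LINT x|torus. det (strain u x)) = (LINT x|torus. stretch x)"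
proof -
  have ae: "AE x in torus. det (strain u x) = (stretch x + cube x / 3) / 4"
    using AE_div_free
  proof eventually_elim
    case (elim x)
    then show ?case using det_strain[OF elim] by simp
  qed
  have meas: "(\<lambda>x. det (strain u x)) \<in> borel_measurable torus" "(\<lambda>x. (stretch x + cube x / 3) / 4) \<in> borel_measurable torus"
    unfolding det_3 by measurable
  note ints = integrable_bounded_L2_tendsto[OF stretch_lim] integrable_bounded_L2_tendsto[OF cube_lim]
  show "integrable torus (\<lambda>x. det (strain u x))"
    using ints by (subst integrable_cong_AE[OF meas ae]) (intro integrable_divide Bochner_Integration.integrable_add)
  have "(LINT x|torus. det (strain u x)) = ((LINT x|torus. stretch x) + (LINT x|torus. cube x) / 3) / 4"
    unfolding integral_cong_AE[OF meas ae] integral_divide_zero using ints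
    by (subst Bochner_Integration.integral_add) (auto simp only: integral_divide_zero intro!: integrable_divide)
  then show "4 * (LINT x|torus. det (strain u x)) = (LINT x|torus. stretch x)"
    unfolding integral_cube by simp
qed

lemma vorticity_measurable [measurable]: "(\<lambda>x. vorticity u x $ i) \<in> borel_measurable torus"
proof -
  have "\<forall>i. (\<lambda>x. vorticity u x $ i) \<in> borel_measurable torus"
    unfolding forall_3 vorticity_eq by measurable
  then show ?thesis by simp
qed

lemma integrable_strain_vorticity: "integrable torus (\<lambda>x. strain u x \<bullet> outer (vorticity u x) (vorticity u x))"
  and integral_strain_vorticity:
    "(LINT x|torus. strain u x \<bullet> outer (vorticity u x) (vorticity u x)) = - (LINT x|torus. stretch x)"
proof -
  have ae: "AE x in torus. strain u x \<bullet> outer (vorticity u x) (vorticity u x) = cube x - stretch x"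
    using AE_div_free by eventually_elim (rule strain_vorticity)
  have meas: "(\<lambda>x. strain u x \<bullet> outer (vorticity u x) (vorticity u x)) \<in> borel_measurable torus"
    "(\<lambda>x. cube x - stretch x) \<in> borel_measurable torus"
    unfolding inner_vec_def outer_def by (simp_all add: inner_real_def)
  note ints = integrable_bounded_L2_tendsto[OF stretch_lim] integrable_bounded_L2_tendsto[OF cube_lim]
  show "integrable torus (\<lambda>x. strain u x \<bullet> outer (vorticity u x) (vorticity u x))"
    using ints by (subst integrable_cong_AE[OF meas ae]) (intro Bochner_Integration.integrable_diff)
  have "(LINT x|torus. strain u x \<bullet> outer (vorticity u x) (vorticity u x)) = (LINT x|torus. cube x) - (LINT x|torus. stretch x)"
    unfolding integral_cong_AE[OF meas ae] using ints by (subst Bochner_Integration.integral_diff) auto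
  then show "(LINT x|torus. strain u x \<bullet> outer (vorticity u x) (vorticity u x)) = - (LINT x|torus. stretch x)"
    unfolding integral_cube by simp
qed

lemma integrable_norm_grad: "integrable torus (\<lambda>x. (norm (grad u x))\<^sup>2)"
  unfolding norm_matrix by (intro Bochner_Integration.integrable_sum L2_integrable_square grad_L2)

lemma integrable_norm_strain: "integrable torus (\<lambda>x. (norm (strain u x))\<^sup>2)"
  unfolding norm_strain
  by (intro Bochner_Integration.integrable_add integrable_divide Bochner_Integration.integrable_sum
      integrable_norm_grad L2_integrable_mult grad_L2)

text \<open>On the frequency side the imaginary multipliers of the two factors can be exchanged,
  which turns the double sum into the squared divergence coefficient, namely 0.\<close>

lemma integral_trace_square:
  "(LINT x|torus. (\<Sum>i\<in>UNIV. \<Sum>j\<in>UNIV. grad u x $ i $ j * grad u x $ j $ i)) = 0"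
proof -
  have "((\<lambda>k. \<Sum>i\<in>UNIV. \<Sum>j\<in>UNIV. sfourier (du j i) k \<bullet> sfourier (du i j) k) has_sum
      (\<Sum>i\<in>UNIV. \<Sum>j\<in>UNIV. LINT x|torus. du j i x * du i j x)) UNIV"
    by (intro has_sum_finite_sum Parseval du_L2)
  moreover have "(\<Sum>i\<in>UNIV. \<Sum>j\<in>UNIV. sfourier (du j i) k \<bullet> sfourier (du i j) k) = 0" for k
  proof -
    have "sfourier (du j i) k \<bullet> sfourier (du i j) k = (dsymbol i k * fourier u k $ i) \<bullet> (dsymbol j k * fourier u k $ j)" for i j
      unfolding du_sfourier by (simp add: dsymbol_def inner_complex_def algebra_simps)
    then have "(\<Sum>i\<in>UNIV. \<Sum>j\<in>UNIV. sfourier (du j i) k \<bullet> sfourier (du i j) k)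
      = (\<Sum>i\<in>UNIV. dsymbol i k * fourier u k $ i) \<bullet> (\<Sum>j\<in>UNIV. dsymbol j k * fourier u k $ j)"
      by (simp only: inner_sum_left inner_sum_right) (rule sum.swap)
    then show ?thesis by (simp add: div_free)
  qed
  ultimately have "(\<Sum>i\<in>UNIV. \<Sum>j\<in>UNIV. LINT x|torus. du j i x * du i j x) = 0"
    using has_sum_unique[OF _ has_sum_0[of UNIV "\<lambda>_. 0"]] by fastforce
  then show ?thesis
    unfolding grad_nth using L2_integrable_mult[OF du_L2 du_L2] by (simp add: Bochner_Integration.integral_sum)
qed

lemma L2_norm_eq:
  "1 / 2 * (L2_norm (grad u))\<^sup>2 = (L2_norm (strain u))\<^sup>2"
  "1 / 2 * (L2_norm (vorticity u))\<^sup>2 = (L2_norm (strain u))\<^sup>2"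
proof -
  have tr: "integrable torus (\<lambda>x. \<Sum>i\<in>UNIV. \<Sum>j\<in>UNIV. grad u x $ i $ j * grad u x $ j $ i)"
    by (intro Bochner_Integration.integrable_sum L2_integrable_mult grad_L2)
  have sq: "(L2_norm f)\<^sup>2 = (LINT x|torus. (norm (f x))\<^sup>2)" for f :: "real ^ 3 \<Rightarrow> 'b :: real_normed_vector"
    by (simp add: L2_norm_def)
  have s: "(L2_norm (strain u))\<^sup>2 = (L2_norm (grad u))\<^sup>2 / 2"
    unfolding sq norm_strain using tr integrable_norm_grad integral_trace_square by simp
  have v: "(L2_norm (vorticity u))\<^sup>2 = (L2_norm (grad u))\<^sup>2"
    unfolding sq norm_vorticity using tr integrable_norm_grad integral_trace_square by simp
  show "1 / 2 * (L2_norm (grad u))\<^sup>2 = (L2_norm (strain u))\<^sup>2"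
    "1 / 2 * (L2_norm (vorticity u))\<^sup>2 = (L2_norm (strain u))\<^sup>2"
    using s v by simp_all
qed

lemma AE_grad_bounded: obtains C where "AE x in torus. \<forall>i j. \<bar>grad u x $ i $ j\<bar> \<le> C"
proof -
  have "\<exists>C. AE x in torus. \<bar>grad u x $ i $ j\<bar> \<le> C" for i j
    unfolding grad_nth using bounded_L2_tendsto_AE_bounded[OF DV_lim finite_subsets_at_top_neq_bot] by metis
  then obtain C where C: "\<And>i j. AE x in torus. \<bar>grad u x $ i $ j\<bar> \<le> C i j" by metis
  have "AE x in torus. \<forall>i j. \<bar>grad u x $ i $ j\<bar> \<le> (\<Sum>i\<in>UNIV. \<Sum>j\<in>UNIV. \<bar>C i j\<bar>)"
  proof -
    have "AE x in torus. \<forall>i j. \<bar>grad u x $ i $ j\<bar> \<le> C i j"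
      using C by (simp add: AE_all_countable)
    then show ?thesis
    proof eventually_elim
      case (elim x)
      have "C i j \<le> (\<Sum>i\<in>UNIV. \<Sum>j\<in>UNIV. \<bar>C i j\<bar>)" for i j
      proof -
        have "C i j \<le> \<bar>C i j\<bar>" by simp
        also have "\<dots> \<le> (\<Sum>j\<in>UNIV. \<bar>C i j\<bar>)"
          by (rule member_le_sum) auto
        also have "\<dots> \<le> (\<Sum>i\<in>UNIV. \<Sum>j\<in>UNIV. \<bar>C i j\<bar>)"
          by (rule member_le_sum[of i UNIV "\<lambda>i. \<Sum>j\<in>UNIV. \<bar>C i j\<bar>"]) (auto intro: sum_nonneg)
        finally show ?thesis .
      qed
      then show ?case using elim order_trans by blast
    qed
  qed
  then show ?thesis by (rule that)
qed

lemma lambda2_measurable [measurable]: "(\<lambda>x. lambda2 (strain u x)) \<in> borel_measurable torus"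
  by (rule borel_measurable_lambda2[OF strain_measurable strain_sym])

lemma integrable_lambda2: "integrable torus (\<lambda>x. max (lambda2 (strain u x)) 0 * (norm (strain u x))\<^sup>2)"
proof -
  obtain C where C: "AE x in torus. \<forall>i j. \<bar>grad u x $ i $ j\<bar> \<le> C" by (rule AE_grad_bounded)
  show ?thesis
  \<comment> \<open>Nine entries of absolute value at most C give the strain a norm of at most 3 C,
    which also bounds its middle eigenvalue.\<close>
  proof (rule Bochner_Integration.integrable_bound[OF integrable_mult_right[OF integrable_norm_strain, of "3 * C"]])
    have "(\<lambda>x. (norm (strain u x))\<^sup>2) \<in> borel_measurable torus"
      using integrable_norm_strain by (rule borel_measurable_integrable)
    then show "(\<lambda>x. max (lambda2 (strain u x)) 0 * (norm (strain u x))\<^sup>2) \<in> borel_measurable torus"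
      by measurable
    show "AE x in torus. norm (max (lambda2 (strain u x)) 0 * (norm (strain u x))\<^sup>2)
        \<le> norm (3 * C * (norm (strain u x))\<^sup>2)"
      using C
    proof eventually_elim
      case (elim x)
      have S: "(strain u x $ i $ j)\<^sup>2 \<le> C\<^sup>2" for i j
      proof -
        have "\<bar>grad u x $ i $ j\<bar> \<le> C" "\<bar>grad u x $ j $ i\<bar> \<le> C" using elim by auto
        then have "\<bar>strain u x $ i $ j\<bar> \<le> C" unfolding strain_eq by (auto simp: abs_le_iff field_simps)
        then show ?thesis by (simp add: power2_le_iff_abs_le)
      qed
      have "0 \<le> C" using elim by (meson abs_ge_zero order_trans)
      have "(norm (strain u x))\<^sup>2 \<le> (\<Sum>i\<in>(UNIV :: 3 set). \<Sum>j\<in>(UNIV :: 3 set). C\<^sup>2)"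
        unfolding norm_matrix by (intro sum_mono S)
      also have "\<dots> = (3 * C)\<^sup>2" by (simp add: power2_eq_square)
      finally have "norm (strain u x) \<le> 3 * C"
        by (rule power2_le_imp_le) (use \<open>0 \<le> C\<close> in simp)
      moreover have "\<bar>lambda2 (strain u x)\<bar> \<le> norm (strain u x)"
        by (rule abs_lambda2_le_norm[OF strain_sym])
      ultimately have "max (lambda2 (strain u x)) 0 \<le> 3 * C"
        using \<open>0 \<le> C\<close> by simp
      then have "max (lambda2 (strain u x)) 0 * (norm (strain u x))\<^sup>2 \<le> 3 * C * (norm (strain u x))\<^sup>2"
        by (rule mult_right_mono) simp
      then show ?case using \<open>0 \<le> C\<close> by (simp add: abs_mult)
    qed
  qed
qed

lemma integral_det_le_lambda2:
  "- 4 * (LINT x|torus. det (strain u x)) \<le> 2 * (LINT x|torus. max (lambda2 (strain u x)) 0 * (norm (strain u x))\<^sup>2)"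
proof -
  have "(LINT x|torus. - 4 * det (strain u x)) \<le> (LINT x|torus. 2 * (max (lambda2 (strain u x)) 0 * (norm (strain u x))\<^sup>2))"
  proof (rule integral_mono_AE)
    show "AE x in torus. - 4 * det (strain u x) \<le> 2 * (max (lambda2 (strain u x)) 0 * (norm (strain u x))\<^sup>2)"
      using AE_div_free
    proof eventually_elim
      case (elim x)
      then show ?case
        by (intro det_le_lambda2 strain_sym) (simp add: strain_eq sum_3)
    qed
  qed (use integrable_det_strain integrable_lambda2 in \<open>auto simp del: mult_minus_left\<close>)
  then show ?thesis by simp
qed

lemma norm_grad_has_sum:
  "((\<lambda>k. 4 * pi\<^sup>2 * (norm (rvec k))\<^sup>2 * (norm (fourier u k))\<^sup>2) has_sum (L2_norm (grad u))\<^sup>2) UNIV"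
proof -
  have "((\<lambda>k. \<Sum>i\<in>UNIV. \<Sum>j\<in>UNIV. sfourier (du j i) k \<bullet> sfourier (du j i) k) has_sum
      (\<Sum>i\<in>UNIV. \<Sum>j\<in>UNIV. LINT x|torus. du j i x * du j i x)) UNIV"
    by (intro has_sum_finite_sum Parseval du_L2)
  moreover have "(\<Sum>i\<in>UNIV. \<Sum>j\<in>UNIV. sfourier (du j i) k \<bullet> sfourier (du j i) k)
      = 4 * pi\<^sup>2 * (norm (rvec k))\<^sup>2 * (norm (fourier u k))\<^sup>2" for k
  proof -
    have "(\<Sum>i\<in>UNIV. \<Sum>j\<in>UNIV. sfourier (du j i) k \<bullet> sfourier (du j i) k)
      = (\<Sum>i\<in>UNIV. 4 * pi\<^sup>2 * (norm (rvec k))\<^sup>2 * (cmod (fourier u k $ i))\<^sup>2)"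
      unfolding power2_norm_eq_inner[symmetric] du_sfourier sum_dsymbol_sq ..
    also have "\<dots> = 4 * pi\<^sup>2 * (norm (rvec k))\<^sup>2 * (norm (fourier u k))\<^sup>2"
      by (simp add: power2_norm_eq_inner inner_vec_def sum_distrib_left)
    finally show ?thesis .
  qed
  moreover have "(\<Sum>i\<in>UNIV. \<Sum>j\<in>UNIV. LINT x|torus. du j i x * du j i x) = (L2_norm (grad u))\<^sup>2"
    unfolding L2_norm_def norm_matrix grad_nth using L2_integrable_square[OF du_L2]
    by (simp add: Bochner_Integration.integral_sum sum_nonneg power2_eq_square)
  ultimately show ?thesis by simp
qed

lemma lap_has_sum:
  assumes w: "\<And>i. (\<lambda>x. w x $ i) \<in> L2"
  shows "((\<lambda>k. 4 * pi\<^sup>2 * (norm (rvec k))\<^sup>2 * (fourier u k \<bullet> fourier w k)) has_sum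
     (LINT x|torus. w x \<bullet> (- laplacian u x))) UNIV"
proof -
  have lap: "sfourier (\<lambda>x. - laplacian u x $ i) k = of_real (4 * pi\<^sup>2 * (norm (rvec k))\<^sup>2) * fourier u k $ i" for i k
  proof -
    have "sfourier (\<lambda>x. - laplacian u x $ i) k = - (\<Sum>l\<in>UNIV. dsymbol l k * (dsymbol l k * fourier u k $ i))"
      unfolding lap_eq using sfourier_cmult[of "-1" "\<lambda>x. \<Sum>l\<in>UNIV. ddu l l i x" k]
      by (simp add: sfourier_sum ddu_L2 ddu_sfourier)
    also have "\<dots> = of_real (4 * pi\<^sup>2 * (norm (rvec k))\<^sup>2) * fourier u k $ i"
      unfolding norm_vector rvec_nth by (simp add: sum_3 dsymbol_def power2_eq_square algebra_simps)
    finally show ?thesis .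
  qed
  have "((\<lambda>k. \<Sum>i\<in>UNIV. sfourier (\<lambda>x. - laplacian u x $ i) k \<bullet> sfourier (\<lambda>x. w x $ i) k) has_sum
      (\<Sum>i\<in>UNIV. LINT x|torus. - laplacian u x $ i * w x $ i)) UNIV"
    by (intro has_sum_finite_sum Parseval lap_L2 w)
  moreover have "(\<Sum>i\<in>UNIV. sfourier (\<lambda>x. - laplacian u x $ i) k \<bullet> sfourier (\<lambda>x. w x $ i) k)
      = 4 * pi\<^sup>2 * (norm (rvec k))\<^sup>2 * (fourier u k \<bullet> fourier w k)" for k
    unfolding lap inner_vec_def fourier_nth[symmetric] sum_distrib_left
    by (simp only: inner_scaleR_left flip: scaleR_conv_of_real)
  moreover have "(\<Sum>i\<in>UNIV. LINT x|torus. - laplacian u x $ i * w x $ i) = (LINT x|torus. w x \<bullet> (- laplacian u x))"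
    unfolding inner_sum_nth using L2_integrable_mult[OF lap_L2 w] by (simp add: mult.commute)
  ultimately show ?thesis by simp
qed

end

section \<open>The constraint space\<close>

text \<open>The first entry of each generating vector is the multiple of \<sigma>, which is 2^n at
  level n, plus a positive multiple of a power of 3; a permutation only moves it.\<close>

lemma Mplus_level_coordinate:
  assumes "k \<in> Mplus_level n"
  obtains i where "2 ^ n \<le> k $ i"
proof -
  note found = that
  have perm: thesis if k: "k \<in> perms v" and v: "2 ^ n \<le> v $ 1" for v
  proof -
    obtain p where p: "bij p" "k = (\<chi> i. v $ p i)" using k by (auto simp: perms_def)
    then obtain i where "p i = 1" by (metis bij_pointE)
    with p v have "2 ^ n \<le> k $ i" by simp
    then show thesis by (rule found)
  qed
  show thesis
  proof (cases "even n")
    case True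
    then have "2 ^ n = (2 :: int) ^ (2 * (n div 2))" by simp
    then have "2 ^ n \<le> kfreq (n div 2) $ 1"
      by (simp add: kfreq_def sigma_def)
    then show thesis using assms True perm by (simp add: Mplus_level_def)
  next
    case False
    then have "2 ^ n = (2 :: int) ^ (2 * (n div 2) + 1)" by simp
    then have "2 ^ n \<le> hfreq (n div 2) $ 1" "2 ^ n \<le> jfreq (n div 2) $ 1"
      by (simp_all add: hfreq_def jfreq_def sigma_def)
    then show thesis using assms False perm by (auto simp: Mplus_level_def)
  qed
qed

definition Mlevel :: "nat \<Rightarrow> (int ^ 3) set" where
  "Mlevel n = Mplus_level n \<union> uminus ` Mplus_level n"

lemma Mset_eq: "Mset = (\<Union>n. Mlevel n)"
  by (auto simp: Mset_def Mplus_def Mlevel_def)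

lemma Mlevel_norm:
  assumes "k \<in> Mlevel n"
  shows "4 ^ n \<le> (norm (rvec k))\<^sup>2"
proof -
  obtain i where i: "2 ^ n \<le> \<bar>k $ i\<bar>"
  proof -
    have "k \<in> Mplus_level n \<or> - k \<in> Mplus_level n" using assms by (auto simp: Mlevel_def)
    then show thesis
    proof
      assume "k \<in> Mplus_level n"
      then obtain i where "2 ^ n \<le> k $ i" by (rule Mplus_level_coordinate)
      then show thesis by (intro that[of i]) linarith
    next
      assume "- k \<in> Mplus_level n"
      then obtain i where "2 ^ n \<le> (- k) $ i" by (rule Mplus_level_coordinate)
      then show thesis by (intro that[of i]) simp
    qed
  qed
  have "real_of_int (2 ^ n) \<le> real_of_int \<bar>k $ i\<bar>" using i by (simp only: of_int_le_iff)
  then have "2 ^ n \<le> \<bar>rvec k $ i\<bar>" by (simp add: rvec_nth)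
  also have "\<dots> \<le> norm (rvec k)" by (rule component_le_norm_cart)
  finally have "(2 ^ n)\<^sup>2 \<le> (norm (rvec k))\<^sup>2" by (rule power_mono) simp
  then show ?thesis by (simp add: power2_eq_square flip: power_mult_distrib)
qed

lemma perms_finite_card: "finite (perms v) \<and> card (perms v) \<le> card (UNIV :: (3 \<Rightarrow> 3) set)"
proof -
  have "perms v \<subseteq> (\<lambda>p. \<chi> i. v $ p i) ` UNIV" by (auto simp: perms_def)
  moreover have "card ((\<lambda>p. \<chi> i. v $ p i) ` (UNIV :: (3 \<Rightarrow> 3) set)) \<le> card (UNIV :: (3 \<Rightarrow> 3) set)"
    by (rule card_image_le) simp
  ultimately show ?thesis
    by (meson card_mono finite_imageI finite_class.finite_UNIV finite_subset order_trans)
qed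

text \<open>The factor 4 accounts for two permutation orbits on odd levels and two signs; each orbit
  is bounded crudely by the number of all maps on three indices.\<close>

lemma Mlevel_finite_card:
  "finite (Mlevel n) \<and> card (Mlevel n) \<le> 4 * card (UNIV :: (3 \<Rightarrow> 3) set)"
proof -
  have lev: "finite (Mplus_level n) \<and> card (Mplus_level n) \<le> 2 * card (UNIV :: (3 \<Rightarrow> 3) set)"
    unfolding Mplus_level_def
    using perms_finite_card[of "kfreq (n div 2)"] perms_finite_card[of "hfreq (n div 2)"]
      perms_finite_card[of "jfreq (n div 2)"] card_Un_le[of "perms (hfreq (n div 2))" "perms (jfreq (n div 2))"]
    by auto
  then have "card (uminus ` Mplus_level n) \<le> 2 * card (UNIV :: (3 \<Rightarrow> 3) set)"
    using card_image_le[of "Mplus_level n" uminus] by linarith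
  with lev show ?thesis
    unfolding Mlevel_def using card_Un_le[of "Mplus_level n" "uminus ` Mplus_level n"] by auto
qed

text \<open>The frequency set is lacunary: boundedly many frequencies per level, of geometrically
  growing size. This replaces the Sobolev embedding, and even gives bounded gradients.\<close>

lemma Mset_summable:
  "(\<lambda>k. if k \<in> Mset then 1 / (norm (rvec k))\<^sup>2 else 0) summable_on UNIV"
proof (rule nonneg_bdd_above_summable_on)
  define K where "K = real (4 * card (UNIV :: (3 \<Rightarrow> 3) set))"
  let ?g = "\<lambda>k. if k \<in> Mset then 1 / (norm (rvec k))\<^sup>2 else 0"
  have "sum ?g F \<le> K * (\<Sum>n. (1 / 4) ^ n)" if F: "finite F" for F
  proof -
    define F' where "F' = F \<inter> Mset"
    have F': "finite F'" "sum ?g F = (\<Sum>k\<in>F'. 1 / (norm (rvec k))\<^sup>2)"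
      using F unfolding F'_def by (auto intro: sum.inter_restrict[symmetric])
    have "\<exists>n. k \<in> Mlevel n" if "k \<in> F'" for k using that by (auto simp: F'_def Mset_eq)
    \<comment> \<open>A level is chosen for each frequency, so that grouping by levels does not
      require them to be disjoint.\<close>
    then obtain l where l: "\<And>k. k \<in> F' \<Longrightarrow> k \<in> Mlevel (l k)" by metis
    have "(\<Sum>k\<in>F'. 1 / (norm (rvec k))\<^sup>2) = (\<Sum>n\<in>l ` F'. \<Sum>k\<in>{k\<in>F'. l k = n}. 1 / (norm (rvec k))\<^sup>2)"
      by (rule sum.image_gen[OF F'(1)])
    also have "\<dots> \<le> (\<Sum>n\<in>l ` F'. K * (1 / 4) ^ n)"
    proof (rule sum_mono)
      fix n
      have sub: "{k \<in> F'. l k = n} \<subseteq> Mlevel n" using l by auto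
      have "(\<Sum>k\<in>{k\<in>F'. l k = n}. 1 / (norm (rvec k))\<^sup>2) \<le> (\<Sum>k\<in>{k\<in>F'. l k = n}. (1 / 4) ^ n)"
      proof (rule sum_mono)
        fix k assume "k \<in> {k \<in> F'. l k = n}"
        then have "4 ^ n \<le> (norm (rvec k))\<^sup>2" using sub Mlevel_norm by blast
        then have "1 / (norm (rvec k))\<^sup>2 \<le> 1 / 4 ^ n" using frac_le[of 1 1 "4 ^ n" "(norm (rvec k))\<^sup>2"] by simp
        then show "1 / (norm (rvec k))\<^sup>2 \<le> (1 / 4) ^ n" by (simp add: power_one_over)
      qed
      also have "\<dots> = real (card {k\<in>F'. l k = n}) * (1 / 4) ^ n" by simp
      also have "\<dots> \<le> K * (1 / 4) ^ n"
      proof (rule mult_right_mono)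
        have "card {k\<in>F'. l k = n} \<le> card (Mlevel n)"
          using sub Mlevel_finite_card by (intro card_mono) auto
        also have "\<dots> \<le> 4 * card (UNIV :: (3 \<Rightarrow> 3) set)" using Mlevel_finite_card by blast
        finally show "real (card {k\<in>F'. l k = n}) \<le> K" unfolding K_def by (simp only: of_nat_le_iff)
      qed simp
      finally show "(\<Sum>k\<in>{k\<in>F'. l k = n}. 1 / (norm (rvec k))\<^sup>2) \<le> K * (1 / 4) ^ n" .
    qed
    also have "\<dots> = K * (\<Sum>n\<in>l ` F'. (1 / 4) ^ n)" by (simp only: sum_distrib_left)
    also have "\<dots> \<le> K * (\<Sum>n. (1 / 4) ^ n)"
      using F' by (intro mult_left_mono sum_le_suminf summable_geometric) (auto simp: K_def)
    finally show ?thesis unfolding F'(2) .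
  qed
  then show "bdd_above (sum ?g ` {F. F \<subseteq> UNIV \<and> finite F})"
    by (intro bdd_aboveI[of _ "K * (\<Sum>n. (1 / 4) ^ n)"]) auto
qed simp

lemma L2_component:
  fixes w :: "real ^ 3 \<Rightarrow> real ^ 3"
  assumes w: "w \<in> L2"
  shows "(\<lambda>x. w x $ i) \<in> L2"
  unfolding L2_def
proof (intro CollectI conjI)
  show "periodic (\<lambda>x. w x $ i)" using L2_periodic[OF w] by (simp add: periodic_def)
  show meas: "(\<lambda>x. w x $ i) \<in> borel_measurable borel"
    by (rule borel_measurable_continuous_on[where f = "\<lambda>v. v $ i"]) (intro continuous_intros, rule L2_borel[OF w])
  have [measurable]: "(\<lambda>x. w x $ i) \<in> borel_measurable torus"
    using meas by (rule borel_measurable_torus)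
  have int: "integrable torus (\<lambda>x. (norm (w x))\<^sup>2)" using w by (simp add: L2_def)
  show "integrable torus (\<lambda>x. (norm (w x $ i))\<^sup>2)"
  proof (rule Bochner_Integration.integrable_bound[OF int])
    show "AE x in torus. norm ((norm (w x $ i))\<^sup>2) \<le> norm ((norm (w x))\<^sup>2)"
    proof (rule AE_I2)
      fix x
      have "(norm (w x $ i))\<^sup>2 \<le> (norm (w x))\<^sup>2"
        by (rule power_mono[OF Finite_Cartesian_Product.norm_nth_le]) simp
      then show "norm ((norm (w x $ i))\<^sup>2) \<le> norm ((norm (w x))\<^sup>2)" by simp
    qed
  qed measurable
qed

lemma Hdot_fourier_0:
  assumes "u \<in> Hdot s"
  shows "fourier u 0 = 0"
proof -
  have u: "u \<in> L2" and mean: "(LINT x|torus. u x) = 0" using assms by (auto simp: Hdot_def)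
  have meas: "u \<in> borel_measurable torus" by (rule L2_measurable[OF u])
  have "integrable torus (\<lambda>x. norm (u x))"
    by (rule torus.square_integrable_imp_integrable) (use meas u in \<open>auto simp: L2_def\<close>)
  then have int: "integrable torus u" using meas by (simp add: integrable_norm_iff)
  have "fourier u 0 $ i = 0" for i
  proof -
    have "(LINT x|torus. u x $ i) = (LINT x|torus. u x) $ i"
      by (rule integral_bounded_linear[OF bounded_linear_vec_nth int])
    then show ?thesis by (simp add: fourier_nth sfourier_def mean)
  qed
  then show ?thesis by (simp add: vec_eq_iff)
qed

section \<open>The symbol of the negative Laplacian and regularity of constrained fields\<close>

definition lapsymbol :: "int ^ 3 \<Rightarrow> real" where
  "lapsymbol k = 4 * pi\<^sup>2 * (norm (rvec k))\<^sup>2"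

lemma lapsymbol_nonneg [simp]: "0 \<le> lapsymbol k"
  by (simp add: lapsymbol_def)

lemma lapsymbol_ge_1:
  assumes "k \<noteq> 0"
  shows "1 \<le> lapsymbol k"
proof -
  obtain i where "k $ i \<noteq> 0" using assms by (auto simp: vec_eq_iff)
  then have "1 \<le> \<bar>k $ i\<bar>" by linarith
  then have "real_of_int 1 \<le> real_of_int \<bar>k $ i\<bar>" by (simp only: of_int_le_iff)
  then have "1 \<le> \<bar>rvec k $ i\<bar>" by (simp add: rvec_nth)
  also have "\<dots> \<le> norm (rvec k)" by (rule component_le_norm_cart)
  finally have "1\<^sup>2 \<le> (norm (rvec k))\<^sup>2" by (rule power_mono) simp
  moreover have "1\<^sup>2 \<le> pi\<^sup>2" using pi_gt3 by (intro power_mono) auto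
  ultimately have "1 * 1 \<le> pi\<^sup>2 * (norm (rvec k))\<^sup>2" by (intro mult_mono) auto
  then show ?thesis by (simp add: lapsymbol_def)
qed

lemma Hdot_weight_2: "Hdot_weight 2 u k = (lapsymbol k)\<^sup>2 * (norm (fourier u k))\<^sup>2"
  unfolding Hdot_weight_def lapsymbol_def by (subst powr_numeral) auto

lemma Hdot_2_summable:
  assumes "u \<in> Hdot 2"
  shows "(\<lambda>k. (lapsymbol k)\<^sup>2 * (norm (fourier u k))\<^sup>2) summable_on UNIV"
proof -
  have "(\<lambda>k. (lapsymbol k)\<^sup>2 * (norm (fourier u k))\<^sup>2) summable_on {k. k \<noteq> 0}"
  proof -
    have "Hdot_weight 2 u = (\<lambda>k. (lapsymbol k)\<^sup>2 * (norm (fourier u k))\<^sup>2)"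
      by (simp add: fun_eq_iff Hdot_weight_2)
    then show ?thesis using assms by (simp add: Hdot_def)
  qed
  then show ?thesis
    by (rule summable_on_cong_neutral[THEN iffD1, rotated -1]) (auto simp: lapsymbol_def)
qed

lemma inner_vdir: "rvec k \<bullet> vdir k = 0"
proof (cases "rvec k = 0")
  case False
  then have "rvec k \<bullet> Pperp (rvec k) (rvec sigma) = 0"
    by (simp add: Pperp_def inner_diff_right power2_norm_eq_inner)
  then show ?thesis by (simp add: vdir_def)
qed simp

text \<open>If \<sigma> is parallel to k, division by zero makes \<open>vdir k\<close> the zero
  vector. The projection argument in \<open>inner_projection\<close> works in either case, so the
  dichotomy is enough.\<close>

lemma vdir_unit: "vdir k = 0 \<or> vdir k \<bullet> vdir k = 1"
proof (cases "Pperp (rvec k) (rvec sigma) = 0")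
  case False
  then have "norm (vdir k) = 1" by (simp add: vdir_def)
  then show ?thesis by (simp add: norm_eq_1)
qed (simp add: vdir_def)

lemma cmod_dsymbol: "(cmod (dsymbol j k))\<^sup>2 \<le> lapsymbol k"
proof -
  have "(rvec k $ j)\<^sup>2 \<le> (norm (rvec k))\<^sup>2"
    using power_mono[OF component_le_norm_cart[of "rvec k" j], of 2] by simp
  then have "4 * pi\<^sup>2 * (rvec k $ j)\<^sup>2 \<le> 4 * pi\<^sup>2 * (norm (rvec k))\<^sup>2"
    by (intro mult_left_mono) auto
  then show ?thesis
    by (simp add: dsymbol_def norm_mult power_mult_distrib rvec_nth lapsymbol_def)
qed

text \<open>The product of |k| and the coefficient is split by the arithmetic-geometric inequality
  into the order-2 Sobolev weight and 1/|k|^2, whose sum over the lacunary set converges.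
  Divergence-freeness holds because \<open>vdir k\<close> is orthogonal to k.\<close>

lemma HdotM_regular_field:
  assumes "u \<in> HdotM 2"
  shows "regular_field u"
proof
  have u: "u \<in> Hdot 2" and supp: "\<And>k. k \<notin> Mset \<Longrightarrow> fourier u k = 0"
    and dir: "\<And>k. k \<in> Mset \<Longrightarrow> \<exists>c. fourier u k = c *s cvec (vdir k)"
    using assms by (auto simp: HdotM_def)
  have uL2: "u \<in> L2" using u by (simp add: Hdot_def)
  let ?W = "\<lambda>k. (lapsymbol k)\<^sup>2 * (norm (fourier u k))\<^sup>2"
  let ?g = "\<lambda>k. ?W k + (if k \<in> Mset then 1 / (norm (rvec k))\<^sup>2 else 0)"
  have g: "?g summable_on UNIV"
    by (intro summable_on_add Hdot_2_summable u Mset_summable)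
  have comp: "cmod (fourier u k $ i) \<le> norm (fourier u k)" for k i
    by (rule Finite_Cartesian_Product.norm_nth_le)
  have bound: "sqrt (lapsymbol k) * norm (fourier u k) \<le> ?g k" for k
  proof (cases "k \<in> Mset \<and> k \<noteq> 0")
    case True
    define q n where "q = sqrt (lapsymbol k)" and "n = norm (fourier u k)"
    have q: "q\<^sup>2 = lapsymbol k" "1 \<le> q" using lapsymbol_ge_1[of k] True by (auto simp: q_def)
    \<comment> \<open>q * n is the product of q^2 * n, whose square is the Sobolev weight, and 1 /
      q, whose square is the lacunary term up to a constant.\<close>
    have "2 * (q\<^sup>2 * n) * (1 / q) \<le> (q\<^sup>2 * n)\<^sup>2 + (1 / q)\<^sup>2" by (rule sum_squares_bound)
    moreover have "2 * (q\<^sup>2 * n) * (1 / q) = 2 * (q * n)" using q(2) by (simp add: power2_eq_square)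
    moreover have "0 \<le> q * n" using q by (simp add: n_def)
    ultimately have "q * n \<le> (q\<^sup>2 * n)\<^sup>2 + (1 / q)\<^sup>2" by linarith
    also have "(q\<^sup>2 * n)\<^sup>2 = ?W k" unfolding q(1) n_def by (simp add: power_mult_distrib)
    also have "(1 / q)\<^sup>2 \<le> 1 / (norm (rvec k))\<^sup>2"
    proof -
      have "rvec k \<noteq> 0" using True by (auto simp: vec_eq_iff rvec_def)
      then have pos: "0 < (norm (rvec k))\<^sup>2" by simp
      have "1\<^sup>2 \<le> pi\<^sup>2" by (rule power_mono) (use pi_gt3 in auto)
      then have "1 \<le> 4 * pi\<^sup>2" by simp
      then have "(norm (rvec k))\<^sup>2 \<le> lapsymbol k"
        unfolding lapsymbol_def using mult_right_mono[of 1 "4 * pi\<^sup>2" "(norm (rvec k))\<^sup>2"] by simp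
      then show ?thesis unfolding power_divide q(1) using pos
        by (simp add: frac_le)
    qed
    finally show ?thesis using True by (simp add: q_def n_def)
  next
    case False
    then have "fourier u k = 0" using supp Hdot_fourier_0[OF u] by auto
    then show ?thesis by simp
  qed
  show "(\<lambda>x. u x $ i) \<in> L2" for i by (rule L2_component[OF uL2])
  show "(\<lambda>k. cmod (fourier u k $ i)) summable_on UNIV" for i
  proof (rule summable_on_comparison_test[OF g])
    fix k
    show "cmod (fourier u k $ i) \<le> ?g k"
    proof (cases "k = 0")
      case True
      then show ?thesis by (simp add: Hdot_fourier_0[OF u])
    next
      case False
      then have "1 \<le> sqrt (lapsymbol k)" using lapsymbol_ge_1 by simp
      then have "1 * norm (fourier u k) \<le> sqrt (lapsymbol k) * norm (fourier u k)"
        by (rule mult_right_mono) simp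
      then show ?thesis using comp[of k i] bound[of k] by linarith
    qed
  qed simp
  show "(\<lambda>k. cmod (dsymbol j k * fourier u k $ i)) summable_on UNIV" for i j
  proof (rule summable_on_comparison_test[OF g])
    fix k
    have "cmod (dsymbol j k) \<le> sqrt (lapsymbol k)"
      using cmod_dsymbol by (rule real_le_rsqrt)
    then have "cmod (dsymbol j k * fourier u k $ i) \<le> sqrt (lapsymbol k) * norm (fourier u k)"
      unfolding norm_mult by (intro mult_mono comp) auto
    then show "cmod (dsymbol j k * fourier u k $ i) \<le> ?g k" using bound[of k] by linarith
  qed simp
  show "(\<lambda>k. (cmod (dsymbol l k * (dsymbol j k * fourier u k $ i)))\<^sup>2) summable_on UNIV" for i j l
  proof (rule summable_on_comparison_test[OF Hdot_2_summable[OF u]])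
    fix k
    have "(cmod (fourier u k $ i))\<^sup>2 \<le> (norm (fourier u k))\<^sup>2"
      by (intro power_mono comp) simp
    then have "(cmod (dsymbol l k))\<^sup>2 * ((cmod (dsymbol j k))\<^sup>2 * (cmod (fourier u k $ i))\<^sup>2)
       \<le> lapsymbol k * (lapsymbol k * (norm (fourier u k))\<^sup>2)"
      by (intro mult_mono cmod_dsymbol) auto
    then show "(cmod (dsymbol l k * (dsymbol j k * fourier u k $ i)))\<^sup>2 \<le> ?W k"
      by (simp add: norm_mult power_mult_distrib power2_eq_square[of "lapsymbol k"] mult.assoc)
  qed simp
  show "(\<Sum>i\<in>UNIV. dsymbol i k * fourier u k $ i) = 0" for k
  proof (cases "k \<in> Mset")
    case True
    then obtain c where c: "fourier u k = c *s cvec (vdir k)" using dir by blast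
    have "(\<Sum>i\<in>UNIV. dsymbol i k * fourier u k $ i) = 2 * pi * \<i> * c * of_real (rvec k \<bullet> vdir k)"
      unfolding c inner_vec_def
      by (simp add: dsymbol_def cvec_def rvec_nth sum_distrib_left mult_ac)
    then show ?thesis by (simp add: inner_vdir)
  qed (simp add: supp)
qed

section \<open>Differentiation in time\<close>

text \<open>The bilinear form of the squared gradient norm, on coefficient families instead of
  functions: it is independent of representatives and can be applied to difference
  quotients.\<close>

definition Qform :: "(int ^ 3 \<Rightarrow> complex ^ 3) \<Rightarrow> (int ^ 3 \<Rightarrow> complex ^ 3) \<Rightarrow> real" where
  "Qform c d = (\<Sum>\<^sub>\<infinity>k. lapsymbol k * (c k \<bullet> d k))"

definition Qspace :: "(int ^ 3 \<Rightarrow> complex ^ 3) set" where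
  "Qspace = {c. (\<lambda>k. lapsymbol k * (norm (c k))\<^sup>2) summable_on UNIV}"

lemma Qform_summable:
  assumes "c \<in> Qspace" "d \<in> Qspace"
  shows "(\<lambda>k. lapsymbol k * (c k \<bullet> d k)) summable_on UNIV"
proof -
  have "(\<lambda>k. lapsymbol k * (norm (c k))\<^sup>2 + lapsymbol k * (norm (d k))\<^sup>2) summable_on UNIV"
    using assms by (intro summable_on_add) (auto simp: Qspace_def)
  then have "(\<lambda>k. norm (lapsymbol k * (c k \<bullet> d k))) summable_on UNIV"
  proof (rule summable_on_comparison_test)
    fix k
    have "\<bar>c k \<bullet> d k\<bar> \<le> norm (c k) * norm (d k)" by (rule Cauchy_Schwarz_ineq2)
    also have "\<dots> \<le> (norm (c k))\<^sup>2 + (norm (d k))\<^sup>2"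
      using two_mult_le_squares[of "norm (c k)" "norm (d k)"] by simp
    finally show "norm (lapsymbol k * (c k \<bullet> d k)) \<le> lapsymbol k * (norm (c k))\<^sup>2 + lapsymbol k * (norm (d k))\<^sup>2"
      by (simp add: abs_mult mult_left_mono flip: distrib_left)
  qed simp
  then show ?thesis by (rule abs_summable_summable)
qed

lemma Qspace_iff: "c \<in> Qspace \<longleftrightarrow> (\<lambda>k. lapsymbol k * (c k \<bullet> c k)) summable_on UNIV"
  by (simp add: Qspace_def power2_norm_eq_inner)

lemma Qspace_add:
  assumes "c \<in> Qspace" "d \<in> Qspace"
  shows "(\<lambda>k. c k + d k) \<in> Qspace"
proof -
  have "(\<lambda>k. lapsymbol k * (c k \<bullet> c k) + lapsymbol k * (c k \<bullet> d k) + lapsymbol k * (c k \<bullet> d k)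
      + lapsymbol k * (d k \<bullet> d k)) summable_on UNIV"
    using assms by (intro summable_on_add Qform_summable)
  then show ?thesis
    unfolding Qspace_iff by (simp add: inner_simps inner_commute algebra_simps)
qed

lemma Qspace_scale:
  assumes "c \<in> Qspace"
  shows "(\<lambda>k. s *\<^sub>R c k) \<in> Qspace"
  unfolding Qspace_iff
  using summable_on_cmult_right[OF Qform_summable[OF assms assms], of "s * s"]
  by (simp add: mult_ac)

lemma Qform_add_right:
  assumes "c \<in> Qspace" "d \<in> Qspace" "e \<in> Qspace"
  shows "Qform c (\<lambda>k. d k + e k) = Qform c d + Qform c e"
  unfolding Qform_def using infsum_add[OF Qform_summable[OF assms(1,2)] Qform_summable[OF assms(1,3)]]
  by (simp add: inner_add_right distrib_left)

lemma Qform_scale_right: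
  "Qform c (\<lambda>k. s *\<^sub>R d k) = s * Qform c d"
proof -
  have "Qform c (\<lambda>k. s *\<^sub>R d k) = (\<Sum>\<^sub>\<infinity>k. s * (lapsymbol k * (c k \<bullet> d k)))"
    by (simp add: Qform_def mult_ac)
  also have "\<dots> = s * Qform c d" unfolding Qform_def by (rule infsum_cmult_right')
  finally show ?thesis .
qed

lemma Qform_commute: "Qform c d = Qform d c"
  by (simp add: Qform_def inner_commute)

lemma Qform_nonneg: "0 \<le> Qform c c"
  unfolding Qform_def by (intro infsum_nonneg) simp

lemma Qform_expand:
  assumes c: "c \<in> Qspace" and d: "d \<in> Qspace"
  shows "Qform (\<lambda>k. c k + s *\<^sub>R d k) (\<lambda>k. c k + s *\<^sub>R d k) = Qform c c + 2 * s * Qform c d + s\<^sup>2 * Qform d d"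
proof -
  have sd: "(\<lambda>k. s *\<^sub>R d k) \<in> Qspace" by (rule Qspace_scale[OF d])
  have cs: "(\<lambda>k. c k + s *\<^sub>R d k) \<in> Qspace" by (rule Qspace_add[OF c sd])
  have left: "Qform (\<lambda>k. c k + s *\<^sub>R d k) e = Qform c e + s * Qform d e" if "e \<in> Qspace" for e
    using Qform_add_right[OF that c sd] Qform_scale_right[of e s d] by (simp add: Qform_commute)
  show ?thesis
    unfolding Qform_add_right[OF cs c sd] Qform_scale_right left[OF c] left[OF d]
    by (simp add: Qform_commute[of d c] power2_eq_square algebra_simps)
qed

lemma Qform_Cauchy_Schwarz:
  assumes c: "c \<in> Qspace" and d: "d \<in> Qspace"
  shows "\<bar>Qform c d\<bar> \<le> sqrt (Qform c c) * sqrt (Qform d d)"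
proof -
  have "0 \<le> t\<^sup>2 * Qform d d + 2 * t * Qform c d + Qform c c" for t
    using Qform_expand[OF c d, of t] Qform_nonneg[of "\<lambda>k. c k + t *\<^sub>R d k"] by simp
  then have "(Qform c d)\<^sup>2 \<le> Qform d d * Qform c c"
    by (intro quadratic_nonneg_imp Qform_nonneg)
  then have "sqrt ((Qform c d)\<^sup>2) \<le> sqrt (Qform d d * Qform c c)" by (rule real_sqrt_le_mono)
  then show ?thesis by (simp add: real_sqrt_mult mult.commute)
qed

text \<open>Nonzero integer frequencies have symbol at least 1, so the order-2 norm controls the
  gradient form; the symbol vanishes at frequency 0.\<close>

lemma Hdot_2_Qspace:
  assumes "(\<lambda>k. (lapsymbol k)\<^sup>2 * (norm (c k))\<^sup>2) summable_on UNIV"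
  shows "c \<in> Qspace"
    and "Qform c c \<le> (\<Sum>\<^sub>\<infinity>k\<in>{k. k \<noteq> 0}. (lapsymbol k)\<^sup>2 * (norm (c k))\<^sup>2)"
proof -
  have le: "lapsymbol k * (norm (c k))\<^sup>2 \<le> (lapsymbol k)\<^sup>2 * (norm (c k))\<^sup>2" for k
  proof (cases "k = 0")
    case True
    then show ?thesis by (simp add: lapsymbol_def)
  next
    case False
    then have "lapsymbol k * 1 \<le> lapsymbol k * lapsymbol k"
      using lapsymbol_ge_1 by (intro mult_left_mono) auto
    then show ?thesis by (intro mult_right_mono) (auto simp: power2_eq_square)
  qed
  show c: "c \<in> Qspace"
    unfolding Qspace_def using le by (intro CollectI summable_on_comparison_test[OF assms]) auto
  have "Qform c c = (\<Sum>\<^sub>\<infinity>k. lapsymbol k * (norm (c k))\<^sup>2)"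
    by (simp add: Qform_def power2_norm_eq_inner)
  also have "\<dots> \<le> (\<Sum>\<^sub>\<infinity>k. (lapsymbol k)\<^sup>2 * (norm (c k))\<^sup>2)"
    using c assms le by (intro infsum_mono) (auto simp: Qspace_def)
  also have "\<dots> = (\<Sum>\<^sub>\<infinity>k\<in>{k. k \<noteq> 0}. (lapsymbol k)\<^sup>2 * (norm (c k))\<^sup>2)"
    by (rule infsum_cong_neutral) (auto simp: lapsymbol_def)
  finally show "Qform c c \<le> \<dots>" .
qed

lemma fourier_linear:
  assumes "f \<in> L2" "g \<in> L2" "h \<in> L2"
  shows "fourier (\<lambda>x. s *\<^sub>R (f x - g x) - h x) k = s *\<^sub>R (fourier f k - fourier g k) - fourier h k"
proof (rule vec_eq_iff[THEN iffD2], rule allI)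
  fix i
  note L2 = assms[THEN L2_component, of i]
  have "fourier (\<lambda>x. s *\<^sub>R (f x - g x) - h x) k $ i = sfourier (\<lambda>x. s * (f x $ i - g x $ i) - h x $ i) k"
    by (simp add: fourier_nth)
  also have "\<dots> = of_real s * (sfourier (\<lambda>x. f x $ i) k - sfourier (\<lambda>x. g x $ i) k) - sfourier (\<lambda>x. h x $ i) k"
    using L2 by (simp add: sfourier_diff sfourier_cmult L2_diff L2_cmult)
  also have "\<dots> = (s *\<^sub>R (fourier f k - fourier g k) - fourier h k) $ i"
    by (simp add: fourier_nth scaleR_conv_of_real[where 'a = complex])
  finally show "fourier (\<lambda>x. s *\<^sub>R (f x - g x) - h x) k $ i = (s *\<^sub>R (fourier f k - fourier g k) - fourier h k) $ i" .
qed

lemma square_weight_summable_add: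
  fixes c d :: "int ^ 3 \<Rightarrow> complex ^ 3"
  assumes "(\<lambda>k. (lapsymbol k)\<^sup>2 * (norm (c k))\<^sup>2) summable_on UNIV"
    and "(\<lambda>k. (lapsymbol k)\<^sup>2 * (norm (d k))\<^sup>2) summable_on UNIV"
  shows "(\<lambda>k. (lapsymbol k)\<^sup>2 * (norm (s *\<^sub>R c k + t *\<^sub>R d k))\<^sup>2) summable_on UNIV"
proof (rule summable_on_comparison_test)
  show "(\<lambda>k. 2 * s\<^sup>2 * ((lapsymbol k)\<^sup>2 * (norm (c k))\<^sup>2) + 2 * t\<^sup>2 * ((lapsymbol k)\<^sup>2 * (norm (d k))\<^sup>2)) summable_on UNIV"
    using assms by (intro summable_on_add summable_on_cmult_right)
  fix k
  have "(norm (s *\<^sub>R c k + t *\<^sub>R d k))\<^sup>2 \<le> (norm (s *\<^sub>R c k) + norm (t *\<^sub>R d k))\<^sup>2"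
    by (intro power_mono norm_triangle_ineq) simp
  also have "\<dots> \<le> 2 * (norm (s *\<^sub>R c k))\<^sup>2 + 2 * (norm (t *\<^sub>R d k))\<^sup>2"
    using sum_squares_bound[of "norm (s *\<^sub>R c k)" "norm (t *\<^sub>R d k)"] by (simp add: power2_sum)
  finally have "(lapsymbol k)\<^sup>2 * (norm (s *\<^sub>R c k + t *\<^sub>R d k))\<^sup>2
    \<le> (lapsymbol k)\<^sup>2 * (2 * (norm (s *\<^sub>R c k))\<^sup>2 + 2 * (norm (t *\<^sub>R d k))\<^sup>2)"
    by (rule mult_left_mono) simp
  then show "(lapsymbol k)\<^sup>2 * (norm (s *\<^sub>R c k + t *\<^sub>R d k))\<^sup>2
    \<le> 2 * s\<^sup>2 * ((lapsymbol k)\<^sup>2 * (norm (c k))\<^sup>2) + 2 * t\<^sup>2 * ((lapsymbol k)\<^sup>2 * (norm (d k))\<^sup>2)"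
    by (simp add: power_mult_distrib algebra_simps)
qed simp

lemma Qform_fourier:
  assumes "u \<in> HdotM 2"
  shows "fourier u \<in> Qspace" "Qform (fourier u) (fourier u) = (L2_norm (grad u))\<^sup>2"
proof -
  have u: "u \<in> Hdot 2" using assms by (simp add: HdotM_def)
  show "fourier u \<in> Qspace" by (rule Hdot_2_Qspace[OF Hdot_2_summable[OF u]])
  interpret regular_field u by (rule HdotM_regular_field[OF assms])
  show "Qform (fourier u) (fourier u) = (L2_norm (grad u))\<^sup>2"
    unfolding Qform_def
    by (rule infsumI) (use norm_grad_has_sum in \<open>simp add: lapsymbol_def power2_norm_eq_inner\<close>)
qed

text \<open>Differentiation of a quadratic form along a curve: expand it at the coefficients at time
  t, with the remainder of the difference quotient tending to 0 in the gradient form because it does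
  so in the stronger order-2 norm.\<close>

lemma norm_grad_deriv:
  assumes C1: "C1_HdotM 2 T u u'" and t: "t \<in> time_interval T"
  shows "((\<lambda>r. (L2_norm (grad (u r)))\<^sup>2) has_real_derivative 2 * Qform (fourier (u t)) (fourier (u' t)))
     (at t within time_interval T)"
proof -
  let ?I = "time_interval T"
  have u: "u r \<in> HdotM 2" "u' r \<in> HdotM 2" if "r \<in> ?I" for r
    using C1 that by (auto simp: C1_HdotM_def)
  have H: "u r \<in> Hdot 2" "u' r \<in> Hdot 2" "u r \<in> L2" "u' r \<in> L2" if "r \<in> ?I" for r
    using u[OF that] by (auto simp: HdotM_def Hdot_def)
  define a where "a r = fourier (u r)" for r
  define b where "b = fourier (u' t)"
  define N where "N r = Hdot_norm 2 (\<lambda>x. (1 / (r - t)) *\<^sub>R (u r x - u t x) - u' t x)" for r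
  \<comment> \<open>The difference quotient minus the derivative.\<close>
  define w where "w r k = (1 / (r - t)) *\<^sub>R (a r k - a t k) - b k" for r k
  have N: "(N \<longlongrightarrow> 0) (at t within ?I)"
    using C1 t unfolding C1_HdotM_def N_def by blast
  have Qa: "a r \<in> Qspace" "Qform (a r) (a r) = (L2_norm (grad (u r)))\<^sup>2" if "r \<in> ?I" for r
    using Qform_fourier[OF u(1)[OF that]] by (simp_all add: a_def)
  have Qb: "b \<in> Qspace" using Qform_fourier[OF u(2)[OF t]] by (simp add: b_def)
  have Qw: "w r \<in> Qspace" "Qform (w r) (w r) \<le> (N r)\<^sup>2" if r: "r \<in> ?I" for r
  proof -
    have fw: "fourier (\<lambda>x. (1 / (r - t)) *\<^sub>R (u r x - u t x) - u' t x) = w r"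
      using H[OF r] H[OF t] by (auto simp: fun_eq_iff fourier_linear w_def a_def b_def)
    note s = Hdot_2_summable[OF H(1)[OF r]] Hdot_2_summable[OF H(1)[OF t]] Hdot_2_summable[OF H(2)[OF t]]
    \<comment> \<open>Rewritten as a nested combination of two terms, the form that
      \<open>square_weight_summable_add\<close> handles.\<close>
    have eq: "w r k = 1 *\<^sub>R ((1 / (r - t)) *\<^sub>R a r k + (- (1 / (r - t))) *\<^sub>R a t k) + (- 1) *\<^sub>R b k" for k
      by (simp add: w_def algebra_simps)
    have sw: "(\<lambda>k. (lapsymbol k)\<^sup>2 * (norm (w r k))\<^sup>2) summable_on UNIV"
      unfolding eq using s unfolding a_def[symmetric] b_def[symmetric]
      by (intro square_weight_summable_add)
    show "w r \<in> Qspace" by (rule Hdot_2_Qspace[OF sw])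
    have "(N r)\<^sup>2 = (\<Sum>\<^sub>\<infinity>k\<in>{k. k \<noteq> 0}. (lapsymbol k)\<^sup>2 * (norm (w r k))\<^sup>2)"
      unfolding N_def Hdot_norm_def Hdot_weight_2 fw by (rule real_sqrt_pow2) (auto intro!: infsum_nonneg)
    then show "Qform (w r) (w r) \<le> (N r)\<^sup>2" using Hdot_2_Qspace(2)[OF sw] by simp
  qed
  have N_nonneg: "0 \<le> N r" for r
    unfolding N_def Hdot_norm_def Hdot_weight_2 by (auto intro!: infsum_nonneg)
  define E where "E r = (L2_norm (grad (u r)))\<^sup>2" for r
  define K where "K = sqrt (Qform (a t) (a t))"
  have bound: "\<bar>(E r - E t) / (r - t) - 2 * Qform (a t) b\<bar>
      \<le> 2 * K * N r + \<bar>r - t\<bar> * (sqrt (Qform b b) + N r)\<^sup>2" if r: "r \<in> ?I" "r \<noteq> t" for r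
  proof -
    \<comment> \<open>The difference quotient itself. The scalar 1 matches the shape of
      \<open>Qform_expand\<close>, used below for both \<open>a r\<close> and d.\<close>
    define d where "d k = b k + 1 *\<^sub>R w r k" for k
    have d: "d \<in> Qspace" unfolding d_def using Qb Qw(1)[OF r(1)] by (simp add: Qspace_add)
    have ar: "a r = (\<lambda>k. a t k + (r - t) *\<^sub>R d k)"
      using r(2) by (simp add: fun_eq_iff d_def w_def)
    have "E r = Qform (a r) (a r)" using Qa(2)[OF r(1)] by (simp add: E_def)
    also have "\<dots> = E t + 2 * (r - t) * Qform (a t) d + (r - t)\<^sup>2 * Qform d d"
      unfolding ar using Qform_expand[OF Qa(1)[OF t] d] Qa(2)[OF t] by (simp add: E_def)
    finally have "(E r - E t) / (r - t) = 2 * Qform (a t) d + (r - t) * Qform d d"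
      using r(2) by (simp add: field_simps power2_eq_square)
    moreover have "Qform (a t) d = Qform (a t) b + Qform (a t) (w r)"
      unfolding d_def using Qform_add_right[OF Qa(1)[OF t] Qb Qw(1)[OF r(1)]] by simp
    ultimately have e: "(E r - E t) / (r - t) - 2 * Qform (a t) b = 2 * Qform (a t) (w r) + (r - t) * Qform d d"
      by simp
    have sqN: "sqrt (Qform (w r) (w r)) \<le> N r"
      using real_sqrt_le_mono[OF Qw(2)[OF r(1)]] N_nonneg by simp
    have "\<bar>Qform (a t) (w r)\<bar> \<le> K * sqrt (Qform (w r) (w r))"
      unfolding K_def by (rule Qform_Cauchy_Schwarz[OF Qa(1)[OF t] Qw(1)[OF r(1)]])
    also have "\<dots> \<le> K * N r"
      using sqN by (intro mult_left_mono) (auto simp: K_def Qform_nonneg)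
    finally have 1: "\<bar>Qform (a t) (w r)\<bar> \<le> K * N r" .
    have "Qform d d = Qform b b + 2 * Qform b (w r) + Qform (w r) (w r)"
      unfolding d_def using Qform_expand[OF Qb Qw(1)[OF r(1)], of 1] by simp
    also have "\<dots> \<le> Qform b b + 2 * (sqrt (Qform b b) * N r) + (N r)\<^sup>2"
    proof -
      have "Qform b (w r) \<le> sqrt (Qform b b) * sqrt (Qform (w r) (w r))"
        using Qform_Cauchy_Schwarz[OF Qb Qw(1)[OF r(1)]] by simp
      also have "\<dots> \<le> sqrt (Qform b b) * N r"
        using sqN by (intro mult_left_mono) (auto simp: Qform_nonneg)
      finally show ?thesis using Qw(2)[OF r(1)] by simp
    qed
    also have "\<dots> = (sqrt (Qform b b) + N r)\<^sup>2"
      by (simp add: power2_sum Qform_nonneg)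
    finally have 2: "\<bar>r - t\<bar> * Qform d d \<le> \<bar>r - t\<bar> * (sqrt (Qform b b) + N r)\<^sup>2"
      by (rule mult_left_mono) simp
    have "\<bar>(r - t) * Qform d d\<bar> = \<bar>r - t\<bar> * Qform d d"
      by (simp add: abs_mult Qform_nonneg)
    then show ?thesis unfolding e using 1 2 by linarith
  qed
  have lim: "((\<lambda>r. 2 * K * N r + \<bar>r - t\<bar> * (sqrt (Qform b b) + N r)\<^sup>2) \<longlongrightarrow>
      2 * K * 0 + \<bar>t - t\<bar> * (sqrt (Qform b b) + 0)\<^sup>2) (at t within ?I)"
    by (intro tendsto_intros N)
  have "((\<lambda>r. (E r - E t) / (r - t) - 2 * Qform (a t) b) \<longlongrightarrow> 0) (at t within ?I)"
  proof (rule Lim_null_comparison)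
    show "\<forall>\<^sub>F r in at t within ?I. norm ((E r - E t) / (r - t) - 2 * Qform (a t) b)
        \<le> 2 * K * N r + \<bar>r - t\<bar> * (sqrt (Qform b b) + N r)\<^sup>2"
      unfolding eventually_at_filter using bound by (intro always_eventually) auto
  qed (use lim in simp)
  then have "((\<lambda>r. (E r - E t) / (r - t)) \<longlongrightarrow> 2 * Qform (a t) b) (at t within ?I)"
    by (rule LIM_zero_cancel)
  then show ?thesis
    unfolding has_field_derivative_iff E_def a_def b_def .
qed

text \<open>The projection onto a line is self-adjoint and fixes vectors on that line, so it
  disappears when paired with one of them.\<close>

lemma inner_projection:
  fixes f :: "complex ^ 3"
  shows "(c *s cvec (vdir k)) \<bullet> ((\<Sum>i\<in>UNIV. of_real (vdir k $ i) * f $ i) *s cvec (vdir k)) = (c *s cvec (vdir k)) \<bullet> f"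
proof -
  let ?s = "\<Sum>i\<in>UNIV. of_real (vdir k $ i) * f $ i"
  have "(c *s cvec (vdir k)) \<bullet> (?s *s cvec (vdir k)) = (vdir k \<bullet> vdir k) * (c \<bullet> ?s)"
    unfolding inner_vec_def sum_distrib_right
    by (simp add: cvec_def inner_complex_def algebra_simps)
  moreover have "(c *s cvec (vdir k)) \<bullet> f = c \<bullet> ?s"
    unfolding inner_vec_def inner_sum_right
    by (simp add: cvec_def inner_complex_def algebra_simps)
  moreover have "c \<bullet> ?s = 0" if "vdir k = 0" using that by simp
  ultimately show ?thesis using vdir_unit[of k] by auto
qed

lemma Qform_solution:
  assumes u: "u \<in> HdotM 2" and u': "u' \<in> HdotM 2"
    and N: "is_projM (advection u u) N" and eq: "AE x in torus. u' x + N x = 0"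
  shows "Qform (fourier u) (fourier u') = - L2_inner (advection u u) (\<lambda>x. - laplacian u x)"
proof -
  interpret regular_field u by (rule HdotM_regular_field[OF u])
  let ?w = "advection u u"
  have u'L2: "u' \<in> L2" using u' by (simp add: HdotM_def Hdot_def)
  have NL2: "N \<in> L2" using N by (simp add: is_projM_def)
  have u'hat: "fourier u' k = - fourier N k" for k
  proof (rule vec_eq_iff[THEN iffD2], rule allI)
    fix i
    have "sfourier (\<lambda>x. u' x $ i) k = sfourier (\<lambda>x. - 1 * N x $ i) k"
    proof (rule sfourier_cong_AE)
      show "AE x in torus. u' x $ i = - 1 * N x $ i"
        using eq by eventually_elim (simp add: eq_neg_iff_add_eq_0 vec_eq_iff)
    qed (use L2_component[OF u'L2] L2_cmult[OF L2_component[OF NL2], of "-1"] in auto)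
    then show "fourier u' k $ i = (- fourier N k) $ i"
      unfolding sfourier_cmult by (simp add: fourier_nth)
  qed
  have inner: "fourier u k \<bullet> fourier u' k = - (fourier u k \<bullet> fourier ?w k)" for k
  proof (cases "k \<in> Mset")
    case True
    then obtain c where c: "fourier u k = c *s cvec (vdir k)" using u by (auto simp: HdotM_def)
    have "fourier N k = (\<Sum>i\<in>UNIV. of_real (vdir k $ i) * fourier ?w k $ i) *s cvec (vdir k)"
      using N True by (simp add: is_projM_def)
    then show ?thesis unfolding u'hat c by (simp add: inner_projection)
  next
    case False
    then have "fourier u k = 0" using u by (simp add: HdotM_def)
    then show ?thesis by simp
  qed
  have "((\<lambda>k. lapsymbol k * (fourier u k \<bullet> fourier ?w k)) has_sum
     (LINT x|torus. ?w x \<bullet> (- laplacian u x))) UNIV"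
    unfolding lapsymbol_def by (rule lap_has_sum[OF adv_L2])
  then have "((\<lambda>k. - (lapsymbol k * (fourier u k \<bullet> fourier ?w k))) has_sum
     - (LINT x|torus. ?w x \<bullet> (- laplacian u x))) UNIV"
    by (simp add: has_sum_uminus)
  then have "((\<lambda>k. lapsymbol k * (fourier u k \<bullet> fourier u' k)) has_sum
     - (LINT x|torus. ?w x \<bullet> (- laplacian u x))) UNIV"
    by (simp add: inner)
  then show ?thesis unfolding Qform_def L2_inner_def by (rule infsumI)
qed

theorem propositionC5:
  fixes Tmax :: ereal and u :: "real \<Rightarrow> real ^ 3 \<Rightarrow> real ^ 3"
  assumes "0 < Tmax"
    and "restricted_Euler_solution 2 Tmax u"
  shows "\<forall>t\<in>time_interval Tmax.
    1 / 2 * (L2_norm (grad (u t)))\<^sup>2 = (L2_norm (strain (u t)))\<^sup>2 \<and>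
    1 / 2 * (L2_norm (vorticity (u t)))\<^sup>2 = (L2_norm (strain (u t)))\<^sup>2 \<and>
    integrable torus (\<lambda>x. advection (u t) (u t) x \<bullet> (- laplacian (u t) x)) \<and>
    ((\<lambda>r. 1 / 2 * (L2_norm (grad (u r)))\<^sup>2) has_real_derivative
        - L2_inner (advection (u t) (u t)) (\<lambda>x. - laplacian (u t) x))
      (at t within time_interval Tmax) \<and>
    integrable torus
      (\<lambda>x. strain (u t) x \<bullet> outer (vorticity (u t) x) (vorticity (u t) x)) \<and>
    ((\<lambda>r. 1 / 2 * (L2_norm (vorticity (u r)))\<^sup>2) has_real_derivative
        L2_inner (strain (u t)) (\<lambda>x. outer (vorticity (u t) x) (vorticity (u t) x)))
      (at t within time_interval Tmax) \<and>
    integrable torus (\<lambda>x. det (strain (u t) x)) \<and>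
    ((\<lambda>r. (L2_norm (strain (u r)))\<^sup>2) has_real_derivative
        - 4 * (LINT x|torus. det (strain (u t) x)))
      (at t within time_interval Tmax) \<and>
    integrable torus (\<lambda>x. max (lambda2 (strain (u t) x)) 0 * (norm (strain (u t) x))\<^sup>2) \<and>
    (\<exists>D. ((\<lambda>r. (L2_norm (strain (u r)))\<^sup>2) has_real_derivative D)
           (at t within time_interval Tmax) \<and>
         D \<le> 2 * (LINT x|torus. max (lambda2 (strain (u t) x)) 0 * (norm (strain (u t) x))\<^sup>2))"
proof (rule ballI, goal_cases)
  case (1 t)
  note t = this
  let ?I = "time_interval Tmax"
  obtain u' where C1: "C1_HdotM 2 Tmax u u'"
    and euler: "\<And>r. r \<in> ?I \<Longrightarrow> \<exists>N. is_projM (advection (u r) (u r)) N \<and> (AE x in torus. u' r x + N x = 0)"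
    using assms(2) by (auto simp: restricted_Euler_solution_def)
  have M: "u r \<in> HdotM 2" "u' r \<in> HdotM 2" if "r \<in> ?I" for r
    using C1 that by (auto simp: C1_HdotM_def)
  interpret regular_field "u t" by (rule HdotM_regular_field[OF M(1)[OF t]])
  have eqs: "1 / 2 * (L2_norm (grad (u r)))\<^sup>2 = (L2_norm (strain (u r)))\<^sup>2"
    "1 / 2 * (L2_norm (vorticity (u r)))\<^sup>2 = (L2_norm (strain (u r)))\<^sup>2" if "r \<in> ?I" for r
    using regular_field.L2_norm_eq[OF HdotM_regular_field[OF M(1)[OF that]]] by auto
  \<comment> \<open>The common value of all three derivatives.\<close>
  define D where "D = - (LINT x|torus. stretch x)"
  have adv: "L2_inner (advection (u t) (u t)) (\<lambda>x. - laplacian (u t) x) = (LINT x|torus. stretch x)"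
    unfolding L2_inner_def by (rule integral_adv_lap)
  obtain N where "is_projM (advection (u t) (u t)) N" "AE x in torus. u' t x + N x = 0"
    using euler[OF t] by blast
  then have Q: "Qform (fourier (u t)) (fourier (u' t)) = D"
    using Qform_solution[OF M[OF t]] adv by (simp add: D_def)
  have grad: "((\<lambda>r. 1 / 2 * (L2_norm (grad (u r)))\<^sup>2) has_real_derivative D) (at t within ?I)"
    using DERIV_cmult[OF norm_grad_deriv[OF C1 t], of "1 / 2"] by (simp add: Q)
  \<comment> \<open>The two functions agree at all times of the interval, so the derivative carries
    over, including the one-sided one at 0; the radius 1 is arbitrary.\<close>
  have strain: "((\<lambda>r. (L2_norm (strain (u r)))\<^sup>2) has_real_derivative D) (at t within ?I)"
    by (rule has_field_derivative_transform_within[OF grad zero_less_one t]) (simp only: eqs)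
  have vort: "((\<lambda>r. 1 / 2 * (L2_norm (vorticity (u r)))\<^sup>2) has_real_derivative D) (at t within ?I)"
    by (rule has_field_derivative_transform_within[OF strain zero_less_one t]) (simp only: eqs)
  have D: "D = - L2_inner (advection (u t) (u t)) (\<lambda>x. - laplacian (u t) x)"
    "D = L2_inner (strain (u t)) (\<lambda>x. outer (vorticity (u t) x) (vorticity (u t) x))"
    "D = - 4 * (LINT x|torus. det (strain (u t) x))"
    using adv integral_strain_vorticity integral_det_strain by (simp_all add: D_def L2_inner_def)
  show ?case
    using eqs[OF t] integrable_adv_lap grad integrable_strain_vorticity vort integrable_det_strain
      strain integrable_lambda2 integral_det_le_lambda2
    unfolding D(1)[symmetric] D(2)[symmetric] D(3)[symmetric] by blast
qed

end
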